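(* Let $\mathbf{k}$ be a field and let $F$ be a finitely generated $\Delta$-module over $\mathbf{k}$. Then $F$ is noetherian, and the Hilbert series $\mathrm{H}'_F(\mathbf{m})$ is a polynomial in the $m_\lambda$ and the $e^{m_\lambda}$.
   Context: $\mathrm{Vec}$ is the category of finite-dimensional $\mathbf{k}$-vector spaces. A (strict) polynomial functor $F\colon\mathrm{Vec}^n\to\mathrm{Vec}$ is a functor such that for all $(V_i),(W_i)$ the map $\prod_i\mathrm{Hom}(V_i,W_i)\to\mathrm{Hom}(F(V_1,\dots,V_n),F(W_1,\dots,W_n))$ is given by polynomial functions of degree bounded independently of the $V_i,W_i$ (if $\mathbf{k}$ is finite, the polynomials are part of the data, in the usual Friedlander–Suslin sense, and maps and subfunctors are required to be compatible with them). $\mathrm{Vec}^\Delta$ is the category whose objects are finite families $\{V_i\}_{i\in I}$ of finite-dimensional vector spaces; a morphism $\{V_i\}_{i\in I}\to\{W_j\}_{j\in J}$ is a surjection $f\colon J\to I$ together with, for each $i\in I$, a linear map $\eta_i\colon V_i\to\bigotimes_{f(j)=i}W_j$. A $\Delta$-module is a functor $F\colon\mathrm{Vec}^\Delta\to\mathrm{Vec}$ such that for each $n\ge 0$ the functor $F_n\colon\mathrm{Vec}^n\to\mathrm{Vec}$, $(V_1,\dots,V_n)\mapsto F(\{V_i\}_{i\in[n]})$, is polynomial. Equivalently, $F$ is a sequence $(F_n)_{n\ge0}$ of $S_n$-equivariant polynomial functors $\mathrm{Vec}^n\to\mathrm{Vec}$ with natural transition maps $F_n(V_1,\dots,V_{n-1},V_n\otimes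 V_{n+1})\to F_{n+1}(V_1,\dots,V_{n+1})$ satisfying the evident compatibilities. An element of $F$ is an element of some $F(\{V_i\})$; $F$ is finitely generated if it is the smallest $\Delta$-submodule containing some finite set of its elements; $F$ is noetherian if every $\Delta$-submodule of $F$ is finitely generated. $\Lambda$ is the ring of symmetric functions, with $\mathbf{Z}$-basis the monomial symmetric functions $m_\lambda$ ($\lambda$ ranging over all partitions, including the empty one). For a polynomial functor $G\colon\mathrm{Vec}^n\to\mathrm{Vec}$ of finite length, let $V=G(\mathbf{k}^\infty,\dots,\mathbf{k}^\infty)$ be the direct limit of the $G(\mathbf{k}^N,\dots,\mathbf{k}^N)$ along standard inclusions, a polynomial representation of $\mathrm{GL}(\infty)^n$; for partitions $\lambda_1,\dots,\lambda_n$ let $V_{\lambda_1,\dots,\lambda_n}$ be the weight space on which the diagonal torus of the $j$th factor acts with weight $\lambda_j$ (weights in the algebraic/scheme sense). Let $\mathrm{ch}(G)$ be the image in $\mathrm{Sym}^n(\Lambda)$ of $\sum_{(\lambda_1,\dots,\lambda_n)}\dim_{\mathbf{k}}(V_{\lambda_1,\dots,\lambda_n})\,m_{\lambda_1}\otimes\cdots\otimes m_{\lambda_n}\in\Lambda^{\otimes n}$; it is a homogeneous polynomial of degree $n$ in the $m_\lambda$, regarded as independent variables. For a $\Delta$-module $F$ with every $F_n$ of finite length (automatic when $F$ is finitely generated), $\mathrm{H}'_F(\mathbf{m})=\sum_{n\ge0}\frac{\mathrm{ch}(F_n)}{n!}\in\prod_{n\ge0}\mathrm{Sym}^n(\Lambda\otimes\mathbf{Q})$,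 a formal power series over $\mathbf{Q}$ in the variables $m_\lambda$. "Polynomial" means polynomial with rational coefficients in finitely many of the $m_\lambda$ and the power series $e^{m_\lambda}$. *)

theory Defs
  imports "HOL-Library.Poly_Mapping" "HOL-Library.FuncSet" "HOL-Library.Function_Algebras" Complex_Main
begin

section \<open>The category \<open>Vec\<^sup>\<Delta>\<close>\<close>

text \<open>
  The objects of \<open>Vec\<^sup>\<Delta>\<close> are the families \<open>(k\<^sup>d\<^sup>0, \<dots>, k\<^sup>d\<^sup>n\<^sup>-\<^sup>1)\<close> of coordinate spaces,
  one for each list \<open>V = [d\<^sub>0, \<dots>, d\<^sub>n\<^sub>-\<^sub>1]\<close> of natural numbers; every finite family of
  finite-dimensional vector spaces is isomorphic to one of these. Morphisms are all the
  morphisms of \<open>Vec\<^sup>\<Delta>\<close> between such families.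

  A surjection from the indices of \<open>W\<close> onto those of \<open>V\<close> is the list of its values. The tensor
  product of the \<open>k\<^bsup>W!j\<^esup>\<close>, \<open>j \<in> J\<close>, has as basis the choices of one basis vector per factor, that
  is \<open>tbasis W J\<close>; so no identification of iterated tensor products is needed. A morphism
  \<open>V \<rightarrow> W\<close> over \<open>f\<close> is given by the matrices of its components
  \<open>\<eta>\<^sub>i : k\<^bsup>V!i\<^esup> \<rightarrow> \<Otimes>\<^bsub>f(j) = i\<^esub> k\<^bsup>W!j\<^esup>\<close>: the value of \<open>\<eta>\<close> at the coordinate \<open>(i, w, v)\<close> is the
  entry of \<open>\<eta>\<^sub>i\<close> in row \<open>w\<close> and column \<open>v\<close>. Entries at triples outside \<open>coords V W f\<close> are
  irrelevant.
\<close>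

type_synonym coord = "nat \<times> (nat \<Rightarrow> nat) \<times> nat"

definition surj_word :: "nat list \<Rightarrow> nat list \<Rightarrow> nat list \<Rightarrow> bool" where
  "surj_word V W f \<longleftrightarrow> length f = length W \<and> set f = {..<length V}"

definition fibre :: "nat list \<Rightarrow> nat \<Rightarrow> nat set" where
  "fibre f i = {j. j < length f \<and> f ! j = i}"

definition tbasis :: "nat list \<Rightarrow> nat set \<Rightarrow> (nat \<Rightarrow> nat) set" where
  "tbasis W J = (\<Pi>\<^sub>E j\<in>J. {..<W ! j})"

definition coords :: "nat list \<Rightarrow> nat list \<Rightarrow> nat list \<Rightarrow> coord set" where
  "coords V W f = {(i, w, v). i < length V \<and> w \<in> tbasis W (fibre f i) \<and> v < V ! i}"

text \<open>
  The identity function on \<open>{0, \<dots>, n-1}\<close>, over which lie the morphisms of \<open>Vec\<^sup>n\<close>.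
\<close>

definition id_word :: "nat list \<Rightarrow> nat list" where
  "id_word V = [0..<length V]"

text \<open>
  Over the identity, \<open>std_mor\<close> is the family of rectangular identity matrices: the identity if
  \<open>V = W\<close>, the standard inclusions if the entries of \<open>W\<close> are at least those of \<open>V\<close>, and the
  standard projections if they are at most those of \<open>V\<close>.
\<close>

definition std_mor :: "coord \<Rightarrow> 'r::comm_ring_1" where
  "std_mor = (\<lambda>(i, w, v). if w i = v then 1 else 0)"

definition comp_word :: "nat list \<Rightarrow> nat list \<Rightarrow> nat list" where
  "comp_word f g = map (\<lambda>l. f ! l) g"

text \<open>
  Composite of \<open>\<eta> : V \<rightarrow> W\<close> over \<open>f\<close> and \<open>\<zeta> : W \<rightarrow> X\<close> over \<open>g\<close>: the \<open>i\<close>-th component is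
  \<open>(\<Otimes>\<^bsub>f(j) = i\<^esub> \<zeta>\<^sub>j) \<circ> \<eta>\<^sub>i\<close>. The entries are in a commutative ring since the same formula is
  used for matrices of indeterminates.
\<close>

definition comp_mor ::
  "nat list \<Rightarrow> nat list \<Rightarrow> nat list \<Rightarrow> (coord \<Rightarrow> 'r) \<Rightarrow> (coord \<Rightarrow> 'r) \<Rightarrow> coord \<Rightarrow> 'r::comm_ring_1"
  where
  "comp_mor W f g \<zeta> \<eta> = (\<lambda>(i, x, v).
     \<Sum>w\<in>tbasis W (fibre f i).
       (\<Prod>j\<in>fibre f i. \<zeta> (j, restrict x (fibre g j), w j)) * \<eta> (i, w, v))"


section \<open>\<open>\<Delta>\<close>-modules\<close>

text \<open>
  The values \<open>F(V)\<close> are finite-dimensional subspaces of one vector space, of arbitrary type and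
  dimension, with scalar multiplication \<open>scl F\<close>. This is no restriction: the direct sum of all
  values of a functor is such a space. \<open>mor F V W f \<eta>\<close> is the linear map
  that the functor assigns to the morphism \<open>(f, \<eta>)\<close>; it matters only on \<open>obj F V\<close>.

  \<open>pol F V W f\<close> is the polynomial in the entries of \<open>\<eta>\<close>, with coefficients in
  \<open>Hom(F(V), F(W))\<close>, whose value at \<open>\<eta>\<close> is \<open>mor F V W f \<eta>\<close>: \<open>pol F V W f \<alpha>\<close> is the coefficient of
  the monomial with exponents \<open>\<alpha>\<close>. For infinite \<open>k\<close> it is determined by \<open>mor F\<close>; for finite \<open>k\<close>
  it is part of the data.
\<close>

record ('k, 'm) vec_delta_functor =
  scl :: "'k \<Rightarrow> 'm \<Rightarrow> 'm"
  obj :: "nat list \<Rightarrow> 'm set"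
  mor :: "nat list \<Rightarrow> nat list \<Rightarrow> nat list \<Rightarrow> (coord \<Rightarrow> 'k) \<Rightarrow> 'm \<Rightarrow> 'm"
  pol :: "nat list \<Rightarrow> nat list \<Rightarrow> nat list \<Rightarrow> (coord \<Rightarrow>\<^sub>0 nat) \<Rightarrow> 'm \<Rightarrow> 'm"

definition linear_maps ::
  "('k \<Rightarrow> 'm \<Rightarrow> 'm::ab_group_add) \<Rightarrow> 'm set \<Rightarrow> 'm set \<Rightarrow> ('m \<Rightarrow> 'm) set" where
  "linear_maps s A B = {\<phi> \<in> A \<rightarrow> B.
     (\<forall>x\<in>A. \<forall>y\<in>A. \<phi> (x + y) = \<phi> x + \<phi> y) \<and> (\<forall>c. \<forall>x\<in>A. \<phi> (s c x) = s c (\<phi> x))}"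

definition is_functor :: "('k::field, 'm::ab_group_add) vec_delta_functor \<Rightarrow> bool" where
  "is_functor F \<longleftrightarrow>
     vector_space (scl F) \<and>
     (\<forall>V. \<exists>B. finite B \<and> obj F V = module.span (scl F) B) \<and>
     (\<forall>V W f \<eta>. surj_word V W f \<longrightarrow> mor F V W f \<eta> \<in> linear_maps (scl F) (obj F V) (obj F W)) \<and>
     (\<forall>V W f \<eta> \<eta>'. surj_word V W f \<and> (\<forall>c\<in>coords V W f. \<eta> c = \<eta>' c) \<longrightarrow>
        (\<forall>x\<in>obj F V. mor F V W f \<eta> x = mor F V W f \<eta>' x)) \<and>
     (\<forall>V. \<forall>x\<in>obj F V. mor F V V (id_word V) std_mor x = x) \<and>
     (\<forall>V W X f g \<eta> \<zeta>. surj_word V W f \<and> surj_word W X g \<longrightarrow>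
        (\<forall>x\<in>obj F V. mor F V X (comp_word f g) (comp_mor W f g \<zeta> \<eta>) x
                    = mor F W X g \<zeta> (mor F V W f \<eta> x)))"

definition monom_eval :: "('c \<Rightarrow> 'r) \<Rightarrow> ('c \<Rightarrow>\<^sub>0 nat) \<Rightarrow> 'r::comm_ring_1" where
  "monom_eval \<eta> \<alpha> = (\<Prod>c\<in>Poly_Mapping.keys \<alpha>. \<eta> c ^ Poly_Mapping.lookup \<alpha> c)"

definition monom_degree :: "('c \<Rightarrow>\<^sub>0 nat) \<Rightarrow> nat" where
  "monom_degree \<alpha> = (\<Sum>c\<in>Poly_Mapping.keys \<alpha>. Poly_Mapping.lookup \<alpha> c)"

definition pol_support ::
  "('k, 'm::zero) vec_delta_functor \<Rightarrow> nat list \<Rightarrow> nat list \<Rightarrow> nat list \<Rightarrow> (coord \<Rightarrow>\<^sub>0 nat) set" where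
  "pol_support F V W f = {\<alpha>. \<exists>x\<in>obj F V. pol F V W f \<alpha> x \<noteq> 0}"

text \<open>
  The generic morphism, with independent indeterminates as entries. Polynomials over
  \<open>k\<close> in indeterminates \<open>'c\<close> are of type \<open>('c \<Rightarrow>\<^sub>0 nat) \<Rightarrow>\<^sub>0 'k\<close>.
\<close>

definition indet :: "('a \<Rightarrow> 'c) \<Rightarrow> 'a \<Rightarrow> (('c \<Rightarrow>\<^sub>0 nat) \<Rightarrow>\<^sub>0 'k::comm_ring_1)" where
  "indet \<iota> a = Poly_Mapping.single (Poly_Mapping.single (\<iota> a) 1) 1"

text \<open>
  The last conjunct says that \<open>F(\<zeta> \<circ> \<eta>) = F(\<zeta>) \<circ> F(\<eta>)\<close> holds as an
  identity of polynomials in the entries of \<open>\<eta>\<close> (indeterminates \<open>Inl c\<close>) and of \<open>\<zeta>\<close>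
  (indeterminates \<open>Inr c\<close>), by comparing the coefficients of each monomial \<open>\<delta>\<close>. For \<open>f\<close> and \<open>g\<close>
  the identity this is the Friedlander--Suslin condition on \<open>F\<^sub>n\<close>; in general it also says that the
  transition maps are natural transformations of strict polynomial functors. It is implied by
  functoriality if \<open>k\<close> is infinite.

  Polynomials are attached to all \<open>f\<close> and not only to the morphisms of \<open>Vec\<^sup>n\<close>.
  As \<open>(f, \<eta>)\<close> is the morphism \<open>\<eta>\<close> of \<open>Vec\<^sup>n\<close> from \<open>V\<close> to the family of the
  \<open>\<Otimes>\<^bsub>f(j) = i\<^esub> k\<^bsup>W!j\<^esup>\<close>, followed by a morphism not depending on \<open>\<eta>\<close>, the former are
  determined by the latter.
\<close>

definition is_polynomial :: "('k::field, 'm::ab_group_add) vec_delta_functor \<Rightarrow> bool" where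
  "is_polynomial F \<longleftrightarrow>
     (\<forall>V W f. surj_word V W f \<longrightarrow>
        (\<forall>\<alpha>. pol F V W f \<alpha> \<in> linear_maps (scl F) (obj F V) (obj F W)) \<and>
        finite (pol_support F V W f) \<and>
        (\<forall>\<alpha>\<in>pol_support F V W f. Poly_Mapping.keys \<alpha> \<subseteq> coords V W f) \<and>
        (\<forall>\<eta>. \<forall>x\<in>obj F V. mor F V W f \<eta> x =
           (\<Sum>\<alpha>\<in>pol_support F V W f. scl F (monom_eval \<eta> \<alpha>) (pol F V W f \<alpha> x)))) \<and>
     (\<forall>n. \<exists>D. \<forall>V W. length V = n \<and> length W = n \<longrightarrow>
        (\<forall>\<alpha>\<in>pol_support F V W (id_word V). monom_degree \<alpha> \<le> D)) \<and>
     (\<forall>V W X f g. surj_word V W f \<and> surj_word W X g \<longrightarrow>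
        (\<forall>\<delta>. \<forall>x\<in>obj F V.
           (\<Sum>\<gamma>\<in>pol_support F V X (comp_word f g).
              scl F (Poly_Mapping.lookup
                       (monom_eval (comp_mor W f g (indet Inr) (indet Inl)) \<gamma>) \<delta>)
                    (pol F V X (comp_word f g) \<gamma> x))
           = pol F W X g (Poly_Mapping.map_key Inr \<delta>)
               (pol F V W f (Poly_Mapping.map_key Inl \<delta>) x)))"

definition delta_module :: "('k::field, 'm::ab_group_add) vec_delta_functor \<Rightarrow> bool" where
  "delta_module F \<longleftrightarrow> is_functor F \<and> is_polynomial F"

definition delta_submodule ::
  "('k::field, 'm::ab_group_add) vec_delta_functor \<Rightarrow> (nat list \<Rightarrow> 'm set) \<Rightarrow> bool" where
  "delta_submodule F U \<longleftrightarrow>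
     (\<forall>V. module.subspace (scl F) (U V) \<and> U V \<subseteq> obj F V) \<and>
     (\<forall>V W f. surj_word V W f \<longrightarrow>
        (\<forall>\<eta>. mor F V W f \<eta> ` U V \<subseteq> U W) \<and> (\<forall>\<alpha>. pol F V W f \<alpha> ` U V \<subseteq> U W))"

text \<open>An element of \<open>F\<close> is a pair \<open>(V, x)\<close> with \<open>x \<in> F(V)\<close>.\<close>

definition finitely_generated :: "('k::field, 'm::ab_group_add) vec_delta_functor \<Rightarrow> bool" where
  "finitely_generated F \<longleftrightarrow>
     (\<exists>S. finite S \<and> (\<forall>(V, x)\<in>S. x \<in> obj F V) \<and>
        (\<forall>U. delta_submodule F U \<and> (\<forall>(V, x)\<in>S. x \<in> U V) \<longrightarrow> (\<forall>V. U V = obj F V)))"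

definition noetherian :: "('k::field, 'm::ab_group_add) vec_delta_functor \<Rightarrow> bool" where
  "noetherian F \<longleftrightarrow> (\<forall>U. delta_submodule F U \<longrightarrow> finitely_generated (F\<lparr>obj := U\<rparr>))"


section \<open>Characters and the Hilbert series\<close>

typedef partition = "{xs :: nat list. sorted_wrt (\<ge>) xs \<and> 0 \<notin> set xs}"
  morphisms parts Partition
  by (intro exI[of _ "[]"]) simp

definition part :: "partition \<Rightarrow> nat \<Rightarrow> nat" where
  "part p a = (if a < length (parts p) then parts p ! a else 0)"

text \<open>
  The space of vectors in \<open>F(V)\<close> on which the diagonal torus of \<open>\<Prod>\<^sub>j GL(V!j)\<close> acts, as a group
  scheme, with weight \<open>(j, a) \<mapsto> part (ps ! j) a\<close>. For \<open>t\<close> diagonal only the monomials in diagonal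
  entries contribute to \<open>F(t) x\<close>, and this sum is required to be \<open>x\<close> times the
  monomial in \<open>t\<close> of that weight, as a polynomial in \<open>t\<close>.
\<close>

definition diag_coord :: "nat \<Rightarrow> nat \<Rightarrow> coord" where
  "diag_coord j a = (j, (\<lambda>l\<in>{j}. a), a)"

definition weight_space ::
  "('k::field, 'm::ab_group_add) vec_delta_functor \<Rightarrow> nat list \<Rightarrow> partition list \<Rightarrow> 'm set" where
  "weight_space F V ps = {x \<in> obj F V.
     \<forall>\<alpha>. Poly_Mapping.keys \<alpha> \<subseteq> {diag_coord j a | j a. j < length V \<and> a < V ! j} \<longrightarrow>
       pol F V V (id_word V) \<alpha> x =
         (if \<forall>j<length V. \<forall>a<V ! j. Poly_Mapping.lookup \<alpha> (diag_coord j a) = part (ps ! j) a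
          then x else 0)}"

text \<open>
  The direct limit \<open>F\<^sub>n(k\<^sup>\<infinity>, \<dots>, k\<^sup>\<infinity>)\<close> of the \<open>F\<^sub>n(k\<^sup>N, \<dots>, k\<^sup>N)\<close>, embedded in their product: the
  class of \<open>x \<in> F\<^sub>n(k\<^sup>M, \<dots>, k\<^sup>M)\<close> is the sequence \<open>s\<close> of its images under the standard maps
  \<open>k\<^sup>M \<rightarrow> k\<^sup>N\<close>. This does not change if \<open>x\<close> is replaced by its image under a standard inclusion,
  and it determines \<open>x = s M\<close> (the inclusions are split, so the transition maps are injective).
\<close>

definition limit_space ::
  "('k::field, 'm::ab_group_add) vec_delta_functor \<Rightarrow> nat \<Rightarrow> (nat \<Rightarrow> 'm) set" where
  "limit_space F n =
     {\<lambda>N. mor F (replicate n M) (replicate n N) [0..<n] std_mor x | M x. x \<in> obj F (replicate n M)}"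

definition limit_weight_space ::
  "('k::field, 'm::ab_group_add) vec_delta_functor \<Rightarrow> partition list \<Rightarrow> (nat \<Rightarrow> 'm) set" where
  "limit_weight_space F ps =
     {s \<in> limit_space F (length ps). \<forall>N. s N \<in> weight_space F (replicate (length ps) N) ps}"

definition weight_dim :: "('k::field, 'm::ab_group_add) vec_delta_functor \<Rightarrow> partition list \<Rightarrow> nat"
  where
  "weight_dim F ps = vector_space.dim (\<lambda>c s N. scl F c (s N)) (limit_weight_space F ps)"

text \<open>
  Formal power series over the rationals in variables \<open>'v\<close>, given by their coefficients.
\<close>

type_synonym 'v power_series = "('v \<Rightarrow>\<^sub>0 nat) \<Rightarrow> rat"

text \<open>
  \<open>ch F n\<close> is the image of \<open>\<Sum> dim V\<^bsub>\<lambda>\<^sub>1, \<dots>, \<lambda>\<^sub>n\<^esub> m\<^bsub>\<lambda>\<^sub>1\<^esub> \<otimes> \<dots> \<otimes> m\<^bsub>\<lambda>\<^sub>n\<^esub>\<close> in the symmetric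
  power: the coefficient of a monomial is the sum over the finitely many tuples that multiply to it.
\<close>

definition ch :: "('k::field, 'm::ab_group_add) vec_delta_functor \<Rightarrow> nat \<Rightarrow> partition power_series"
  where
  "ch F n \<mu> = (\<Sum>ps | length ps = n \<and> (\<Sum>p\<leftarrow>ps. Poly_Mapping.single p 1) = \<mu>.
                 of_nat (weight_dim F ps))"

text \<open>
  Since \<open>ch F n\<close> is homogeneous of degree \<open>n\<close>, at most one \<open>n\<close> contributes to each coefficient.
\<close>

definition hilbert_series ::
  "('k::field, 'm::ab_group_add) vec_delta_functor \<Rightarrow> partition power_series" where
  "hilbert_series F \<mu> = (\<Sum>n | ch F n \<mu> \<noteq> 0. ch F n \<mu> / fact n)"

definition ps_const :: "rat \<Rightarrow> 'v power_series" where
  "ps_const c \<mu> = (if \<mu> = 0 then c else 0)"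

definition ps_var :: "'v \<Rightarrow> 'v power_series" where
  "ps_var v \<mu> = (if \<mu> = Poly_Mapping.single v 1 then 1 else 0)"

definition ps_exp_var :: "'v \<Rightarrow> 'v power_series" where
  "ps_exp_var v \<mu> =
     (if Poly_Mapping.keys \<mu> \<subseteq> {v} then 1 / fact (Poly_Mapping.lookup \<mu> v) else 0)"

definition ps_add :: "'v power_series \<Rightarrow> 'v power_series \<Rightarrow> 'v power_series" where
  "ps_add p q \<mu> = p \<mu> + q \<mu>"

definition ps_mult :: "'v power_series \<Rightarrow> 'v power_series \<Rightarrow> 'v power_series" where
  "ps_mult p q \<mu> = (\<Sum>(a, b) | a + b = \<mu>. p a * q b)"

text \<open>The polynomial expressions in finitely many of the variables and their exponentials.\<close>

inductive_set exp_polynomials :: "'v power_series set" where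
  const: "ps_const c \<in> exp_polynomials"
| var: "ps_var v \<in> exp_polynomials"
| exp_var: "ps_exp_var v \<in> exp_polynomials"
| add: "p \<in> exp_polynomials \<Longrightarrow> q \<in> exp_polynomials \<Longrightarrow> ps_add p q \<in> exp_polynomials"
| mult: "p \<in> exp_polynomials \<Longrightarrow> q \<in> exp_polynomials \<Longrightarrow> ps_mult p q \<in> exp_polynomials"

end

theory Submission
  imports Defs "HOL-Library.Ramsey" "HOL-Library.Sublist" "HOL-Library.List_Lexorder"
    "HOL-Library.Product_Lexorder" "HOL-Combinatorics.Multiset_Permutations"
begin

text \<open>
  Let \<open>F\<close> be generated by finitely many elements \<open>x\<close>. Then \<open>F(W)\<close> is spanned by the coefficients
  at \<open>x\<close> of the monomials of bounded degree in the entries of the generic morphism to \<open>W\<close>. For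
  \<open>W = (k\<^sup>N, \<dots>, k\<^sup>N)\<close> such a monomial is, up to finitely many choices, a word of length \<open>n\<close> over a
  finite alphabet: the \<open>j\<close>-th letter records how the monomial involves the \<open>j\<close>-th factor.
  Duplicating tensor factors by \<open>e\<^sub>a \<mapsto> e\<^sub>a \<otimes> \<dots> \<otimes> e\<^sub>a\<close> acts on these words by composition with
  surjections \<open>g\<close>, and every word is a weight vector whose weight is computed letter by letter.

  Surjections whose values first occur in increasing order preserve the strict lexicographic order,
  and the resulting order on words is a well-quasi-order (by Higman's lemma). Hence the leading words
  of a submodule form a finitely generated upset, which makes \<open>F\<close> noetherian, since submodules are
  determined on the \<open>(k\<^sup>N, \<dots>, k\<^sup>N)\<close> with \<open>N\<close> at least the degree. The words that are
  not leading words of the relations index a basis of \<open>F\<close>. They are recognised by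
  automata in which the only cycles are loops, so the number of words of weight
  \<open>\<lambda>\<^sub>1, \<dots>, \<lambda>\<^sub>1, \<lambda>\<^sub>2, \<dots>, \<lambda>\<^sub>2, \<dots>\<close> is an exponential polynomial in the multiplicities of the \<open>\<lambda>\<^sub>i\<close>.
  By symmetry of the weight multiplicities this determines the Hilbert series.
\<close>

section \<open>Almost full relations and the surjection order on words\<close>

text \<open>The argument runs on coefficients of generic morphisms, not on values of
  \<open>F\<close>: over a finite field values do not separate monomials, while the composition law
  is a polynomial identity over every field. Allowing the second factor of a composite only one
  nonzero entry per column means reducing modulo the other variables; then a coefficient of a
  coefficient is a single coefficient or 0. This one computation yields the action of duplications
  on words, the weights of words, and the degree bound over words \<open>f\<close> other than
  identities. Relations between words are taken inside one weight space at a time, so that the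
  remaining words give its dimension. Composition with a surjection respects this, and finitely many
  forbidden words serve all weights at once. A monomial of the Hilbert series is represented by its
  weights sorted into blocks. Its orderings number n! divided by the factorials of the
  multiplicities, so the factor 1/n! leaves an exponential generating function in the block lengths.
  Loops of the automata give exponentials; powers come from passing through several states with
  equally many loops.\<close>

definition almost_full :: "('a \<Rightarrow> 'a \<Rightarrow> bool) \<Rightarrow> 'a set \<Rightarrow> bool" where
  "almost_full P A \<longleftrightarrow> (\<forall>s::nat \<Rightarrow> 'a. (\<forall>i. s i \<in> A) \<longrightarrow> (\<exists>i j. i < j \<and> P (s i) (s j)))"

lemma almost_fullD:
  assumes "almost_full P A" "\<And>i::nat. s i \<in> A"
  obtains i j where "i < j" "P (s i) (s j)"
  using assms unfolding almost_full_def by blast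

text \<open>Ramsey's theorem for pairs: an infinite set of indices all of whose pairs have the bad
  colour would be a sequence contradicting \<open>af\<close>.\<close>

lemma almost_full_subseq:
  fixes s :: "nat \<Rightarrow> 'a"
  assumes af: "almost_full P A" and s: "\<And>i. s i \<in> A"
  obtains r :: "nat \<Rightarrow> nat" where "strict_mono r" "\<And>i j. i < j \<Longrightarrow> P (s (r i)) (s (r j))"
proof -
  define col where "col X = (if P (s (Min X)) (s (Max X)) then 0 else 1::nat)" for X
  have "\<forall>x\<in>UNIV. \<forall>y\<in>UNIV. x \<noteq> y \<longrightarrow> col {x, y} < 2"
    by (simp add: col_def)
  from Ramsey2[OF infinite_UNIV_nat this] obtain Y t where Y: "infinite Y"
    and t: "\<forall>x\<in>Y. \<forall>y\<in>Y. x \<noteq> y \<longrightarrow> col {x, y} = t"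
    by blast
  define r where "r = enumerate Y"
  have r: "strict_mono r" using Y unfolding r_def by (rule strict_mono_enumerate)
  have rY: "r i \<in> Y" for i unfolding r_def using Y by (rule enumerate_in_set)
  have col: "col {r i, r j} = t" if "i < j" for i j
    using t rY r that by (metis less_irrefl strict_mono_less)
  have MM: "Min {r i, r j} = r i" "Max {r i, r j} = r j" if "i < j" for i j
    using r that by (auto simp: strict_mono_def min_def max_def dest: less_imp_le leD)
  obtain i j where ij: "i < j" "P (s (r i)) (s (r j))"
    using almost_fullD[OF af, of "s \<circ> r"] s by auto
  have "t = 0" using col[OF ij(1)] ij(2) MM[OF ij(1)] by (simp add: col_def)
  then have "P (s (r i)) (s (r j))" if "i < j" for i j
    using col[OF that] MM[OF that] by (simp add: col_def split: if_splits)
  then show ?thesis using that r by blast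
qed

text \<open>On a subsequence all of whose pairs are good for \<open>P\<close>, one good pair for
  \<open>Q\<close> is enough.\<close>

lemma almost_full_times:
  assumes P: "almost_full P A" and Q: "almost_full Q B"
  shows "almost_full (\<lambda>x y. P (fst x) (fst y) \<and> Q (snd x) (snd y)) (A \<times> B)"
  unfolding almost_full_def
proof (intro allI impI)
  fix s :: "nat \<Rightarrow> _"
  assume s: "\<forall>i. s i \<in> A \<times> B"
  obtain r where r: "strict_mono (r :: nat \<Rightarrow> nat)"
    and Pr: "\<And>i j. i < j \<Longrightarrow> P ((fst \<circ> s) (r i)) ((fst \<circ> s) (r j))"
    using almost_full_subseq[OF P, of "fst \<circ> s"] s by (auto simp: mem_Times_iff)
  obtain i j where ij: "i < j" "Q ((snd \<circ> s \<circ> r) i) ((snd \<circ> s \<circ> r) j)"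
    using almost_fullD[OF Q, of "snd \<circ> s \<circ> r"] s by (auto simp: mem_Times_iff)
  then show "\<exists>i j. i < j \<and> P (fst (s i)) (fst (s j)) \<and> Q (snd (s i)) (snd (s j))"
    using Pr[OF ij(1)] r by (metis comp_apply strict_mono_less)
qed

lemma almost_full_Un:
  assumes A: "almost_full P A" and B: "almost_full P B"
  shows "almost_full P (A \<union> B)"
  unfolding almost_full_def
proof (intro allI impI)
  fix s :: "nat \<Rightarrow> 'a"
  assume s: "\<forall>i. s i \<in> A \<union> B"
  have *: "\<exists>i j. i < j \<and> P (s i) (s j)" if C: "almost_full P C" and inf: "infinite {i. s i \<in> C}" for C
  proof -
    define r where "r = enumerate {i. s i \<in> C}"
    have r: "strict_mono r" unfolding r_def by (rule strict_mono_enumerate[OF inf])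
    have "s (r i) \<in> C" for i using enumerate_in_set[OF inf] unfolding r_def by blast
    then obtain i j where "i < j" "P ((s \<circ> r) i) ((s \<circ> r) j)"
      using almost_fullD[OF C, of "s \<circ> r"] by auto
    then show ?thesis using r by (metis comp_apply strict_mono_less)
  qed
  have "UNIV = {i. s i \<in> A} \<union> {i. s i \<in> B}" using s by auto
  then have "infinite {i. s i \<in> A} \<or> infinite {i. s i \<in> B}"
    by (metis finite_UnI infinite_UNIV_nat)
  then show "\<exists>i j. i < j \<and> P (s i) (s j)" using * A B by blast
qed

lemma almost_full_UN:
  assumes "finite I" "\<And>i. i \<in> I \<Longrightarrow> almost_full P (A i)"
  shows "almost_full P (\<Union>i\<in>I. A i)"
  using assms
proof (induction I rule: finite_induct)
  case empty
  then show ?case by (simp add: almost_full_def)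
next
  case (insert i I)
  then show ?case by (simp add: almost_full_Un)
qed

lemma almost_full_subset: "almost_full P B \<Longrightarrow> A \<subseteq> B \<Longrightarrow> almost_full P A"
  unfolding almost_full_def by blast

lemma almost_full_image:
  assumes Q: "almost_full Q B" and h: "\<And>x y. x \<in> B \<Longrightarrow> y \<in> B \<Longrightarrow> Q x y \<Longrightarrow> P (h x) (h y)"
  shows "almost_full P (h ` B)"
  unfolding almost_full_def
proof (intro allI impI)
  fix s :: "nat \<Rightarrow> _"
  assume "\<forall>i. s i \<in> h ` B"
  then have "\<forall>i. \<exists>x. x \<in> B \<and> s i = h x" by blast
  then obtain t where t: "\<And>i. t i \<in> B" "\<And>i. s i = h (t i)" by metis
  obtain i j where "i < j" "Q (t i) (t j)" using almost_fullD[OF Q, of t] t(1) by auto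
  then show "\<exists>i j. i < j \<and> P (s i) (s j)" using h t by metis
qed

lemma almost_full_mono:
  assumes "almost_full Q B" "\<And>x y. x \<in> B \<Longrightarrow> y \<in> B \<Longrightarrow> Q x y \<Longrightarrow> P x y"
  shows "almost_full P B"
  using almost_full_image[OF assms(1), of P id] assms(2) by simp

text \<open>Greedy choice: if no finite subset works, some element lies above none of those picked
  so far, and the sequence of picks has no good pair.\<close>

lemma almost_full_finite_basis:
  assumes af: "almost_full P A" and I: "I \<subseteq> A"
  shows "\<exists>I0. finite I0 \<and> I0 \<subseteq> I \<and> (\<forall>w\<in>I. \<exists>u\<in>I0. P u w)" 
proof (rule ccontr)
  assume no: "\<not> ?thesis"
  have ex: "\<exists>w\<in>I. \<forall>u\<in>J. \<not> P u w" if "finite J" "J \<subseteq> I" for J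
  proof (rule ccontr)
    assume "\<not> ?thesis"
    then have "\<And>w. w \<in> I \<Longrightarrow> \<exists>u\<in>J. P u w" by blast
    with that no show False by blast
  qed
  define pick where "pick J = (SOME w. w \<in> I \<and> (\<forall>u\<in>J. \<not> P u w))" for J
  have pick: "pick J \<in> I \<and> (\<forall>u\<in>J. \<not> P u (pick J))" if "finite J" "J \<subseteq> I" for J
    unfolding pick_def using someI_ex[OF ex[OF that, unfolded Bex_def]] by simp
  define K where "K n = rec_nat {} (\<lambda>_ J. insert (pick J) J) n" for n :: nat
  have K0: "K 0 = {}" and KS: "K (Suc n) = insert (pick (K n)) (K n)" for n
    by (simp_all add: K_def)
  have K: "finite (K n) \<and> K n \<subseteq> I" for n
    by (induction n) (auto simp: K0 KS pick)
  have mono: "i < j \<Longrightarrow> pick (K i) \<in> K j" for i j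
    by (induction j) (auto simp: K0 KS less_Suc_eq)
  have pK: "pick (K n) \<in> A" for n using pick[of "K n"] K[of n] I by blast
  obtain i j where "i < j" "P (pick (K i)) (pick (K j))"
    using almost_fullD[OF af pK] .
  then show False using pick[of "K j"] K[of j] mono[of i j] by blast
qed

section \<open>Higman's lemma for words over a finite alphabet, and its refinement to
  \<open>emb\<close>\<close>

lemma higman_finite:
  assumes "finite A"
  shows "almost_full subseq (lists A)"
  using assms
proof (induction A rule: finite_psubset_induct)
  case (psubset A)
  \<comment> \<open>Induction on \<open>w\<close>: splitting at the first occurrence of its head
    \<open>x\<close> leaves a word over a smaller alphabet and a word avoiding the tail of
    \<open>w\<close>.\<close>
  have avoid: "almost_full subseq {v \<in> lists A. \<not> subseq w v}" if "w \<in> lists A" for w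
    using that
  proof (induction w)
    case Nil
    then show ?case by (simp add: almost_full_def)
  next
    case (Cons x w)
    then have x: "x \<in> A" and af: "almost_full subseq {v \<in> lists A. \<not> subseq w v}" by auto
    have B: "almost_full subseq (lists (A - {x}))" using psubset x by blast
    define h where "h = (\<lambda>(u, v). u @ [x] @ v)"
    have C: "almost_full subseq (h ` (lists (A - {x}) \<times> {v \<in> lists A. \<not> subseq w v}))"
      by (rule almost_full_image[OF almost_full_times[OF B af]])
        (auto simp: h_def intro!: list_emb_append_mono)
    have "{v \<in> lists A. \<not> subseq (x # w) v} \<subseteq>
       lists (A - {x}) \<union> h ` (lists (A - {x}) \<times> {v \<in> lists A. \<not> subseq w v})"
    proof
      fix v assume v: "v \<in> {v \<in> lists A. \<not> subseq (x # w) v}"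
      show "v \<in> lists (A - {x}) \<union> h ` (lists (A - {x}) \<times> {v \<in> lists A. \<not> subseq w v})"
      proof (cases "x \<in> set v")
        case True
        then obtain u t where ut: "v = u @ x # t" "x \<notin> set u" by (meson split_list_first)
        have "\<not> subseq w t"
          using v ut by (auto intro: list_emb_append2)
        then have "(u, t) \<in> lists (A - {x}) \<times> {v \<in> lists A. \<not> subseq w v}" "v = h (u, t)"
          using v ut by (auto simp: h_def)
        then show ?thesis by blast
      qed (use v in auto)
    qed
    then show ?case using almost_full_subset[OF almost_full_Un[OF B C]] by blast
  qed
  show ?case
    unfolding almost_full_def
  proof (intro allI impI, rule ccontr)
    fix s :: "nat \<Rightarrow> 'a list"
    assume s: "\<forall>i. s i \<in> lists A" and bad: "\<not> (\<exists>i j. i < j \<and> subseq (s i) (s j))"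
    \<comment> \<open>All later words of a bad sequence avoid its first word.\<close>
    then have "s (Suc i) \<in> {v \<in> lists A. \<not> subseq (s 0) v}" for i by (metis mem_Collect_eq zero_less_Suc)
    then obtain i j where "i < j" "subseq (s (Suc i)) (s (Suc j))"
      using almost_fullD[OF avoid, of "s 0" "\<lambda>i. s (Suc i)"] s by auto
    then show False using bad Suc_mono by blast
  qed
qed

text \<open>\<open>emb {} u w\<close>: \<open>w\<close> arises from \<open>u\<close> by inserting letters that occur earlier; \<open>S\<close> is the set of letters read so far.\<close>

inductive emb :: "'a set \<Rightarrow> 'a list \<Rightarrow> 'a list \<Rightarrow> bool" where
  Nil: "emb S [] []"
| keep: "emb (insert x S) u w \<Longrightarrow> emb S (x # u) (x # w)"
| skip: "x \<in> S \<Longrightarrow> emb S u w \<Longrightarrow> emb S u (x # w)"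

text \<open>As long as every letter read lies in \<open>S\<close>, any letter may be inserted, so
  the plain subsequence order suffices.\<close>

lemma emb_append:
  assumes "subseq u w" "set w \<subseteq> S" "emb S u' w'"
  shows "emb S (u @ u') (w @ w')"
  using assms
proof (induction rule: list_emb.induct)
  case (list_emb_Nil ys)
  then show ?case by (induction ys) (auto intro: emb.intros)
next
  case (list_emb_Cons xs ys y)
  then show ?case by (auto intro: emb.intros)
next
  case (list_emb_Cons2 x y xs ys)
  then have "insert y S = S" by auto
  with list_emb_Cons2 show ?case by (auto intro!: emb.keep)
qed

text \<open>Induction on the number of unseen letters. At its first unseen letter \<open>x\<close> a
  word splits into a prefix over \<open>S\<close>, handled by Higman's lemma, and a rest compared
  with \<open>x\<close> counted as seen; there are finitely many choices of
  \<open>x\<close>.\<close>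

lemma almost_full_emb:
  assumes A: "finite A" and "S \<subseteq> A"
  shows "almost_full (emb S) (lists A)"
  using assms(2)
proof (induction "A - S" arbitrary: S rule: measure_induct_rule[where f = card])
  case (less S)
  have S: "finite S" using less.prems A finite_subset by blast
  define h where "h = (\<lambda>x (u, v). u @ [x] @ v :: 'a list)"
  have 1: "almost_full (emb S) (lists S)"
    by (rule almost_full_mono[OF higman_finite[OF S]]) (auto dest: emb_append[OF _ _ emb.Nil])
  have 2: "almost_full (emb S) (h x ` (lists S \<times> lists A))" if x: "x \<in> A - S" for x
  proof -
    have "card (A - insert x S) < card (A - S)"
      using x A by (intro psubset_card_mono) auto
    then have "almost_full (emb (insert x S)) (lists A)" using less x by blast
    from almost_full_times[OF higman_finite[OF S] this] show ?thesis
      by (rule almost_full_image) (auto simp: h_def intro!: emb_append emb.keep)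
  qed
  have "lists A \<subseteq> lists S \<union> (\<Union>x\<in>A - S. h x ` (lists S \<times> lists A))"
  proof
    fix v assume v: "v \<in> lists A"
    show "v \<in> lists S \<union> (\<Union>x\<in>A - S. h x ` (lists S \<times> lists A))"
    proof (cases "v \<in> lists S")
      case False
      then obtain x where "x \<in> set v" "x \<notin> S" by auto
      then obtain u y t where "v = u @ y # t" "y \<notin> S" "\<forall>z\<in>set u. z \<in> S"
        using split_list_first_prop[of v "\<lambda>x. x \<notin> S"] by metis
      then have "y \<in> A - S" "(u, t) \<in> lists S \<times> lists A" "v = h y (u, t)"
        using v by (auto simp: h_def)
      then show ?thesis by blast
    qed simp
  qed
  moreover have "almost_full (emb S) (\<Union>x\<in>A - S. h x ` (lists S \<times> lists A))"
    by (rule almost_full_UN) (use A 2 in auto)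
  ultimately show ?case using almost_full_subset[OF almost_full_Un[OF 1]] by blast
qed

text \<open>For surjections, this says that the first occurrences of the values are in increasing order.\<close>

definition restricted_growth :: "nat list \<Rightarrow> bool" where
  "restricted_growth g \<longleftrightarrow> (\<forall>q<length g. \<forall>i<g ! q. \<exists>p<q. g ! p = i)"

text \<open>Generalised to a prefix \<open>p\<close> already read, so that an inserted letter can be
  sent to the position of an earlier occurrence in \<open>p\<close>. Positions of \<open>p\<close>
  count as already hit: the growth condition exempts them, and only the positions of
  \<open>u\<close> must be reached.\<close>

lemma emb_imp_surjection_aux:
  assumes "emb (set p) u w"
  shows "\<exists>h. length h = length w \<and> set h \<subseteq> {..<length (p @ u)} \<and>
    {length p..<length (p @ u)} \<subseteq> set h \<and> map (\<lambda>l. (p @ u) ! l) h = w \<and>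
    (\<forall>q<length h. \<forall>i<h ! q. i < length p \<or> (\<exists>r<q. h ! r = i))"
  using assms
proof (induction "set p" u w arbitrary: p rule: emb.induct)
  case Nil
  then show ?case by (intro exI[of _ "[]"]) auto
next
  case (keep x u w)
  have "insert x (set p) = set (p @ [x])" by simp
  from keep.hyps(2)[OF this] obtain h where "length h = length w"
    "set h \<subseteq> {..<length ((p @ [x]) @ u)}" "{length (p @ [x])..<length ((p @ [x]) @ u)} \<subseteq> set h"
    "map (\<lambda>l. ((p @ [x]) @ u) ! l) h = w"
    "\<forall>q<length h. \<forall>i<h ! q. i < length (p @ [x]) \<or> (\<exists>r<q. h ! r = i)"
    by blast
  then have h: "length h = length w"
    "set h \<subseteq> {..<length (p @ x # u)}" "{Suc (length p)..<length (p @ x # u)} \<subseteq> set h"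
    "map (\<lambda>l. (p @ x # u) ! l) h = w"
    "\<And>q i. q < length h \<Longrightarrow> i < h ! q \<Longrightarrow> i < Suc (length p) \<or> (\<exists>r<q. h ! r = i)"
    by simp_all
  have "i < length p \<or> (\<exists>r<q. (length p # h) ! r = i)"
    if qi: "q < length (length p # h)" "i < (length p # h) ! q" for q i
  proof (cases q)
    case (Suc q')
    consider "i < length p" | "i = length p" | r where "r < q'" "h ! r = i"
      using h(5)[of q' i] qi unfolding Suc by (auto simp: less_Suc_eq)
    then show ?thesis
    proof cases
      case 3
      then show ?thesis using Suc by (intro disjI2 exI[of _ "Suc r"]) simp
    qed (use Suc in auto)
  qed (use qi in simp)
  moreover have "{length p..<length (p @ x # u)} \<subseteq> set (length p # h)"
  proof
    fix i assume "i \<in> {length p..<length (p @ x # u)}"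
    then show "i \<in> set (length p # h)" using h(3) by (cases "i = length p") auto
  qed
  ultimately show ?case using h by (intro exI[of _ "length p # h"]) auto
next
  case (skip x u w)
  from skip.hyps(3)[OF refl] obtain h where "length h = length w"
    "set h \<subseteq> {..<length (p @ u)}" "{length p..<length (p @ u)} \<subseteq> set h"
    "map (\<lambda>l. (p @ u) ! l) h = w"
    "\<forall>q<length h. \<forall>i<h ! q. i < length p \<or> (\<exists>r<q. h ! r = i)"
    by blast
  then have h: "length h = length w"
    "set h \<subseteq> {..<length (p @ u)}" "{length p..<length (p @ u)} \<subseteq> set h"
    "map (\<lambda>l. (p @ u) ! l) h = w"
    "\<And>q i. q < length h \<Longrightarrow> i < h ! q \<Longrightarrow> i < length p \<or> (\<exists>r<q. h ! r = i)"
    by simp_all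
  obtain r where r: "r < length p" "p ! r = x" using skip.hyps(1) by (metis in_set_conv_nth)
  have "i < length p \<or> (\<exists>t<q. (r # h) ! t = i)"
    if qi: "q < length (r # h)" "i < (r # h) ! q" for q i
  proof (cases q)
    case (Suc q')
    consider "i < length p" | t where "t < q'" "h ! t = i"
      using h(5)[of q' i] qi unfolding Suc by auto
    then show ?thesis
    proof cases
      case 2
      then show ?thesis using Suc by (intro disjI2 exI[of _ "Suc t"]) simp
    qed simp
  qed (use qi r in simp)
  with h r show ?case by (intro exI[of _ "r # h"]) (auto simp: nth_append)
qed

lemma emb_imp_surjection:
  assumes "emb {} u w"
  obtains g where "set g = {..<length u}" "restricted_growth g" "map ((!) u) g = w"
  using emb_imp_surjection_aux[of "[]" u w] assms
  by (auto simp: restricted_growth_def atLeast0LessThan)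

section \<open>Lexicographic order under composition with surjections\<close>

lemma list_less_iff_nth:
  fixes c d :: "'a::linorder list"
  assumes "length c = length d"
  shows "c < d \<longleftrightarrow> (\<exists>i<length c. (\<forall>j<i. c ! j = d ! j) \<and> c ! i < d ! i)"
  using assms
proof (induction c d rule: list_induct2)
  case (Cons x xs y ys)
  show ?case (is "_ \<longleftrightarrow> (\<exists>i. ?Q i)")
  proof
    assume "x # xs < y # ys"
    then consider "x < y" | "x = y" "xs < ys" by auto
    then show "\<exists>i. ?Q i"
    proof cases
      case 1
      then show ?thesis by (intro exI[of _ 0]) auto
    next
      case 2
      then obtain i where "i<length xs" "\<forall>j<i. xs ! j = ys ! j" "xs ! i < ys ! i" using Cons by auto
      then show ?thesis using 2 by (intro exI[of _ "Suc i"]) (auto simp: less_Suc_eq_0_disj)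
    qed
  next
    assume "\<exists>i. ?Q i"
    then obtain i where i: "?Q i" by blast
    show "x # xs < y # ys"
    proof (cases i)
      case (Suc k)
      then have "x = y" "\<forall>j<k. xs ! j = ys ! j" "xs ! k < ys ! k" "k < length xs" using i by (auto simp: less_Suc_eq_0_disj)
      then show ?thesis using Cons by auto
    qed (use i in auto)
  qed
qed simp

text \<open>If \<open>c\<close> and \<open>d\<close> first differ at \<open>i\<close>, their images
  first differ where \<open>g\<close> first takes the value \<open>i\<close>: a larger value before
  that place would, by restricted growth, be preceded by \<open>i\<close>.\<close>

lemma map_nth_less:
  fixes c d :: "'a::linorder list"
  assumes g: "restricted_growth g" "set g = {..<length c}" and "length c = length d" "c < d"
  shows "map ((!) c) g < map ((!) d) g"
proof -
  obtain i where i: "i < length c" "\<And>j. j < i \<Longrightarrow> c ! j = d ! j" "c ! i < d ! i"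
    using assms list_less_iff_nth by blast
  define q where "q = (LEAST q. q < length g \<and> g ! q = i)"
  have "\<exists>q. q < length g \<and> g ! q = i" using i g by (metis in_set_conv_nth lessThan_iff)
  then have q: "q < length g" "g ! q = i" and qm: "\<And>p. p < q \<Longrightarrow> p < length g \<Longrightarrow> g ! p \<noteq> i"
    unfolding q_def by (metis (mono_tags, lifting) LeastI_ex, metis (mono_tags, lifting) LeastI_ex, metis (mono_tags, lifting) not_less_Least)
  have "g ! p < i" if "p < q" for p
    using g(1) q qm that unfolding restricted_growth_def
    by (metis dual_order.strict_trans linorder_neqE_nat)
  then show ?thesis
    using i q by (subst list_less_iff_nth) (auto intro!: exI[of _ q])
qed


section \<open>Counting words that avoid a finite set\<close>

text \<open>
  In a state \<open>(S, R)\<close>, the set of letters read so far is \<open>S\<close>, and \<open>R\<close> lists what remains to be matched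
  of the forbidden words. It suffices to match greedily (\<open>emb_Cons_skip\<close>), so the automaton is deterministic.
\<close>

type_synonym 'a state = "'a set \<times> 'a list list"

definition step :: "'a \<Rightarrow> 'a state \<Rightarrow> 'a state" where
  "step x q = (insert x (fst q), concat (map (\<lambda>w.
     if w \<noteq> [] \<and> hd w = x then [tl w] else if x \<in> fst q then [w] else []) (snd q)))"

definition run :: "'a state \<Rightarrow> 'a list \<Rightarrow> 'a state" where
  "run q c = foldl (\<lambda>q x. step x q) q c"

definition avoids :: "'a state \<Rightarrow> 'a list \<Rightarrow> bool" where
  "avoids q c \<longleftrightarrow> \<not> (\<exists>u\<in>set (snd q). emb (fst q) u c)"

lemma run_simps [simp]:
  "run q [] = q"
  "run q (x # c) = run (step x q) c"
  "run q (c @ d) = run (run q c) d"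
  by (simp_all add: run_def)

text \<open>If the head of the pattern has been seen before, its match in \<open>c\<close> can be
  treated as an insertion. Hence matching a head as soon as possible loses nothing.\<close>

lemma emb_Cons_skip:
  assumes "emb S u' c" "u' = x # u" "x \<in> S"
  shows "emb S u c"
  using assms
  by (induction rule: emb.induct) (auto simp: insert_absorb intro: emb.intros)

lemma emb_Cons_iff:
  "emb S u (x # c) \<longleftrightarrow> (if u \<noteq> [] \<and> hd u = x then emb (insert x S) (tl u) c else x \<in> S \<and> emb (insert x S) u c)"
proof
  assume "emb S u (x # c)"
  then show "if u \<noteq> [] \<and> hd u = x then emb (insert x S) (tl u) c else x \<in> S \<and> emb (insert x S) u c"
  proof cases
    case skip
    then show ?thesis by (cases u) (auto simp: insert_absorb dest: emb_Cons_skip)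
  qed auto
next
  assume "if u \<noteq> [] \<and> hd u = x then emb (insert x S) (tl u) c else x \<in> S \<and> emb (insert x S) u c"
  then show "emb S u (x # c)"
    by (cases u) (auto simp: insert_absorb intro: emb.intros split: if_splits)
qed

lemma avoids_Cons: "avoids q (x # c) \<longleftrightarrow> avoids (step x q) c"
  unfolding avoids_def step_def by (auto simp: emb_Cons_iff split: if_splits)

text \<open>Avoidance depends only on the state reached, so a word can be cut anywhere and its parts
  counted state by state.\<close>

lemma avoids_run: "avoids q c \<longleftrightarrow> avoids (run q c) []"
  by (induction c arbitrary: q) (simp_all add: avoids_Cons)

text \<open>A rank that drops at every step that is not a loop; \<open>Suc\<close> makes the removal
  of an empty remaining pattern count as well.\<close>

definition state_size :: "'a set \<Rightarrow> 'a state \<Rightarrow> nat" where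
  "state_size A q = (\<Sum>w\<leftarrow>snd q. Suc (length w)) + card (A - fst q)"

lemma sum_length_concat_map:
  assumes "\<And>w. w \<in> set R \<Longrightarrow> f w = [w] \<or> (\<Sum>w\<leftarrow>f w. Suc (length w)) < Suc (length w)"
  shows "concat (map f R) = R \<or> (\<Sum>w\<leftarrow>concat (map f R). Suc (length w)) < (\<Sum>w\<leftarrow>R. Suc (length w))"
  using assms
proof (induction R)
  case (Cons w R)
  from Cons.prems[of w] Cons.IH[OF Cons.prems] show ?case by fastforce
qed simp

text \<open>Either some pattern shrinks or disappears, or the patterns are unchanged and the letter
  is new.\<close>

lemma state_size_step:
  assumes "finite A" "x \<in> A" "step x q \<noteq> q"
  shows "state_size A (step x q) < state_size A q"
proof -
  define f where "f w = (if w \<noteq> [] \<and> hd w = x then [tl w] else if x \<in> fst q then [w] else [])" for w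
  have st: "step x q = (insert x (fst q), concat (map f (snd q)))" by (simp add: step_def f_def[abs_def])
  have f: "f w = [w] \<or> (\<Sum>w\<leftarrow>f w. Suc (length w)) < Suc (length w)" for w
    unfolding f_def by (cases w) auto
  from sum_length_concat_map[OF f, of "snd q"]
  consider "concat (map f (snd q)) = snd q" | "(\<Sum>w\<leftarrow>concat (map f (snd q)). Suc (length w)) < (\<Sum>w\<leftarrow>snd q. Suc (length w))"
    by blast
  then show ?thesis
  proof cases
    case 1
    then have "x \<notin> fst q" using assms(3) st by (auto simp: insert_absorb prod_eq_iff)
    then have "card (A - insert x (fst q)) < card (A - fst q)"
      using assms by (intro psubset_card_mono) auto
    then show ?thesis using 1 st by (simp add: state_size_def)
  next
    case 2
    have "card (A - insert x (fst q)) \<le> card (A - fst q)"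
      using assms by (intro card_mono) auto
    then show ?thesis using 2 st by (simp add: state_size_def)
  qed
qed

definition reach :: "'a set \<Rightarrow> 'a state \<Rightarrow> 'a state set" where
  "reach A q = run q ` lists A"

text \<open>A run stays in \<open>q\<close> through loops and then enters a state of smaller rank;
  there are finitely many such exits.\<close>

lemma finite_reach:
  assumes A: "finite A"
  shows "finite (reach A q)"
proof (induction q rule: measure_induct_rule[where f = "state_size A"])
  case (less q)
  have "run q c \<in> insert q (\<Union>x\<in>{x \<in> A. step x q \<noteq> q}. reach A (step x q))" if "c \<in> lists A" for c
    using that
  proof (induction c)
    case (Cons x c)
    then show ?case by (cases "step x q = q") (auto simp: reach_def)
  qed simp
  then have "reach A q \<subseteq> insert q (\<Union>x\<in>{x \<in> A. step x q \<noteq> q}. reach A (step x q))"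
    unfolding reach_def by blast
  moreover have "finite (insert q (\<Union>x\<in>{x \<in> A. step x q \<noteq> q}. reach A (step x q)))"
    using A less state_size_step[OF A] by auto
  ultimately show ?case by (rule finite_subset)
qed

section \<open>Path counts of the automaton and their exponential generating functions\<close>

definition path_count :: "'a set \<Rightarrow> 'a state \<Rightarrow> 'a state \<Rightarrow> nat \<Rightarrow> nat" where
  "path_count B q q' a = card {c. set c \<subseteq> B \<and> length c = a \<and> run q c = q'}"

lemma path_count_Suc:
  assumes B: "finite B"
  shows "path_count B q q' (Suc a) = (\<Sum>x\<in>B. path_count B (step x q) q' a)"
proof -
  let ?W = "\<lambda>x. {c. set c \<subseteq> B \<and> length c = a \<and> run (step x q) c = q'}"
  have fin: "finite (?W x)" for x
    by (rule finite_subset[OF _ finite_lists_length_eq[OF B, of a]]) auto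
  have "{c. set c \<subseteq> B \<and> length c = Suc a \<and> run q c = q'} = (\<Union>x\<in>B. (#) x ` ?W x)" (is "?L = ?R")
  proof (intro equalityI subsetI)
    fix c assume "c \<in> ?L"
    then show "c \<in> ?R" by (cases c) auto
  qed auto
  moreover have "card (\<Union>x\<in>B. (#) x ` ?W x) = (\<Sum>x\<in>B. card ((#) x ` ?W x))"
    by (rule card_UN_disjoint) (use B fin in auto)
  ultimately show ?thesis by (simp add: path_count_def card_image)
qed

definition exp_term :: "nat \<Rightarrow> nat \<Rightarrow> nat \<Rightarrow> rat" where
  "exp_term j c a = (if a < j then 0 else of_nat c ^ (a - j) / fact (a - j))"

text \<open>Taylor coefficients of the linear combinations of the functions \<open>z\<^sup>j e\<^bsup>c z\<^esup>\<close>.\<close>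

inductive_set exp_seqs :: "(nat \<Rightarrow> rat) set" where
  exp_term: "exp_term j c \<in> exp_seqs"
| add: "e \<in> exp_seqs \<Longrightarrow> e' \<in> exp_seqs \<Longrightarrow> (\<lambda>a. e a + e' a) \<in> exp_seqs"
| scale: "e \<in> exp_seqs \<Longrightarrow> (\<lambda>a. r * e a) \<in> exp_seqs"

lemma exp_seqs_zero: "(\<lambda>a. 0) \<in> exp_seqs"
  using exp_seqs.scale[OF exp_seqs.exp_term[of 0 0], of 0] by simp

lemma exp_seqs_sum: "finite I \<Longrightarrow> (\<And>i. i \<in> I \<Longrightarrow> e i \<in> exp_seqs) \<Longrightarrow> (\<lambda>a. \<Sum>i\<in>I. e i a) \<in> exp_seqs"
  by (induction I rule: finite_induct) (simp_all add: exp_seqs_zero exp_seqs.add)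

text \<open>The derivative of \<open>z^j e^(c z)\<close>, coefficient by coefficient. For
  \<open>j = 0\<close> the truncated \<open>j - 1\<close> is harmless because of the factor
  \<open>j\<close>.\<close>

lemma exp_term_Suc:
  "of_nat (Suc a) * exp_term j c (Suc a) = of_nat j * exp_term (j - 1) c a + of_nat c * exp_term j c a"
proof -
  consider "Suc a < j" | "Suc a = j" | m where "a = j + m"
    by (metis less_Suc_eq_le linorder_neqE_nat nat_le_iff_add not_less_eq)
  then show ?thesis
  proof cases
    case 3
    have f: "(fact (Suc m) :: rat) = of_nat (Suc m) * fact m" by simp
    have nz: "(fact m :: rat) \<noteq> 0" "(of_nat (Suc m) :: rat) \<noteq> 0" by (simp, metis of_nat_neq_0)
    have e1: "exp_term j c (Suc a) = of_nat c ^ Suc m / (of_nat (Suc m) * fact m)"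
      and e2: "exp_term j c a = of_nat c ^ m / fact m"
      using 3 f by (simp_all add: exp_term_def)
    have e3: "of_nat j * exp_term (j - 1) c a = of_nat j * (of_nat c ^ Suc m / (of_nat (Suc m) * fact m))"
    proof (cases j)
      case (Suc i)
      then have "a - i = Suc m" "\<not> a < i" using 3 by auto
      then show ?thesis using f Suc by (simp add: exp_term_def)
    qed simp
    have "(of_nat (Suc a) :: rat) = of_nat j + of_nat (Suc m)" using 3 by simp
    then show ?thesis unfolding e1 e2 e3 using nz by (simp only:) (simp add: field_simps del: of_nat_Suc)
  qed (auto simp: exp_term_def)
qed

text \<open>Solves \<open>p' = l p + g\<close> by undetermined coefficients: the exponent
  \<open>c = l\<close> is resonant and raises the power of \<open>z\<close> by one; any other
  exponent is treated by induction on the power.\<close>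

lemma exp_seqs_particular:
  assumes "g \<in> exp_seqs"
  shows "\<exists>p\<in>exp_seqs. \<forall>a. of_nat (Suc a) * p (Suc a) = of_nat l * p a + g a"
  using assms
proof induction
  case (exp_term j c)
  show ?case
  proof (cases "c = l")
    case True
    have "of_nat (Suc a) * (1 / of_nat (Suc j) * exp_term (Suc j) c (Suc a)) =
        of_nat l * (1 / of_nat (Suc j) * exp_term (Suc j) c a) + exp_term j c a" for a
      using exp_term_Suc[of a "Suc j" c] True by (simp add: field_simps del: of_nat_Suc)
    then show ?thesis
      by (intro bexI[of _ "\<lambda>a. 1 / of_nat (Suc j) * exp_term (Suc j) c a"] exp_seqs.scale exp_seqs.exp_term) blast
  next
    case False
    then have nz: "(of_nat c - of_nat l :: rat) \<noteq> 0" by simp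
    show ?thesis
    proof (induction j)
      case 0
      have "of_nat (Suc a) * (1 / (of_nat c - of_nat l) * exp_term 0 c (Suc a)) =
        of_nat l * (1 / (of_nat c - of_nat l) * exp_term 0 c a) + exp_term 0 c a" for a
        using exp_term_Suc[of a 0 c] nz by (simp add: field_simps del: of_nat_Suc)
      then show ?case
        by (intro bexI[of _ "\<lambda>a. 1 / (of_nat c - of_nat l) * exp_term 0 c a"] exp_seqs.scale exp_seqs.exp_term) blast
    next
      case (Suc j)
      then obtain p where p: "p \<in> exp_seqs"
        "\<And>a. of_nat (Suc a) * p (Suc a) = of_nat l * p a + exp_term j c a" by blast
      \<comment> \<open>Differentiating \<open>z^(j+1) e^(c z)\<close> also produces
        \<open>(j+1) z^j e^(c z)\<close>; subtracting \<open>j+1\<close> times the solution for the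
        lower power cancels it.\<close>
      define p' where "p' a = 1 / (of_nat c - of_nat l) * (exp_term (Suc j) c a + (- of_nat (Suc j)) * p a)" for a
      have "of_nat (Suc a) * p' (Suc a) = of_nat l * p' a + exp_term (Suc j) c a" for a
      proof -
        have "of_nat (Suc a) * (exp_term (Suc j) c (Suc a) + (- of_nat (Suc j)) * p (Suc a))
          = of_nat (Suc a) * exp_term (Suc j) c (Suc a) - of_nat (Suc j) * (of_nat (Suc a) * p (Suc a))"
          by (simp add: algebra_simps del: of_nat_Suc)
        also have "\<dots> = of_nat l * (exp_term (Suc j) c a + (- of_nat (Suc j)) * p a) + (of_nat c - of_nat l) * exp_term (Suc j) c a"
          unfolding p(2) exp_term_Suc by (simp add: algebra_simps del: of_nat_Suc)
        finally show ?thesis using nz unfolding p'_def by (simp add: field_simps del: of_nat_Suc)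
      qed
      moreover have "p' \<in> exp_seqs"
        unfolding p'_def by (intro exp_seqs.scale exp_seqs.add exp_seqs.exp_term p)
      ultimately show ?case by blast
    qed
  qed
next
  case (add e e')
  then obtain p p' where "p \<in> exp_seqs" "p' \<in> exp_seqs"
    "\<forall>a. of_nat (Suc a) * p (Suc a) = of_nat l * p a + e a"
    "\<forall>a. of_nat (Suc a) * p' (Suc a) = of_nat l * p' a + e' a" by blast
  then show ?case
    by (intro bexI[of _ "\<lambda>a. p a + p' a"] exp_seqs.add) (simp_all add: distrib_left del: of_nat_Suc)
next
  case (scale e r)
  then obtain p where "p \<in> exp_seqs" "\<forall>a. of_nat (Suc a) * p (Suc a) = of_nat l * p a + e a" by blast
  then show ?case
    by (intro bexI[of _ "\<lambda>a. r * p a"] exp_seqs.scale) (simp_all add: algebra_simps del: of_nat_Suc)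
qed

text \<open>The solution is the particular one plus a multiple of \<open>e^(l z)\<close>, fixed by
  the constant term.\<close>

lemma exp_seqs_recurrence:
  assumes g: "g \<in> exp_seqs" and e: "\<And>a. of_nat (Suc a) * e (Suc a) = of_nat l * e a + g a"
  shows "e \<in> exp_seqs"
proof -
  obtain p where p: "p \<in> exp_seqs" "\<And>a. of_nat (Suc a) * p (Suc a) = of_nat l * p a + g a"
    using exp_seqs_particular[OF g] by blast
  have "e a = p a + (e 0 - p 0) * exp_term 0 l a" for a
  proof (induction a)
    case 0
    show ?case by (simp add: exp_term_def)
  next
    case (Suc a)
    have "of_nat (Suc a) * (p (Suc a) + (e 0 - p 0) * exp_term 0 l (Suc a)) =
       of_nat (Suc a) * p (Suc a) + (e 0 - p 0) * (of_nat (Suc a) * exp_term 0 l (Suc a))"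
      by (simp add: algebra_simps del: of_nat_Suc)
    also have "\<dots> = of_nat l * e a + g a"
      unfolding p(2) exp_term_Suc Suc.IH by (simp add: algebra_simps del: of_nat_Suc)
    finally have "of_nat (Suc a) * (p (Suc a) + (e 0 - p 0) * exp_term 0 l (Suc a)) = of_nat (Suc a) * e (Suc a)"
      using e by simp
    then show ?case by (simp del: of_nat_Suc)
  qed
  then have "e = (\<lambda>a. p a + (e 0 - p 0) * exp_term 0 l a)" by blast
  then show ?thesis using p(1) exp_seqs.add exp_seqs.scale exp_seqs.exp_term by metis
qed

text \<open>Cutting off the first letter shows that the generating function \<open>E\<close> of
  \<open>q\<close> satisfies \<open>E' = l E + g\<close>, where \<open>l\<close> is the number of
  loops at \<open>q\<close> and \<open>g\<close> collects the generating functions of states of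
  smaller rank.\<close>

lemma path_count_exp_seqs:
  assumes B: "finite B"
  shows "(\<lambda>a. of_nat (path_count B q q' a) / fact a) \<in> exp_seqs"
proof (induction q rule: measure_induct_rule[where f = "state_size B"])
  case (less q)
  define L where "L = {x \<in> B. step x q = q}"
  define M where "M = {x \<in> B. step x q \<noteq> q}"
  have fin: "finite L" "finite M" "L \<inter> M = {}" "B = L \<union> M" using B by (auto simp: L_def M_def)
  show ?case
  proof (rule exp_seqs_recurrence[where l = "card L" and g = "\<lambda>a. \<Sum>x\<in>M. of_nat (path_count B (step x q) q' a) / fact a"])
    show "(\<lambda>a. \<Sum>x\<in>M. of_nat (path_count B (step x q) q' a) / fact a) \<in> exp_seqs"
    proof (rule exp_seqs_sum[OF fin(2)])
      fix x assume "x \<in> M"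
      then show "(\<lambda>a. of_nat (path_count B (step x q) q' a) / fact a) \<in> exp_seqs"
        using less.IH[of "step x q"] state_size_step[OF B] by (simp add: M_def)
    qed
    fix a
    have "path_count B q q' (Suc a) = (\<Sum>x\<in>L. path_count B (step x q) q' a) + (\<Sum>x\<in>M. path_count B (step x q) q' a)"
      unfolding path_count_Suc[OF B] using fin sum.union_disjoint[OF fin(1-3)] by simp
    also have "(\<Sum>x\<in>L. path_count B (step x q) q' a) = card L * path_count B q q' a"
      by (simp add: L_def)
    finally have *: "path_count B q q' (Suc a) = card L * path_count B q q' a + (\<Sum>x\<in>M. path_count B (step x q) q' a)" .
    have "of_nat (Suc a) * (of_nat (path_count B q q' (Suc a)) / fact (Suc a)) = (of_nat (path_count B q q' (Suc a)) / fact a :: rat)"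
      by (simp add: field_simps del: of_nat_Suc)
    also have "\<dots> = of_nat (card L) * (of_nat (path_count B q q' a) / fact a) + (\<Sum>x\<in>M. of_nat (path_count B (step x q) q' a) / fact a)"
      unfolding * by (simp add: add_divide_distrib sum_divide_distrib)
    finally show "of_nat (Suc a) * (of_nat (path_count B q q' (Suc a)) / fact (Suc a)) = (of_nat (card L) * (of_nat (path_count B q q' a) / fact a) + (\<Sum>x\<in>M. of_nat (path_count B (step x q) q' a) / fact a) :: rat)" .
  qed
qed


section \<open>Exponential polynomials\<close>

abbreviation lookup :: "('a \<Rightarrow>\<^sub>0 'b::zero) \<Rightarrow> 'a \<Rightarrow> 'b" where
  "lookup \<equiv> Poly_Mapping.lookup"

abbreviation keys :: "('a \<Rightarrow>\<^sub>0 'b::zero) \<Rightarrow> 'a set" where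
  "keys \<equiv> Poly_Mapping.keys"

abbreviation single :: "'a \<Rightarrow> 'b \<Rightarrow> 'a \<Rightarrow>\<^sub>0 'b::zero" where
  "single \<equiv> Poly_Mapping.single"

text \<open>Makes the sum in \<open>ps_mult\<close> a genuine finite sum: a summand is determined by
  its values on \<open>keys \<mu>\<close>, each bounded by that of \<open>\<mu>\<close>.\<close>

lemma finite_poly_mapping_pairs: "finite {(a, b). a + b = (\<mu> :: 'v \<Rightarrow>\<^sub>0 nat)}"
proof -
  let ?S = "{(a, b). a + b = \<mu>}"
  define r where "r = (\<lambda>(a :: 'v \<Rightarrow>\<^sub>0 nat, b :: 'v \<Rightarrow>\<^sub>0 nat). restrict (lookup a) (keys \<mu>))"
  have "inj_on r ?S"
  proof (rule inj_onI)
    fix p p' assume p: "p \<in> ?S" "p' \<in> ?S" "r p = r p'"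
    obtain a b a' b' where ab: "p = (a, b)" "p' = (a', b')" by fastforce
    have s: "a + b = \<mu>" "a' + b' = \<mu>" using p ab by auto
    have "lookup a k = lookup a' k" for k
    proof (cases "k \<in> keys \<mu>")
      case True
      then show ?thesis using p(3) ab by (auto simp: r_def dest: fun_cong[of _ _ k])
    next
      case False
      then have "lookup (a + b) k = 0" "lookup (a' + b') k = 0"
        using s by (auto simp: in_keys_iff)
      then show ?thesis by (simp add: lookup_add)
    qed
    then have "a = a'" by (intro poly_mapping_eqI)
    then show "p = p'" using s ab by auto
  qed
  moreover have "r ` ?S \<subseteq> (\<Pi>\<^sub>E k\<in>keys \<mu>. {..lookup \<mu> k})"
    by (auto simp: r_def lookup_add)
  ultimately show ?thesis
    by (meson finite_PiE finite_atMost finite_keys finite_subset inj_on_finite)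
qed

section \<open>Power series in a single variable as exponential polynomials\<close>

definition univ_series :: "'v \<Rightarrow> (nat \<Rightarrow> rat) \<Rightarrow> 'v power_series" where
  "univ_series v e \<mu> = (if keys \<mu> \<subseteq> {v} then e (lookup \<mu> v) else 0)"

lemma poly_mapping_single_keysD:
  "keys \<mu> \<subseteq> {v} \<Longrightarrow> \<mu> = single v (lookup \<mu> v)"
  by (rule poly_mapping_eqI) (auto simp: lookup_single when_def in_keys_iff)

text \<open>Only powers of \<open>v\<close> contribute from the first factor. The bound on
  \<open>i\<close> makes the truncated subtraction \<open>\<mu> - single v i\<close> exact.\<close>

lemma ps_mult_univ_series:
  "ps_mult (univ_series v e) G \<mu> =
     (\<Sum>i\<le>lookup \<mu> v. e i * G (\<mu> - single v i))"
proof -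
  let ?h = "\<lambda>i. (single v i, \<mu> - single v i)"
  have inj: "inj_on ?h {..lookup \<mu> v}"
    by (rule inj_onI) (metis lookup_single_eq prod.inject)
  have "ps_mult (univ_series v e) G \<mu> = (\<Sum>(a, b)\<in>?h ` {..lookup \<mu> v}. univ_series v e a * G b)"
    unfolding ps_mult_def
  proof (rule sum.mono_neutral_right[OF finite_poly_mapping_pairs])
    show "?h ` {..lookup \<mu> v} \<subseteq> {(a, b). a + b = \<mu>}"
      by (auto intro!: poly_mapping_eqI simp: lookup_add lookup_minus lookup_single when_def)
    show "\<forall>p\<in>{(a, b). a + b = \<mu>} - ?h ` {..lookup \<mu> v}. (case p of (a, b) \<Rightarrow> univ_series v e a * G b) = 0"
    proof
      fix p assume "p \<in> {(a, b). a + b = \<mu>} - ?h ` {..lookup \<mu> v}"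
      then obtain a b where p: "p = (a, b)"
        and *: "(a, b) \<notin> ?h ` {..lookup (a + b) v}" "\<mu> = a + b" by auto
      have "\<not> keys a \<subseteq> {v}"
      proof
        assume "keys a \<subseteq> {v}"
        then have a: "a = single v (lookup a v)" by (rule poly_mapping_single_keysD)
        have "b = a + b - single v (lookup a v)" by (subst a[symmetric]) simp
        then have "(a, b) = (single v (lookup a v), a + b - single v (lookup a v))"
          using a by simp
        moreover have "lookup a v \<in> {..lookup (a + b) v}" by (simp add: lookup_add)
        ultimately show False using *(1) unfolding *(2) by blast
      qed
      then show "(case p of (a, b) \<Rightarrow> univ_series v e a * G b) = 0" by (simp add: p univ_series_def)
    qed
  qed
  also have "\<dots> = (\<Sum>i\<le>lookup \<mu> v. univ_series v e (single v i) * G (\<mu> - single v i))"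
    by (subst sum.reindex[OF inj]) simp
  moreover have "univ_series v e (single v i) = e i" for i
    by (simp add: univ_series_def)
  ultimately show ?thesis by (simp only:)
qed

lemma ps_mult_univ_univ:
  "ps_mult (univ_series v e) (univ_series v e') = univ_series v (\<lambda>a. \<Sum>i\<le>a. e i * e' (a - i))"
proof
  fix \<mu>
  show "ps_mult (univ_series v e) (univ_series v e') \<mu> = univ_series v (\<lambda>a. \<Sum>i\<le>a. e i * e' (a - i)) \<mu>"
  proof (cases "keys \<mu> \<subseteq> {v}")
    case True
    moreover have "keys (\<mu> - single v i) \<subseteq> keys \<mu>" for i
    proof
      fix x assume "x \<in> keys (\<mu> - single v i)"
      then show "x \<in> keys \<mu>"
        by (cases "lookup \<mu> x = 0") (simp_all add: in_keys_iff lookup_minus)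
    qed
    ultimately have "keys (\<mu> - single v i) \<subseteq> {v}" for i by blast
    then show ?thesis using True by (simp add: ps_mult_univ_series univ_series_def lookup_minus)
  next
    case False
    then obtain x where x: "x \<in> keys \<mu>" "x \<noteq> v" by blast
    then have "x \<in> keys (\<mu> - single v i)" for i
      by (simp add: in_keys_iff lookup_minus lookup_single)
    then have "\<not> keys (\<mu> - single v i) \<subseteq> {v}" for i
      using x by blast
    then show ?thesis using False by (simp add: ps_mult_univ_series univ_series_def)
  qed
qed

lemma exp_polynomials_zero: "(\<lambda>\<mu>. 0) \<in> exp_polynomials"
  using exp_polynomials.const[of 0] by (simp add: ps_const_def[abs_def])

lemma exp_polynomials_plus:
  "p \<in> exp_polynomials \<Longrightarrow> q \<in> exp_polynomials \<Longrightarrow> (\<lambda>\<mu>. p \<mu> + q \<mu>) \<in> exp_polynomials"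
  using exp_polynomials.add[of p q] by (simp add: ps_add_def[abs_def])

lemma exp_polynomials_sum:
  "finite I \<Longrightarrow> (\<And>i. i \<in> I \<Longrightarrow> p i \<in> exp_polynomials) \<Longrightarrow> (\<lambda>\<mu>. \<Sum>i\<in>I. p i \<mu>) \<in> exp_polynomials"
  by (induction I rule: finite_induct) (simp_all add: exp_polynomials_zero exp_polynomials_plus)

lemma univ_series_0: "univ_series v (\<lambda>a. if a = 0 then r else 0) = ps_const r"
proof
  fix \<mu> :: "'a \<Rightarrow>\<^sub>0 nat"
  have "lookup \<mu> v \<noteq> 0" if "keys \<mu> \<subseteq> {v}" "\<mu> \<noteq> 0"
    using that by (metis poly_mapping_single_keysD single_zero)
  then show "univ_series v (\<lambda>a. if a = 0 then r else 0) \<mu> = ps_const r \<mu>"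
    by (auto simp: univ_series_def ps_const_def)
qed

lemma univ_series_1: "univ_series v (\<lambda>a. if a = 1 then 1 else 0) = ps_var v"
proof
  fix \<mu> :: "'a \<Rightarrow>\<^sub>0 nat"
  show "univ_series v (\<lambda>a. if a = 1 then 1 else 0) \<mu> = ps_var v \<mu>"
    using poly_mapping_single_keysD[of \<mu> v] by (auto simp: univ_series_def ps_var_def)
qed

text \<open>Each step of the induction on \<open>c\<close> multiplies by \<open>e^v\<close>, through
  the binomial theorem; each step of the induction on \<open>j\<close> multiplies by
  \<open>v\<close>.\<close>

lemma univ_series_exp_term: "univ_series v (exp_term j c) \<in> exp_polynomials"
proof (induction j)
  case 0
  show ?case
  proof (induction c)
    case 0
    have "exp_term 0 0 = (\<lambda>a. if a = 0 then 1 else 0)" by (auto simp: exp_term_def fun_eq_iff)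
    then show ?case using univ_series_0[of v 1] exp_polynomials.const[of 1] by metis
  next
    case (Suc c)
    have "(\<Sum>i\<le>a. exp_term 0 1 i * exp_term 0 c (a - i)) = exp_term 0 (Suc c) a" for a
    proof -
      have "exp_term 0 (Suc c) a = (1 + of_nat c) ^ a / fact a" by (simp add: exp_term_def)
      also have "(1 + of_nat c) ^ a = (\<Sum>i\<le>a. of_nat (a choose i) * 1 ^ i * (of_nat c :: rat) ^ (a - i))"
        by (rule binomial_ring)
      also have "\<dots> / fact a = (\<Sum>i\<le>a. exp_term 0 1 i * exp_term 0 c (a - i))"
        unfolding sum_divide_distrib
        by (intro sum.cong) (simp_all add: exp_term_def binomial_fact field_simps)
      finally show ?thesis by simp
    qed
    then have "univ_series v (exp_term 0 (Suc c)) = ps_mult (univ_series v (exp_term 0 1)) (univ_series v (exp_term 0 c))"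
      by (simp add: ps_mult_univ_univ)
    moreover have "univ_series v (exp_term 0 1) = ps_exp_var v"
      by (auto simp: univ_series_def exp_term_def ps_exp_var_def fun_eq_iff)
    ultimately show ?case using Suc exp_polynomials.exp_var exp_polynomials.mult by metis
  qed
next
  case (Suc j)
  have "(\<Sum>i\<le>a. (if i = 1 then 1 else 0) * exp_term j c (a - i)) = exp_term (Suc j) c a" for a
  proof (cases a)
    case (Suc b)
    have "(\<Sum>i\<le>a. (if i = 1 then 1 else 0) * exp_term j c (a - i)) = (\<Sum>i\<in>{1}. (if i = 1 then 1 else 0) * exp_term j c (a - i))"
      by (rule sum.mono_neutral_right) (use Suc in auto)
    then show ?thesis using Suc by (simp add: exp_term_def)
  qed (simp add: exp_term_def)
  then have "univ_series v (exp_term (Suc j) c) = ps_mult (ps_var v) (univ_series v (exp_term j c))"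
    unfolding univ_series_1[symmetric] ps_mult_univ_univ by (simp only:)
  then show ?case using Suc exp_polynomials.mult exp_polynomials.var by metis
qed

lemma univ_series_exp_seqs: "e \<in> exp_seqs \<Longrightarrow> univ_series v e \<in> exp_polynomials"
proof (induction rule: exp_seqs.induct)
  case (add e e')
  have "univ_series v (\<lambda>a. e a + e' a) = (\<lambda>\<mu>. univ_series v e \<mu> + univ_series v e' \<mu>)"
    by (auto simp: univ_series_def fun_eq_iff)
  then show ?case using add exp_polynomials_plus by metis
next
  case (scale e r)
  have "(\<Sum>i\<le>a. (if i = 0 then r else 0) * e (a - i)) = r * e a" for a
  proof -
    have "(\<Sum>i\<le>a. (if i = 0 then r else 0) * e (a - i)) = (\<Sum>i\<in>{0}. (if i = 0 then r else 0) * e (a - i))"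
      by (rule sum.mono_neutral_right) auto
    then show ?thesis by simp
  qed
  then have "univ_series v (\<lambda>a. r * e a) = ps_mult (ps_const r) (univ_series v e)"
    unfolding univ_series_0[of v, symmetric] ps_mult_univ_univ by (simp only:)
  then show ?case using scale exp_polynomials.const exp_polynomials.mult by metis
qed (rule univ_series_exp_term)

section \<open>Series counting avoiding words whose weights are sorted into blocks\<close>

definition block_word :: "'v list \<Rightarrow> ('v \<Rightarrow>\<^sub>0 nat) \<Rightarrow> 'v list" where
  "block_word vs \<mu> = concat (map (\<lambda>v. replicate (lookup \<mu> v) v) vs)"

definition lifts :: "('v \<Rightarrow> 'a set) \<Rightarrow> 'v list \<Rightarrow> 'a list set" where
  "lifts B ps = {c. list_all2 (\<lambda>x v. x \<in> B v) c ps}"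

lemma finite_lifts: "(\<And>v. finite (B v)) \<Longrightarrow> finite (lifts B ps)"
proof (induction ps)
  case (Cons v ps)
  have "lifts B (v # ps) = (\<lambda>(x, c). x # c) ` (B v \<times> lifts B ps)"
    by (auto simp: lifts_def list_all2_Cons2 image_iff)
  with Cons show ?case by simp
qed (simp add: lifts_def)

text \<open>The exponential generating function of these words in the block lengths, one variable
  for each entry of \<open>vs\<close>.\<close>

definition block_series :: "('v \<Rightarrow> 'a set) \<Rightarrow> 'v list \<Rightarrow> 'a state \<Rightarrow> 'v power_series" where
  "block_series B vs q \<mu> = (if keys \<mu> \<subseteq> set vs
     then of_nat (card {c \<in> lifts B (block_word vs \<mu>). avoids q c}) / (\<Prod>v\<in>set vs. fact (lookup \<mu> v))
     else 0)"

text \<open>Cut each word after its first block and sort by the state reached there; from then on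
  avoidance depends only on this state.\<close>

lemma card_lifts_append:
  assumes A: "finite A" and B: "\<And>v. B v \<subseteq> A"
  shows "card {c \<in> lifts B (replicate a v @ ps). avoids q c} =
    (\<Sum>q'\<in>reach A q. path_count (B v) q q' a * card {c \<in> lifts B ps. avoids q' c})"
proof -
  let ?P = "\<lambda>q'. {c. set c \<subseteq> B v \<and> length c = a \<and> run q c = q'}"
  let ?W = "\<lambda>q'. {c \<in> lifts B ps. avoids q' c}"
  have Bf: "finite (B v)" for v using A B finite_subset by blast
  have rep: "list_all2 (\<lambda>x v. x \<in> B v) c (replicate a v) \<longleftrightarrow> set c \<subseteq> B v \<and> length c = a" for c
    by (auto simp: list_all2_conv_all_nth in_set_conv_nth subset_iff)
  have fP: "finite (?P q')" for q'
    by (rule finite_subset[OF _ finite_lists_length_eq[OF Bf, of v a]]) auto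
  have fW: "finite (?W q')" for q' using finite_lifts[of B ps] Bf by simp
  have av: "avoids q (c @ d) \<longleftrightarrow> avoids (run q c) d" for c d
    by (metis avoids_run run_simps(3))
  have "{c \<in> lifts B (replicate a v @ ps). avoids q c} =
    (\<lambda>(c, d). c @ d) ` (\<Union>q'\<in>reach A q. ?P q' \<times> ?W q')" (is "?L = ?R")
  proof (intro equalityI subsetI)
    fix e assume "e \<in> ?L"
    then obtain c d where "e = c @ d" "set c \<subseteq> B v" "length c = a" "d \<in> lifts B ps" "avoids (run q c) d"
      by (auto simp: lifts_def list_all2_append2 rep av)
    moreover from this have "run q c \<in> reach A q" using B[of v] by (auto simp: reach_def)
    ultimately show "e \<in> ?R" by (auto simp: image_iff)
  next
    fix e assume "e \<in> ?R"
    then obtain c d where e: "e = c @ d" "set c \<subseteq> B v \<and> length c = a" "d \<in> lifts B ps" "avoids (run q c) d"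
      by auto
    from e(2) have "list_all2 (\<lambda>x v. x \<in> B v) c (replicate a v)" by (simp only: rep)
    then show "e \<in> ?L" using e by (auto simp: lifts_def av intro!: list_all2_appendI)
  qed
  moreover have "inj_on (\<lambda>(c, d). c @ d) (\<Union>q'\<in>reach A q. ?P q' \<times> ?W q')"
    by (auto simp: inj_on_def)
  ultimately have "card ?L = card (\<Union>q'\<in>reach A q. ?P q' \<times> ?W q')" by (simp add: card_image)
  also have "\<dots> = (\<Sum>q'\<in>reach A q. card (?P q' \<times> ?W q'))"
    by (rule card_UN_disjoint) (use finite_reach[OF A] fP fW in auto)
  finally show ?thesis by (simp add: card_cartesian_product path_count_def)
qed

lemma block_word_cong:
  fixes \<mu> \<mu>' :: "'v \<Rightarrow>\<^sub>0 nat"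
  shows "(\<And>v. v \<in> set vs \<Longrightarrow> lookup \<mu> v = lookup \<mu>' v) \<Longrightarrow> block_word vs \<mu> = block_word vs \<mu>'"
  unfolding block_word_def by (intro arg_cong[of _ _ concat] map_cong) auto

text \<open>Peeling off the block of \<open>v\<close> gives a finite sum, over the states reached,
  of a series in \<open>v\<close> alone times a series in the remaining variables.\<close>

theorem block_series_exp_polynomials:
  assumes A: "finite A" and B: "\<And>v. B v \<subseteq> A" and vs: "distinct vs"
  shows "block_series B vs q \<in> exp_polynomials"
  using vs
proof (induction vs arbitrary: q)
  case Nil
  have "block_series B [] q = ps_const (of_nat (card {c \<in> lifts B []. avoids q c}))"
    by (auto simp: block_series_def ps_const_def block_word_def fun_eq_iff)
  then show ?case using exp_polynomials.const by metis
next
  case (Cons v vs)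
  have Bf: "finite (B v)" using A B finite_subset by blast
  let ?e = "\<lambda>q' a. of_nat (path_count (B v) q q' a) / fact a :: rat"
  have "block_series B (v # vs) q = (\<lambda>\<mu>. \<Sum>q'\<in>reach A q. ps_mult (univ_series v (?e q')) (block_series B vs q') \<mu>)"
  proof
    fix \<mu> :: "'b \<Rightarrow>\<^sub>0 nat"
    let ?a = "lookup \<mu> v"
    let ?\<nu> = "\<mu> - single v ?a"
    have v: "v \<notin> set vs" using Cons.prems by simp
    \<comment> \<open>As \<open>v\<close> does not occur in \<open>vs\<close>, the second factor
      vanishes unless the whole power of \<open>v\<close> has been removed.\<close>
    have 0: "block_series B vs q' (\<mu> - single v i) = 0" if "i < ?a" for q' i
      using that v by (auto simp: block_series_def in_keys_iff lookup_minus subset_iff)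
    have "ps_mult (univ_series v (?e q')) (block_series B vs q') \<mu> = ?e q' ?a * block_series B vs q' ?\<nu>" for q'
    proof -
      have "ps_mult (univ_series v (?e q')) (block_series B vs q') \<mu> = (\<Sum>i\<in>{?a}. ?e q' i * block_series B vs q' (\<mu> - single v i))"
        unfolding ps_mult_univ_series by (rule sum.mono_neutral_right) (auto simp: 0)
      then show ?thesis by simp
    qed
    moreover have "block_series B (v # vs) q \<mu> = (\<Sum>q'\<in>reach A q. ?e q' ?a * block_series B vs q' ?\<nu>)"
    proof (cases "keys \<mu> \<subseteq> set (v # vs)")
      case False
      then have "\<not> keys ?\<nu> \<subseteq> set vs"
        by (auto simp: in_keys_iff lookup_minus lookup_single when_def subset_iff)
      then show ?thesis using False by (simp add: block_series_def)
    next
      case True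
      then have keys: "keys ?\<nu> \<subseteq> set vs"
        by (auto simp: in_keys_iff lookup_minus lookup_single when_def subset_iff split: if_splits)
      have l: "lookup ?\<nu> u = lookup \<mu> u" if "u \<in> set vs" for u
        using that v by (auto simp: lookup_minus lookup_single when_def)
      have "block_word (v # vs) \<mu> = replicate ?a v @ block_word vs ?\<nu>"
        using block_word_cong[OF l] by (simp add: block_word_def)
      then have "of_nat (card {c \<in> lifts B (block_word (v # vs) \<mu>). avoids q c}) =
         (\<Sum>q'\<in>reach A q. of_nat (path_count (B v) q q' ?a) * of_nat (card {c \<in> lifts B (block_word vs ?\<nu>). avoids q' c}) :: rat)"
        by (simp add: card_lifts_append[OF A B])
      moreover have "(\<Prod>u\<in>set (v # vs). fact (lookup \<mu> u)) = (fact ?a * (\<Prod>u\<in>set vs. fact (lookup ?\<nu> u)) :: rat)"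
        using v l by simp
      ultimately show ?thesis using True keys
        unfolding block_series_def by (simp only: if_True sum_divide_distrib times_divide_times_eq)
    qed
    ultimately show "block_series B (v # vs) q \<mu> = (\<Sum>q'\<in>reach A q. ps_mult (univ_series v (?e q')) (block_series B vs q') \<mu>)"
      by simp
  qed
  moreover have "(\<lambda>\<mu>. \<Sum>q'\<in>reach A q. ps_mult (univ_series v (?e q')) (block_series B vs q') \<mu>) \<in> exp_polynomials"
    using finite_reach[OF A] path_count_exp_seqs[OF Bf] Cons
    by (intro exp_polynomials_sum exp_polynomials.mult univ_series_exp_seqs) auto
  ultimately show ?case by simp
qed


section \<open>Leading words of submodules\<close>

text \<open>Adding the elements in increasing order, exactly those outside the span of their
  predecessors enlarge a basis.\<close>

lemma (in vector_space) dim_span_image_linorder: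
  fixes \<pi> :: "'p::linorder \<Rightarrow> 'b"
  assumes "finite X"
  shows "dim (span (\<pi> ` X)) = card {p \<in> X. \<pi> p \<notin> span (\<pi> ` {q \<in> X. q < p})}"
proof -
  define std where "std X = {p \<in> X. \<pi> p \<notin> span (\<pi> ` {q \<in> X. q < p})}" for X
  have "independent (\<pi> ` std X) \<and> inj_on \<pi> (std X) \<and> span (\<pi> ` std X) = span (\<pi> ` X)"
    using assms
  proof (induction X rule: finite_linorder_max_induct)
    case empty
    show ?case by (simp add: std_def independent_empty)
  next
    case (insert b X)
    have X: "{q \<in> insert b X. q < b} = X" using insert.hyps by auto
    have lt: "{q \<in> insert b X. q < p} = {q \<in> X. q < p}" if "p \<in> X" for p
      using insert.hyps that by auto
    have b: "b \<notin> X" using insert.hyps by auto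
    have std: "std (insert b X) = (if \<pi> b \<in> span (\<pi> ` X) then std X else insert b (std X))"
    proof -
      have "p \<in> std (insert b X) \<longleftrightarrow> p = b \<and> \<pi> b \<notin> span (\<pi> ` X) \<or> p \<in> std X" for p
      proof (cases "p = b")
        case True
        then show ?thesis using b X by (simp add: std_def)
      next
        case False
        show ?thesis
        proof (cases "p \<in> X")
          case True
          then show ?thesis using False lt[OF True] unfolding std_def by simp
        qed (use False in \<open>simp add: std_def\<close>)
      qed
      then show ?thesis by auto
    qed
    have sub: "std X \<subseteq> X" by (auto simp: std_def)
    show ?case
    proof (cases "\<pi> b \<in> span (\<pi> ` X)")
      case True
      then show ?thesis using insert.IH std by (simp add: span_redundant)
    next
      case False
      then have "\<pi> b \<notin> span (\<pi> ` std X)" using insert.IH by simp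
      then have "independent (insert (\<pi> b) (\<pi> ` std X))" "\<pi> b \<notin> \<pi> ` std X"
        using insert.IH by (auto simp: independent_insert intro: span_base)
      moreover have "span (insert (\<pi> b) (\<pi> ` std X)) = span (insert (\<pi> b) (\<pi> ` X))"
        using insert.IH by (auto simp: span_insert)
      ultimately show ?thesis using insert.IH std False b sub by auto
    qed
  qed
  then have "dim (span (\<pi> ` X)) = card (\<pi> ` std X)" "inj_on \<pi> (std X)"
    by (metis dim_eq_card_independent dim_span)+
  then show ?thesis by (simp add: card_image std_def)
qed

text \<open>\<open>D n g\<close> abstracts the duplication along \<open>g\<close>. Its linearity is
  required only on the span of the words of length \<open>n\<close>, because the maps of a functor
  are controlled only on its values.\<close>

locale word_module = vector_space scale
  for scale :: "'k::field \<Rightarrow> 'b::ab_group_add \<Rightarrow> 'b" +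
  fixes I :: "'s::linorder set" and A :: "'a::linorder set"
    and \<pi> :: "'s \<times> 'a list \<Rightarrow> 'b" and D :: "nat \<Rightarrow> nat list \<Rightarrow> 'b \<Rightarrow> 'b"
  assumes fin_I: "finite I" and fin_A: "finite A"
    and D_add: "set g = {..<n} \<Longrightarrow> x \<in> span (\<pi> ` (I \<times> {c \<in> lists A. length c = n})) \<Longrightarrow>
       y \<in> span (\<pi> ` (I \<times> {c \<in> lists A. length c = n})) \<Longrightarrow> D n g (x + y) = D n g x + D n g y"
    and D_scale: "set g = {..<n} \<Longrightarrow> x \<in> span (\<pi> ` (I \<times> {c \<in> lists A. length c = n})) \<Longrightarrow>
       D n g (scale r x) = scale r (D n g x)"
    and D_word: "\<sigma> \<in> I \<Longrightarrow> c \<in> lists A \<Longrightarrow> set g = {..<length c} \<Longrightarrow>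
       D (length c) g (\<pi> (\<sigma>, c)) = \<pi> (\<sigma>, map ((!) c) g)"
begin

definition words :: "nat \<Rightarrow> ('s \<times> 'a list) set" where
  "words n = I \<times> {c \<in> lists A. length c = n}"

abbreviation E :: "nat \<Rightarrow> 'b set" where
  "E n \<equiv> span (\<pi> ` words n)"

lemma finite_words: "finite (words n)"
proof -
  have "{c \<in> lists A. length c = n} = {c. set c \<subseteq> A \<and> length c = n}" by auto
  then show ?thesis using fin_I finite_lists_length_eq[OF fin_A] by (simp add: words_def)
qed

text \<open>Membership in \<open>E n\<close> is carried through the induction because the linearity
  of \<open>D n g\<close> is known only there.\<close>

lemma D_span:
  assumes g: "set g = {..<n}" and T: "T \<subseteq> E n" "\<And>t. t \<in> T \<Longrightarrow> D n g t \<in> span T'"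
    and y: "y \<in> span T"
  shows "y \<in> E n \<and> D n g y \<in> span T'"
  using y
proof (induction rule: span_induct_alt)
  case base
  have "D n g (scale 0 0) = scale 0 (D n g 0)" by (rule D_scale[OF g]) (rule span_zero)
  then show ?case by (simp add: span_zero)
next
  case (step r x y)
  then have x: "x \<in> E n" "D n g x \<in> span T'" using T by auto
  then have "D n g (scale r x + y) = scale r (D n g x) + D n g y"
    using step D_add[OF g] D_scale[OF g] by (simp add: words_def span_scale)
  then show ?case using x step by (simp add: span_add span_scale)
qed

lemma D_diff:
  assumes g: "set g = {..<n}" and x: "x \<in> E n" and y: "y \<in> E n"
  shows "D n g (x - y) = D n g x - D n g y"
proof -
  have 1: "D n g (x + scale (- 1) y) = D n g x + D n g (scale (- 1) y)"
    using x y by (intro D_add[OF g]) (simp_all only: words_def span_scale)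
  have 2: "D n g (scale (- 1) y) = scale (- 1) (D n g y)"
    using y by (intro D_scale[OF g]) (simp only: words_def)
  show ?thesis using 1 unfolding 2 by simp
qed

lemma map_nth_lists:
  "c \<in> lists A \<Longrightarrow> set g = {..<length c} \<Longrightarrow> map ((!) c) g \<in> lists A"
  by auto

text \<open>Pairs are compared first by \<open>\<sigma>\<close>, which \<open>D\<close> leaves
  alone, then lexicographically, where restricted growth preserves strictness. The sets
  \<open>W\<close> and \<open>W'\<close> allow the use both for all words and for words of a fixed
  weight.\<close>

lemma D_lower:
  assumes g: "set g = {..<length c}" "restricted_growth g"
    and W: "W \<subseteq> words (length c)" "\<And>\<tau> d. (\<tau>, d) \<in> W \<Longrightarrow> (\<tau>, map ((!) d) g) \<in> W'"
    and y: "y \<in> span (\<pi> ` {q \<in> W. q < (\<sigma>, c)})"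
  shows "D (length c) g y \<in> span (\<pi> ` {q \<in> W'. q < (\<sigma>, map ((!) c) g)})"
proof -
  have *: "D (length c) g (\<pi> q) \<in> span (\<pi> ` {q \<in> W'. q < (\<sigma>, map ((!) c) g)})"
    if q: "q \<in> W" "q < (\<sigma>, c)" for q
  proof -
    obtain \<tau> d where qd: "q = (\<tau>, d)" by fastforce
    with q W have d: "\<tau> \<in> I" "d \<in> lists A" "length d = length c" by (auto simp: words_def)
    have "(\<tau>, map ((!) d) g) < (\<sigma>, map ((!) c) g)"
      using q(2) map_nth_less[OF g(2), of d c] g(1) d qd by (auto simp: less_prod_def')
    moreover have "D (length c) g (\<pi> q) = \<pi> (\<tau>, map ((!) d) g)"
      using D_word[of \<tau> d g] d g qd by simp
    moreover have "(\<tau>, map ((!) d) g) \<in> W'" using W(2) q(1) qd by blast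
    ultimately show ?thesis by (auto intro: span_base)
  qed
  have sub: "\<pi> ` {q \<in> W. q < (\<sigma>, c)} \<subseteq> E (length c)" using W(1) by (auto intro: span_base)
  show ?thesis using D_span[OF g(1) sub _ y] * by blast
qed

definition weight_words :: "('s \<Rightarrow> 'a \<Rightarrow> 'w) \<Rightarrow> 'w list \<Rightarrow> ('s \<times> 'a list) set" where
  "weight_words wt ps = {(\<sigma>, c). \<sigma> \<in> I \<and> c \<in> lists A \<and> map (wt \<sigma>) c = ps}"

lemma weight_words_subset: "weight_words wt ps \<subseteq> words (length ps)"
  by (auto simp: weight_words_def words_def)

text \<open>\<open>N \<sigma>\<close> collects the words that are reducible within their own weight.
  It is an upset for \<open>emb {}\<close>, hence generated by finitely many words
  \<open>R \<sigma>\<close>, and the other words of a weight index a basis of its span.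
  \<open>R\<close> is chosen before \<open>ps\<close>: the same forbidden words serve all
  weights.\<close>

theorem dim_weight_words:
  "\<exists>R. \<forall>ps. dim (span (\<pi> ` weight_words wt ps)) =
     (\<Sum>\<sigma>\<in>I. card {c \<in> lists A. map (wt \<sigma>) c = ps \<and> avoids ({}, R \<sigma>) c})"
proof -
  define N where "N \<sigma> = {c \<in> lists A. \<pi> (\<sigma>, c) \<in> span (\<pi> ` {q \<in> weight_words wt (map (wt \<sigma>) c). q < (\<sigma>, c)})}" for \<sigma>
  have up: "c \<in> N \<sigma>" if u: "u \<in> N \<sigma>" and c: "c \<in> lists A" "emb {} u c" and \<sigma>: "\<sigma> \<in> I" for u c \<sigma>
  proof -
    obtain g where g: "set g = {..<length u}" "restricted_growth g" "map ((!) u) g = c"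
      using emb_imp_surjection[OF c(2)] .
    let ?W = "weight_words wt (map (wt \<sigma>) u)" and ?W' = "weight_words wt (map (wt \<sigma>) c)"
    have u': "u \<in> lists A" "\<pi> (\<sigma>, u) \<in> span (\<pi> ` {q \<in> ?W. q < (\<sigma>, u)})"
      using u by (auto simp: N_def)
    \<comment> \<open>The weight of the composed word is the old weight composed with
      \<open>g\<close>, so words sharing a weight still share one.\<close>
    have "(\<tau>, map ((!) d) g) \<in> ?W'" if "(\<tau>, d) \<in> ?W" for \<tau> d
    proof -
      have d: "\<tau> \<in> I" "d \<in> lists A" and m: "map (wt \<tau>) d = map (wt \<sigma>) u"
        using that by (auto simp: weight_words_def)
      then have len: "length d = length u" by (metis length_map)
      have "map (wt \<tau>) (map ((!) d) g) = map (\<lambda>i. map (wt \<tau>) d ! i) g"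
        using g(1) len by auto
      also have "\<dots> = map (wt \<sigma>) c" unfolding m g(3)[symmetric] using g(1) by auto
      finally show ?thesis using d map_nth_lists[of d g] g(1) len by (auto simp: weight_words_def)
    qed
    then have "D (length u) g (\<pi> (\<sigma>, u)) \<in> span (\<pi> ` {q \<in> ?W'. q < (\<sigma>, map ((!) u) g)})"
      using weight_words_subset[of wt "map (wt \<sigma>) u"] u'(2) by (intro D_lower[OF g(1,2)]) auto
    then show ?thesis using D_word[OF \<sigma> u'(1) g(1)] g(3) c(1) by (simp add: N_def)
  qed
  have "\<exists>r. set r \<subseteq> N \<sigma> \<and> (\<forall>c\<in>N \<sigma>. \<exists>u\<in>set r. emb {} u c)" for \<sigma>
  proof -
    have "N \<sigma> \<subseteq> lists A" by (auto simp: N_def)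
    from almost_full_finite_basis[OF almost_full_emb[OF fin_A, of "{}"] this]
    show ?thesis by (metis empty_subsetI finite_list)
  qed
  then obtain R where R: "\<And>\<sigma>. set (R \<sigma>) \<subseteq> N \<sigma>" "\<And>\<sigma> c. c \<in> N \<sigma> \<Longrightarrow> \<exists>u\<in>set (R \<sigma>). emb {} u c"
    by metis
  have av: "avoids ({}, R \<sigma>) c \<longleftrightarrow> c \<notin> N \<sigma>" if "\<sigma> \<in> I" "c \<in> lists A" for \<sigma> c
  proof -
    have "c \<in> N \<sigma>" if "u \<in> set (R \<sigma>)" "emb {} u c" for u
      using up[of u \<sigma> c] R(1)[of \<sigma>] that \<open>\<sigma> \<in> I\<close> \<open>c \<in> lists A\<close> by blast
    then show ?thesis using R(2)[of c \<sigma>] by (auto simp: avoids_def)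
  qed
  show ?thesis
  proof (intro exI allI)
    fix ps
    have fin: "finite (weight_words wt ps)"
      using weight_words_subset finite_words finite_subset by blast
    let ?C = "\<lambda>\<sigma>. {c \<in> lists A. map (wt \<sigma>) c = ps \<and> avoids ({}, R \<sigma>) c}"
    have "{p \<in> weight_words wt ps. \<pi> p \<notin> span (\<pi> ` {q \<in> weight_words wt ps. q < p})} = (SIGMA \<sigma>:I. ?C \<sigma>)"
      using av by (auto simp: weight_words_def N_def)
    moreover have "finite (?C \<sigma>)" for \<sigma>
    proof -
      have "?C \<sigma> \<subseteq> {c. set c \<subseteq> A \<and> length c = length ps}" by auto
      then show ?thesis using finite_lists_length_eq[OF fin_A] finite_subset by blast
    qed
    ultimately show "dim (span (\<pi> ` weight_words wt ps)) = (\<Sum>\<sigma>\<in>I. card (?C \<sigma>))"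
      using dim_span_image_linorder[OF fin, of \<pi>] fin_I by (simp add: card_SigmaI)
  qed
qed

text \<open>A Groebner basis argument: \<open>T\<close> holds one element for each word of a finite
  basis of the leading words, and division by these elements terminates because there are finitely
  many words of each length.\<close>

theorem finite_generation:
  assumes sub: "\<And>n. subspace (U n)" and UE: "\<And>n. U n \<subseteq> E n"
    and UD: "\<And>n g. set g = {..<n} \<Longrightarrow> D n g ` U n \<subseteq> U (length g)"
  shows "\<exists>T. finite T \<and> (\<forall>(n, u)\<in>T. u \<in> U n) \<and>
    (\<forall>U'. (\<forall>n. subspace (U' n)) \<and> (\<forall>n g. set g = {..<n} \<longrightarrow> D n g ` U' n \<subseteq> U' (length g)) \<and>
       (\<forall>(n, u)\<in>T. u \<in> U' n) \<longrightarrow> (\<forall>n. U n \<subseteq> U' n))"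
proof -
  \<comment> \<open>The leading coefficient is normalised to 1. The images of words under
    \<open>\<pi>\<close> may be dependent, so one element may lead with several words.\<close>
  define leads where "leads \<sigma> c u \<longleftrightarrow> u \<in> U (length c) \<and>
    u - \<pi> (\<sigma>, c) \<in> span (\<pi> ` {q \<in> words (length c). q < (\<sigma>, c)})" for \<sigma> c u
  define Lead where "Lead \<sigma> = {c \<in> lists A. \<exists>u. leads \<sigma> c u}" for \<sigma>
  have "\<exists>B. finite B \<and> B \<subseteq> Lead \<sigma> \<and> (\<forall>c\<in>Lead \<sigma>. \<exists>d\<in>B. emb {} d c)" for \<sigma>
    by (rule almost_full_finite_basis[OF almost_full_emb[OF fin_A, of "{}"]]) (auto simp: Lead_def)
  then obtain B where B: "\<And>\<sigma>. finite (B \<sigma>)" "\<And>\<sigma>. B \<sigma> \<subseteq> Lead \<sigma>"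
    "\<And>\<sigma> c. c \<in> Lead \<sigma> \<Longrightarrow> \<exists>d\<in>B \<sigma>. emb {} d c" by metis
  define u where "u \<sigma> c = (SOME u. leads \<sigma> c u)" for \<sigma> c
  have u: "leads \<sigma> c (u \<sigma> c)" if "c \<in> Lead \<sigma>" for \<sigma> c
    using that unfolding u_def Lead_def by (auto intro: someI_ex)
  define T where "T = (\<lambda>(\<sigma>, c). (length c, u \<sigma> c)) ` (SIGMA \<sigma>:I. B \<sigma>)"
  have T: "finite T" "\<forall>(n, x)\<in>T. x \<in> U n"
    unfolding T_def using fin_I B(1) u B(2) by (auto simp: leads_def, meson leads_def subsetD)
  have gen: "U n \<subseteq> U' n"
    if U': "\<And>n. subspace (U' n)" "\<And>n g. set g = {..<n} \<Longrightarrow> D n g ` U' n \<subseteq> U' (length g)"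
      "\<And>n x. (n, x) \<in> T \<Longrightarrow> x \<in> U' n" for U' n
  proof -
    \<comment> \<open>\<open>X\<close> runs through initial segments of the words of length
      \<open>n\<close>; the contribution of its largest element is cleared with the image of a
      chosen generator.\<close>
    have main: "X \<subseteq> words n \<Longrightarrow> (\<And>p q. p \<in> X \<Longrightarrow> q \<in> words n \<Longrightarrow> q < p \<Longrightarrow> q \<in> X) \<Longrightarrow> U n \<inter> span (\<pi> ` X) \<subseteq> U' n"
      if "finite X" for X
      using that
    proof (induction X rule: finite_linorder_max_induct)
      case empty
      then show ?case using subspace_0[OF U'(1)] by auto
    next
      case (insert b X)
      have X: "X = {q \<in> words n. q < b}"
      proof (intro equalityI subsetI)
        show "q \<in> {q \<in> words n. q < b}" if "q \<in> X" for q
          using that insert.hyps insert.prems(1) by auto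
        show "q \<in> X" if "q \<in> {q \<in> words n. q < b}" for q
          using that insert.prems(2)[of b q] by auto
      qed
      have IH: "U n \<inter> span (\<pi> ` X) \<subseteq> U' n"
      proof (rule insert.IH)
        show "X \<subseteq> words n" using X by blast
        show "q \<in> X" if "p \<in> X" "q \<in> words n" "q < p" for p q
          using that unfolding X by (auto intro: less_trans)
      qed
      show ?case
      proof
        fix x assume "x \<in> U n \<inter> span (\<pi> ` insert b X)"
        then obtain k where xU: "x \<in> U n" and k: "x - scale k (\<pi> b) \<in> span (\<pi> ` X)"
          by (auto simp: span_breakdown_eq)
        show "x \<in> U' n"
        proof (cases "k = 0")
          case True
          then show ?thesis using k xU IH by auto
        next
          case False
          obtain \<sigma> c where b: "b = (\<sigma>, c)" by fastforce
          then have c: "\<sigma> \<in> I" "c \<in> lists A" "length c = n"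
            using insert.prems by (auto simp: words_def)
          have "scale (1 / k) (x - scale k (\<pi> b)) \<in> span (\<pi> ` X)" using k by (rule span_scale)
          then have "leads \<sigma> c (scale (1 / k) x)"
            using False sub xU c X b by (simp add: leads_def subspace_scale scale_right_diff_distrib)
          then have "c \<in> Lead \<sigma>" using c by (auto simp: Lead_def)
          then obtain d where d: "d \<in> B \<sigma>" "emb {} d c" using B(3) by blast
          obtain g where g: "set g = {..<length d}" "restricted_growth g" "map ((!) d) g = c"
            using emb_imp_surjection[OF d(2)] .
          then have lg: "length g = n" using c by auto
          have dL: "d \<in> Lead \<sigma>" using B(2) d(1) by blast
          then have dA: "d \<in> lists A" by (simp add: Lead_def)
          have ud: "leads \<sigma> d (u \<sigma> d)" by (rule u[OF dL])
          let ?v = "D (length d) g (u \<sigma> d)"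
          have "(length d, u \<sigma> d) \<in> T" using d(1) c(1) by (force simp: T_def)
          then have vU': "?v \<in> U' n" using U'(2)[OF g(1)] U'(3) lg by blast
          have uU: "u \<sigma> d \<in> U (length d)" using ud by (simp add: leads_def)
          then have vU: "?v \<in> U n" using UD[OF g(1)] lg by blast
          have "D (length d) g (u \<sigma> d - \<pi> (\<sigma>, d)) \<in> span (\<pi> ` {q \<in> words n. q < (\<sigma>, map ((!) d) g)})"
          proof (rule D_lower[OF g(1,2)])
            show "(\<tau>, map ((!) e) g) \<in> words n" if "(\<tau>, e) \<in> words (length d)" for \<tau> e
              using that map_nth_lists[of e g] g(1) lg by (simp add: words_def)
            show "u \<sigma> d - \<pi> (\<sigma>, d) \<in> span (\<pi> ` {q \<in> words (length d). q < (\<sigma>, d)})"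
              using ud by (simp add: leads_def)
          qed simp
          moreover have "D (length d) g (u \<sigma> d - \<pi> (\<sigma>, d)) = ?v - \<pi> b"
          proof -
            have "\<pi> (\<sigma>, d) \<in> E (length d)" using c dA by (auto intro: span_base simp: words_def)
            moreover have "u \<sigma> d \<in> E (length d)" using uU UE by blast
            ultimately show ?thesis using D_diff[OF g(1)] D_word[OF c(1) dA g(1)] g(3) b by simp
          qed
          ultimately have v: "?v - \<pi> b \<in> span (\<pi> ` X)" using X b g(3) by simp
          \<comment> \<open>\<open>x\<close> and \<open>k\<close> times \<open>?v\<close> have the
            same leading part, \<open>k\<close> times \<open>\<pi> b\<close>.\<close>
          have "(x - scale k (\<pi> b)) - scale k (?v - \<pi> b) \<in> span (\<pi> ` X)"
            by (rule span_diff[OF k span_scale[OF v]])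
          then have "x - scale k ?v \<in> span (\<pi> ` X)" by (simp add: scale_right_diff_distrib)
          moreover have "x - scale k ?v \<in> U n"
            by (rule subspace_diff[OF sub xU subspace_scale[OF sub vU]])
          ultimately have "x - scale k ?v \<in> U' n" using IH by blast
          then have "x - scale k ?v + scale k ?v \<in> U' n"
            by (rule subspace_add[OF U'(1) _ subspace_scale[OF U'(1) vU']])
          then show ?thesis by simp
        qed
      qed
    qed
    have "U n \<inter> E n \<subseteq> U' n" by (rule main[OF finite_words]) auto
    then show ?thesis using UE by blast
  qed
  show ?thesis
  proof (intro exI[of _ T] conjI allI impI)
    show "finite T" "\<forall>(n, x)\<in>T. x \<in> U n" by (rule T)+
    fix U' n
    assume "(\<forall>n. subspace (U' n)) \<and> (\<forall>n g. set g = {..<n} \<longrightarrow> D n g ` U' n \<subseteq> U' (length g)) \<and>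
       (\<forall>(n, u)\<in>T. u \<in> U' n)"
    then have 1: "\<And>n. subspace (U' n)" and 2: "\<And>n g. set g = {..<n} \<Longrightarrow> D n g ` U' n \<subseteq> U' (length g)"
      and 3: "\<forall>(n, u)\<in>T. u \<in> U' n" by simp_all
    show "U n \<subseteq> U' n"
    proof (rule gen[OF 1 2])
      show "x \<in> U' m" if "(m, x) \<in> T" for m x using bspec[OF 3 that] by simp
    qed
  qed
qed

end


section \<open>Coefficients of composites of generic morphisms\<close>

text \<open>Listing the variables of a monomial with repetitions lets maps of variables act by
  \<open>map\<close> and products be evaluated by induction on the list.\<close>

definition msum :: "'c list \<Rightarrow> 'c \<Rightarrow>\<^sub>0 nat" where
  "msum cs = (\<Sum>c\<leftarrow>cs. single c 1)"

lemma msum_simps [simp]: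
  "msum [] = 0" "msum (c # cs) = single c 1 + msum cs" "msum (cs @ ds) = msum cs + msum ds"
  by (simp_all add: msum_def)

lemma lookup_msum: "lookup (msum cs) c = count (mset cs) c"
  by (induction cs) (simp_all add: lookup_add lookup_single when_def)

lemma keys_msum [simp]: "keys (msum cs) = set cs"
  by (auto simp: in_keys_iff lookup_msum)

lemma msum_eq_iff: "msum cs = msum ds \<longleftrightarrow> mset cs = mset ds"
  by (metis lookup_msum multiset_eqI poly_mapping_eqI)

lemma msum_exhaust: obtains cs where "\<alpha> = msum cs"
proof -
  have "finite {x. lookup \<alpha> x > 0}"
    using finite_keys[of \<alpha>] by (simp add: keys.rep_eq)
  then have "count (Abs_multiset (lookup \<alpha>)) = lookup \<alpha>"
    by (simp add: Abs_multiset_inverse)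
  moreover obtain cs where "mset cs = Abs_multiset (lookup \<alpha>)" using ex_mset by blast
  ultimately have "\<alpha> = msum cs" by (intro poly_mapping_eqI) (simp add: lookup_msum)
  then show ?thesis using that by blast
qed

lemma msum_map_cong: "msum cs = msum ds \<Longrightarrow> msum (map h cs) = msum (map h ds)"
  by (simp add: msum_eq_iff)

lemma lookup_map_key: "inj h \<Longrightarrow> lookup (Poly_Mapping.map_key h p) c = lookup p (h c)"
  by (simp add: map_key.rep_eq)

lemma map_key_msum:
  fixes cs :: "'a list" and ds :: "'b list"
  shows "Poly_Mapping.map_key Inl (msum (map Inl cs @ map Inr ds)) = msum cs"
  "Poly_Mapping.map_key Inr (msum (map Inl cs @ map Inr ds)) = msum ds"
proof -
  have "count (mset (map Inl cs)) (Inr d :: 'a + 'b) = 0" for d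
    by (induction cs) auto
  moreover have "count (mset (map Inr ds)) (Inl c :: 'a + 'b) = 0" for c
    by (induction ds) auto
  moreover have "count (mset (map Inl cs)) (Inl c :: 'a + 'b) = count (mset cs) c" for c
    by (induction cs) auto
  moreover have "count (mset (map Inr ds)) (Inr d :: 'a + 'b) = count (mset ds) d" for d
    by (induction ds) auto
  ultimately show
    "Poly_Mapping.map_key Inl (msum (map Inl cs @ map Inr ds)) = msum cs"
    "Poly_Mapping.map_key Inr (msum (map Inl cs @ map Inr ds)) = msum ds"
    by (auto intro!: poly_mapping_eqI simp only: lookup_map_key[OF inj_Inl] lookup_map_key[OF inj_Inr] lookup_msum
        mset_append count_union add_0 add_0_right)
qed

lemma msum_Inl_Inr_eq_iff:
  fixes cs cs' :: "'a list" and ds ds' :: "'b list"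
  shows "msum (map Inl cs @ map Inr ds) = msum (map Inl cs' @ map Inr ds') \<longleftrightarrow> msum cs = msum cs' \<and> msum ds = msum ds'"
proof
  assume *: "msum (map Inl cs @ map Inr ds) = msum (map Inl cs' @ map Inr ds')"
  show "msum cs = msum cs' \<and> msum ds = msum ds'"
    using arg_cong[OF *, of "Poly_Mapping.map_key Inl"] arg_cong[OF *, of "Poly_Mapping.map_key Inr"]
    by (simp only: map_key_msum)
next
  assume "msum cs = msum cs' \<and> msum ds = msum ds'"
  then show "msum (map Inl cs @ map Inr ds) = msum (map Inl cs' @ map Inr ds')"
    using msum_map_cong[of cs cs' "Inl :: _ \<Rightarrow> 'a + 'b"] msum_map_cong[of ds ds' "Inr :: _ \<Rightarrow> 'a + 'b"] by simp
qed

lemma monom_eval_mono: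
  assumes "finite S" "keys \<alpha> \<subseteq> S"
  shows "monom_eval \<eta> \<alpha> = (\<Prod>c\<in>S. \<eta> c ^ lookup \<alpha> c)"
  unfolding monom_eval_def by (rule prod.mono_neutral_left) (use assms in \<open>auto simp: in_keys_iff\<close>)

lemma monom_eval_plus: "monom_eval \<eta> (\<alpha> + \<beta>) = monom_eval \<eta> \<alpha> * monom_eval \<eta> \<beta>"
proof -
  let ?S = "keys \<alpha> \<union> keys \<beta>"
  have "keys (\<alpha> + \<beta>) \<subseteq> ?S" by (rule keys_add)
  then show ?thesis
    by (simp add: monom_eval_mono[of ?S] lookup_add power_add prod.distrib)
qed

lemma monom_eval_msum: "monom_eval \<eta> (msum cs) = (\<Prod>c\<leftarrow>cs. \<eta> c)"
  by (induction cs) (simp_all add: monom_eval_plus, simp_all add: monom_eval_def)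

lemma monom_degree_mono:
  assumes "finite S" "keys \<alpha> \<subseteq> S"
  shows "monom_degree \<alpha> = (\<Sum>c\<in>S. lookup \<alpha> c)"
  unfolding monom_degree_def by (rule sum.mono_neutral_left) (use assms in \<open>auto simp: in_keys_iff\<close>)

lemma monom_degree_plus: "monom_degree (\<alpha> + \<beta>) = monom_degree \<alpha> + monom_degree \<beta>"
proof -
  let ?S = "keys \<alpha> \<union> keys \<beta>"
  have "keys (\<alpha> + \<beta>) \<subseteq> ?S" by (rule keys_add)
  then show ?thesis by (simp add: monom_degree_mono[of ?S] lookup_add sum.distrib)
qed

lemma monom_degree_msum: "monom_degree (msum cs) = length cs"
  by (induction cs) (simp_all add: monom_degree_plus, simp_all add: monom_degree_def)

text \<open>Equality modulo the ideal generated by the variables in \<open>Z\<close>.\<close>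

definition poly_cong :: "'c set \<Rightarrow> (('c \<Rightarrow>\<^sub>0 nat) \<Rightarrow>\<^sub>0 'k::comm_ring_1) \<Rightarrow> (('c \<Rightarrow>\<^sub>0 nat) \<Rightarrow>\<^sub>0 'k) \<Rightarrow> bool" where
  "poly_cong Z p q \<longleftrightarrow> (\<forall>m. keys m \<inter> Z = {} \<longrightarrow> lookup p m = lookup q m)"

lemma poly_cong_refl: "poly_cong Z p p"
  by (simp add: poly_cong_def)

lemma keys_add_nat: "keys (a + b :: 'c \<Rightarrow>\<^sub>0 nat) = keys a \<union> keys b"
  by (auto simp: in_keys_iff lookup_add)

text \<open>A divisor of a monomial free of \<open>Z\<close> is free of \<open>Z\<close>, so the
  convolution only sees coefficients on which the factors agree.\<close>

lemma poly_cong_mult: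
  fixes p q :: "('a \<Rightarrow>\<^sub>0 nat) \<Rightarrow>\<^sub>0 'k::comm_ring_1"
  assumes "poly_cong Z p p'" "poly_cong Z q q'"
  shows "poly_cong Z (p * q) (p' * q')"
  unfolding poly_cong_def
proof (intro allI impI)
  fix m :: "'a \<Rightarrow>\<^sub>0 nat"
  assume m: "keys m \<inter> Z = {}"
  have "lookup p l * Sum_any (\<lambda>r. lookup q r when m = l + r) =
    lookup p' l * Sum_any (\<lambda>r. lookup q' r when m = l + r)" for l :: "'a \<Rightarrow>\<^sub>0 nat"
  proof (cases "\<exists>r. m = l + r")
    case True
    then have "keys l \<inter> Z = {}" using m by (auto simp: keys_add_nat)
    then have "lookup p l = lookup p' l" using assms by (simp add: poly_cong_def)
    moreover have "(lookup q r when m = l + r) = (lookup q' r when m = l + r)" for r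
    proof (cases "m = l + r")
      case True
      then have "keys r \<inter> Z = {}" using m by (auto simp: keys_add_nat)
      then show ?thesis using assms by (simp add: poly_cong_def)
    qed simp
    ultimately show ?thesis by simp
  qed simp
  then show "lookup (p * q) m = lookup (p' * q') m"
    by (simp add: times_poly_mapping.rep_eq prod_fun_def)
qed

lemma poly_cong_sum:
  assumes "\<And>i. i \<in> I \<Longrightarrow> poly_cong Z (p i) (q i)"
  shows "poly_cong Z (\<Sum>i\<in>I. p i) (\<Sum>i\<in>I. q i)"
  using assms
  by (induction I rule: infinite_finite_induct) (auto simp: poly_cong_def lookup_add)

lemma poly_cong_prod_list:
  assumes "\<And>e. e \<in> set es \<Longrightarrow> poly_cong Z (p e) (q e)"
  shows "poly_cong Z (\<Prod>e\<leftarrow>es. p e) (\<Prod>e\<leftarrow>es. q e)"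
  using assms by (induction es) (auto simp: poly_cong_refl intro: poly_cong_mult)

lemma poly_cong_bad_monomial:
  "keys m \<inter> Z \<noteq> {} \<Longrightarrow> poly_cong Z (single m r) 0"
  by (auto simp: poly_cong_def lookup_single when_def)

lemma prod_list_single:
  "(\<Prod>e\<leftarrow>es. single (m e) 1) = single (\<Sum>e\<leftarrow>es. m e) (1 :: 'k::comm_ring_1)"
  by (induction es) (simp_all add: mult_single)

section \<open>Generic composites modulo the variables killed by a basis map\<close>

definition fibre_list :: "nat list \<Rightarrow> nat \<Rightarrow> nat list" where
  "fibre_list f i = filter (\<lambda>j. f ! j = i) [0..<length f]"

lemma set_fibre_list [simp]: "set (fibre_list f i) = fibre f i"
  by (auto simp: fibre_list_def fibre_def)

lemma distinct_fibre_list [simp]: "distinct (fibre_list f i)"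
  by (simp add: fibre_list_def)

lemma finite_fibre [simp]: "finite (fibre f i)"
  by (simp add: fibre_def)

lemma finite_tbasis [simp]: "finite (tbasis W (fibre f i))"
  by (simp add: tbasis_def finite_PiE)

text \<open>
  The maps on basis coordinates and weights induced by \<open>e\<^sub>w \<mapsto> e\<^bsub>b j w\<^esub>\<close>, where \<open>b j\<close> is an
  injection of the basis of the \<open>j\<close>-th space into the basis of the tensor product over the
  fibre of \<open>j\<close> under \<open>g\<close>.
\<close>

definition push :: "(nat \<Rightarrow> nat \<Rightarrow> nat \<Rightarrow> nat) \<Rightarrow> nat list \<Rightarrow> nat list \<Rightarrow> coord \<Rightarrow> coord" where
  "push b f g = (\<lambda>(i, w, v). (i, (\<lambda>l\<in>fibre (comp_word f g) i. b (g ! l) (w (g ! l)) l), v))"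

definition weight_list :: "(nat \<Rightarrow> nat \<Rightarrow> nat \<Rightarrow> nat) \<Rightarrow> nat list \<Rightarrow> coord \<Rightarrow> coord list" where
  "weight_list b f = (\<lambda>(i, w, v). map (\<lambda>j. (j, b j (w j), w j)) (fibre_list f i))"

definition basis_injection :: "nat list \<Rightarrow> nat list \<Rightarrow> nat list \<Rightarrow> (nat \<Rightarrow> nat \<Rightarrow> nat \<Rightarrow> nat) \<Rightarrow> bool" where
  "basis_injection W X g b \<longleftrightarrow>
     (\<forall>j<length W. (\<forall>w<W ! j. b j w \<in> tbasis X (fibre g j)) \<and> inj_on (b j) {..<W ! j})"

lemma comp_word_length [simp]: "length (comp_word f g) = length g"
  by (simp add: comp_word_def)

lemma nth_comp_word [simp]: "l < length g \<Longrightarrow> comp_word f g ! l = f ! (g ! l)"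
  by (simp add: comp_word_def)

lemma fibre_comp_word: "l \<in> fibre (comp_word f g) i \<longleftrightarrow> l < length g \<and> f ! (g ! l) = i"
  by (auto simp: fibre_def comp_word_def)

abbreviation generic_comp :: "nat list \<Rightarrow> nat list \<Rightarrow> nat list \<Rightarrow> coord \<Rightarrow> ((coord + coord) \<Rightarrow>\<^sub>0 nat) \<Rightarrow>\<^sub>0 'k::comm_ring_1" where
  "generic_comp W f g \<equiv> comp_mor W f g (indet Inr) (indet Inl)"

abbreviation generic_term :: "nat list \<Rightarrow> nat list \<Rightarrow> nat \<Rightarrow> (nat \<Rightarrow> nat) \<Rightarrow> nat \<Rightarrow> (nat \<Rightarrow> nat) \<Rightarrow> ((coord + coord) \<Rightarrow>\<^sub>0 nat) \<Rightarrow>\<^sub>0 'k::comm_ring_1" where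
  "generic_term f g i x v w \<equiv>
     single (msum (Inl (i, w, v) # map (\<lambda>j. Inr (j, restrict x (fibre g j), w j)) (fibre_list f i))) 1"

abbreviation pushed_term :: "(nat \<Rightarrow> nat \<Rightarrow> nat \<Rightarrow> nat) \<Rightarrow> nat list \<Rightarrow> coord \<Rightarrow> ((coord + coord) \<Rightarrow>\<^sub>0 nat) \<Rightarrow>\<^sub>0 'k::comm_ring_1" where
  "pushed_term b f c \<equiv> single (msum (Inl c # map Inr (weight_list b f c))) 1"

lemma generic_comp_eq:
  "(generic_comp W f g (i, x, v) :: _ \<Rightarrow>\<^sub>0 'k::comm_ring_1) = (\<Sum>w\<in>tbasis W (fibre f i).
     generic_term f g i x v w)"
proof -
  have "(\<Prod>j\<in>fibre f i. indet Inr (j, restrict x (fibre g j), w j)) * indet Inl (i, w, v) =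
    (generic_term f g i x v w
      :: ((coord + coord) \<Rightarrow>\<^sub>0 nat) \<Rightarrow>\<^sub>0 'k::comm_ring_1)" for w
  proof -
    have "(\<Prod>j\<in>fibre f i. indet Inr (j, restrict x (fibre g j), w j)) =
      (\<Prod>j\<leftarrow>fibre_list f i. indet Inr (j, restrict x (fibre g j), w j) :: ((coord + coord) \<Rightarrow>\<^sub>0 nat) \<Rightarrow>\<^sub>0 'k)"
      by (simp add: prod.distinct_set_conv_list flip: set_fibre_list)
    then show ?thesis
      by (simp add: indet_def prod_list_single mult_single msum_def comp_def add.commute)
  qed
  then show ?thesis by (simp only: comp_mor_def prod.case)
qed

text \<open>The variables to set to 0 so that column \<open>w\<close> of the \<open>j\<close>-th
  component of the second factor is supported at row \<open>b j w\<close>.\<close>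

definition bad_vars :: "(nat \<Rightarrow> nat \<Rightarrow> nat \<Rightarrow> nat) \<Rightarrow> (coord + coord) set" where
  "bad_vars b = {Inr (j, y, w) | j y w. y \<noteq> b j w}"

text \<open>The summand of \<open>w\<close> involves the variables
  \<open>(j, restrict x (fibre g j), w j)\<close>. None of them is bad exactly when each restriction
  of \<open>x\<close> is \<open>b j (w j)\<close>, that is, when \<open>x\<close> is glued from
  these.\<close>

lemma generic_comp_term:
  fixes x :: "nat \<Rightarrow> nat"
  assumes f: "surj_word V W f" and g: "surj_word W X g" and b: "basis_injection W X g b"
    and x: "x \<in> tbasis X (fibre (comp_word f g) i)" and w: "w \<in> tbasis W (fibre f i)"
  shows "poly_cong (bad_vars b)
    (generic_term f g i x v w)
    (if push b f g (i, w, v) = (i, x, v)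
     then (pushed_term b f (i, w, v) :: _ \<Rightarrow>\<^sub>0 'k::comm_ring_1) else 0)"
proof -
  have iff: "push b f g (i, w, v) = (i, x, v) \<longleftrightarrow> (\<forall>j\<in>fibre f i. restrict x (fibre g j) = b j (w j))"
  proof
    assume p: "push b f g (i, w, v) = (i, x, v)"
    show "\<forall>j\<in>fibre f i. restrict x (fibre g j) = b j (w j)"
    proof
      fix j assume j: "j \<in> fibre f i"
      then have jl: "j < length W" "w j < W ! j" using f w by (auto simp: fibre_def surj_word_def tbasis_def)
      then have ext: "b j (w j) \<in> tbasis X (fibre g j)" using b by (simp add: basis_injection_def)
      show "restrict x (fibre g j) = b j (w j)"
      proof
        fix l
        show "restrict x (fibre g j) l = b j (w j) l"
        proof (cases "l \<in> fibre g j")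
          case True
          then have "l \<in> fibre (comp_word f g) i" "g ! l = j" using j by (auto simp: fibre_comp_word fibre_def)
          then show ?thesis using p True by (auto simp: push_def dest!: fun_cong[of _ _ l])
        next
          case False
          then show ?thesis using ext by (auto simp: tbasis_def PiE_def extensional_def)
        qed
      qed
    qed
  next
    assume r: "\<forall>j\<in>fibre f i. restrict x (fibre g j) = b j (w j)"
    have "(\<lambda>l\<in>fibre (comp_word f g) i. b (g ! l) (w (g ! l)) l) = x"
    proof
      fix l
      show "(\<lambda>l\<in>fibre (comp_word f g) i. b (g ! l) (w (g ! l)) l) l = x l"
      proof (cases "l \<in> fibre (comp_word f g) i")
        case True
        then have l: "l < length g" "f ! (g ! l) = i" by (auto simp: fibre_comp_word)
        then have "g ! l \<in> set g" by simp
        then have "g ! l < length f" using f g by (auto simp: surj_word_def)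
        then have "g ! l \<in> fibre f i" "l \<in> fibre g (g ! l)" using l by (auto simp: fibre_def)
        then show ?thesis using r True by (metis (no_types, lifting) restrict_apply')
      next
        case False
        then show ?thesis using x by (auto simp: tbasis_def PiE_def extensional_def)
      qed
    qed
    then show "push b f g (i, w, v) = (i, x, v)" by (simp add: push_def)
  qed
  show ?thesis
  proof (cases "push b f g (i, w, v) = (i, x, v)")
    case True
    then have *: "map (\<lambda>j. Inr (j, restrict x (fibre g j), w j)) (fibre_list f i) = map Inr (weight_list b f (i, w, v))"
      using iff by (simp add: weight_list_def)
    show ?thesis unfolding if_P[OF True] * by (rule poly_cong_refl)
  next
    case False
    then obtain j where "j \<in> fibre f i" "restrict x (fibre g j) \<noteq> b j (w j)" using iff by blast
    then have "Inr (j, restrict x (fibre g j), w j) \<in> bad_vars b"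
      "Inr (j, restrict x (fibre g j), w j) \<in> set (Inl (i, w, v) # map (\<lambda>j. Inr (j, restrict x (fibre g j), w j)) (fibre_list f i))"
      by (auto simp: bad_vars_def)
    then show ?thesis using False unfolding keys_msum[symmetric] by (simp only: if_False) (blast intro: poly_cong_bad_monomial)
  qed
qed

text \<open>The pushed index restricts on the fibre of \<open>j\<close> under \<open>g\<close> to
  \<open>b j (w j)\<close>, and \<open>b j\<close> is injective.\<close>

lemma push_inj:
  assumes f: "surj_word V W f" and g: "surj_word W X g" and b: "basis_injection W X g b"
    and w: "w \<in> tbasis W (fibre f i)" "w' \<in> tbasis W (fibre f i)"
    and eq: "push b f g (i, w, v) = push b f g (i, w', v)"
  shows "w = w'"
proof
  fix j
  show "w j = w' j"
  proof (cases "j \<in> fibre f i")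
    case True
    then have j: "j < length W" "w j < W ! j" "w' j < W ! j" using f w by (auto simp: fibre_def surj_word_def tbasis_def)
    then have ext: "b j (w j) \<in> tbasis X (fibre g j)" "b j (w' j) \<in> tbasis X (fibre g j)"
      using b by (simp_all add: basis_injection_def)
    have *: "(\<lambda>l\<in>fibre (comp_word f g) i. b (g ! l) (w (g ! l)) l) = (\<lambda>l\<in>fibre (comp_word f g) i. b (g ! l) (w' (g ! l)) l)"
      using eq by (simp add: push_def)
    have "b j (w j) l = b j (w' j) l" for l
    proof (cases "l \<in> fibre g j")
      case lj: True
      then have "l \<in> fibre (comp_word f g) i" "g ! l = j" using True by (auto simp: fibre_comp_word fibre_def)
      then show ?thesis using fun_cong[OF *, of l] by simp
    next
      case False
      then show ?thesis using ext by (auto simp: tbasis_def PiE_def extensional_def)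
    qed
    then have "b j (w j) = b j (w' j)" by blast
    then show ?thesis using b j by (auto simp: basis_injection_def inj_on_def)
  next
    case False
    then show ?thesis using w by (auto simp: tbasis_def PiE_def extensional_def)
  qed
qed

lemma push_coords:
  assumes f: "surj_word V W f" and g: "surj_word W X g" and b: "basis_injection W X g b"
    and c: "c \<in> coords V W f"
  shows "push b f g c \<in> coords V X (comp_word f g)"
proof -
  obtain i w v where iwv: "c = (i, w, v)" "i < length V" "w \<in> tbasis W (fibre f i)" "v < V ! i"
    using c by (auto simp: coords_def)
  have "b (g ! l) (w (g ! l)) l < X ! l" if l: "l < length g" "f ! (g ! l) = i" for l
  proof -
    have "g ! l \<in> set g" using l by simp
    then have gl: "g ! l < length f" "g ! l < length W" using f g by (auto simp: surj_word_def)
    then have "w (g ! l) < W ! (g ! l)" using iwv(3) l by (auto simp: tbasis_def fibre_def)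
    then have "b (g ! l) (w (g ! l)) \<in> tbasis X (fibre g (g ! l))" using b gl by (simp add: basis_injection_def)
    then show ?thesis using l by (auto simp: tbasis_def fibre_def)
  qed
  then show ?thesis using iwv by (auto simp: push_def coords_def tbasis_def fibre_comp_word)
qed

text \<open>By injectivity of \<open>push\<close>, a single summand of the matrix product
  survives.\<close>

lemma generic_comp_push:
  assumes fgb: "surj_word V W f" "surj_word W X g" "basis_injection W X g b" and c: "c \<in> coords V W f"
  shows "poly_cong (bad_vars b) (generic_comp W f g (push b f g c))
    (pushed_term b f c :: _ \<Rightarrow>\<^sub>0 'k::comm_ring_1)"
proof -
  obtain i w v where iwv: "c = (i, w, v)" "w \<in> tbasis W (fibre f i)" using c by (auto simp: coords_def)
  obtain x where x: "push b f g c = (i, x, v)" using iwv by (simp add: push_def)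
  have "x \<in> tbasis X (fibre (comp_word f g) i)" using push_coords[OF fgb c] x by (simp add: coords_def)
  note t = generic_comp_term[OF fgb this]
  have "poly_cong (bad_vars b) (generic_comp W f g (i, x, v))
    (\<Sum>u\<in>tbasis W (fibre f i). if push b f g (i, u, v) = (i, x, v)
     then (pushed_term b f (i, u, v) :: _ \<Rightarrow>\<^sub>0 'k::comm_ring_1) else 0)"
    unfolding generic_comp_eq by (rule poly_cong_sum) (rule t)
  also have "(\<Sum>u\<in>tbasis W (fibre f i). if push b f g (i, u, v) = (i, x, v)
     then (pushed_term b f (i, u, v) :: _ \<Rightarrow>\<^sub>0 'k::comm_ring_1) else 0)
     = (\<Sum>u\<in>tbasis W (fibre f i). if u = w then (pushed_term b f (i, u, v) :: _ \<Rightarrow>\<^sub>0 'k::comm_ring_1) else 0)"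
  proof (intro sum.cong refl if_cong)
    fix u assume "u \<in> tbasis W (fibre f i)"
    then show "push b f g (i, u, v) = (i, x, v) \<longleftrightarrow> u = w"
      using push_inj[OF fgb, of u i w v] iwv x by auto
  qed
  finally show ?thesis using x iwv by simp
qed

lemma generic_comp_not_push:
  assumes fgb: "surj_word V W f" "surj_word W X g" "basis_injection W X g b"
    and e: "e \<in> coords V X (comp_word f g)" "e \<notin> push b f g ` coords V W f"
  shows "poly_cong (bad_vars b) (generic_comp W f g e) (0 :: _ \<Rightarrow>\<^sub>0 'k::comm_ring_1)"
proof -
  obtain i x v where ixv: "e = (i, x, v)" "x \<in> tbasis X (fibre (comp_word f g) i)" "i < length V" "v < V ! i"
    using e by (auto simp: coords_def)
  note t = generic_comp_term[OF fgb ixv(2)]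
  have *: "push b f g (i, u, v) \<noteq> (i, x, v)" if "u \<in> tbasis W (fibre f i)" for u
    using e(2) ixv that by (force simp: coords_def)
  have "poly_cong (bad_vars b) (generic_term f g i x v u) 0"
    if "u \<in> tbasis W (fibre f i)" for u
    using t[OF that, of v] unfolding if_not_P[OF *[OF that]] .
  then have "poly_cong (bad_vars b) (generic_comp W f g (i, x, v)) (\<Sum>u\<in>tbasis W (fibre f i). 0 :: _ \<Rightarrow>\<^sub>0 'k)"
    unfolding generic_comp_eq by (rule poly_cong_sum)
  then show ?thesis using ixv by simp
qed

text \<open>The monomial in question avoids \<open>bad_vars b\<close>, so its coefficient can be
  computed modulo these variables, where each entry of the composite is a single monomial or
  0.\<close>

lemma generic_comp_coeff:
  assumes fgb: "surj_word V W f" "surj_word W X g" "basis_injection W X g b"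
    and cs: "set cs \<subseteq> coords V W f" and ds: "\<forall>(j, y, w)\<in>set ds. y = b j w"
    and \<gamma>: "keys \<gamma> \<subseteq> coords V X (comp_word f g)"
  shows "lookup (monom_eval (generic_comp W f g) \<gamma>) (msum (map Inl cs @ map Inr ds)) =
    (if \<gamma> = msum (map (push b f g) cs) \<and> msum ds = msum (concat (map (weight_list b f) cs)) then 1 else 0 :: 'k::comm_ring_1)"
proof -
  let ?\<delta> = "msum (map Inl cs @ map Inr ds)"
  have good: "keys ?\<delta> \<inter> bad_vars b = {}"
    using ds by (auto simp: bad_vars_def keys_add_nat)
  have coeff: "lookup (\<Prod>e\<leftarrow>map (push b f g) cs'. generic_comp W f g e :: _ \<Rightarrow>\<^sub>0 'k) ?\<delta> =
      (if msum cs' = msum cs \<and> msum ds = msum (concat (map (weight_list b f) cs')) then 1 else 0)"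
    if cs': "set cs' \<subseteq> coords V W f" for cs'
  proof -
    have "poly_cong (bad_vars b) (\<Prod>c\<leftarrow>cs'. generic_comp W f g (push b f g c) :: _ \<Rightarrow>\<^sub>0 'k)
      (\<Prod>c\<leftarrow>cs'. pushed_term b f c)"
      by (rule poly_cong_prod_list, rule generic_comp_push[OF fgb]) (use cs' in auto)
    moreover have "(\<Sum>c\<leftarrow>cs'. msum (Inl c # map Inr (weight_list b f c))) = msum (map Inl cs' @ map Inr (concat (map (weight_list b f) cs')))"
      by (induction cs') (simp_all add: algebra_simps)
    ultimately have "lookup (\<Prod>e\<leftarrow>map (push b f g) cs'. generic_comp W f g e :: _ \<Rightarrow>\<^sub>0 'k) ?\<delta> =
      (1 when msum (map Inl cs' @ map Inr (concat (map (weight_list b f) cs'))) = ?\<delta>)"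
      using good unfolding prod_list_single poly_cong_def by (simp add: lookup_single comp_def)
    moreover have "msum (map Inl cs' @ map Inr (concat (map (weight_list b f) cs'))) = ?\<delta> \<longleftrightarrow>
      msum cs' = msum cs \<and> msum (concat (map (weight_list b f) cs')) = msum ds"
      by (rule msum_Inl_Inr_eq_iff)
    ultimately show ?thesis by (auto simp: when_def)
  qed
  show ?thesis
  proof (cases "\<gamma> = msum (map (push b f g) cs)")
    case True
    then show ?thesis using coeff[OF cs] by (simp only: monom_eval_msum) simp
  next
    case False
    \<comment> \<open>If all entries of \<open>\<gamma>\<close> are pushed ones they come from some
      \<open>cs'\<close>, which the variables of the first factor determine up to order; any other
      entry is 0 modulo the bad variables.\<close>
    obtain es where es: "\<gamma> = msum es" by (rule msum_exhaust)
    have "lookup (\<Prod>e\<leftarrow>es. generic_comp W f g e :: _ \<Rightarrow>\<^sub>0 'k) ?\<delta> = 0"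
    proof (cases "set es \<subseteq> push b f g ` coords V W f")
      case True
      then have "es \<in> lists (push b f g ` coords V W f)" unfolding in_lists_conv_set by blast
      then have "es \<in> map (push b f g) ` lists (coords V W f)" by (simp only: lists_image)
      then obtain cs' where "es = map (push b f g) cs'" "cs' \<in> lists (coords V W f)" by (rule imageE)
      then have cs': "es = map (push b f g) cs'" "set cs' \<subseteq> coords V W f"
        unfolding in_lists_conv_set by (blast+)
      then have "msum cs' \<noteq> msum cs" using False es msum_map_cong by metis
      then show ?thesis using coeff[OF cs'(2)] cs'(1) by simp
    next
      case False
      then obtain e where e: "e \<in> set es" "e \<notin> push b f g ` coords V W f" by blast
      then have "poly_cong (bad_vars b) (generic_comp W f g e :: _ \<Rightarrow>\<^sub>0 'k) 0"
        using \<gamma> es by (intro generic_comp_not_push[OF fgb]) auto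
      moreover obtain es1 es2 where "es = es1 @ e # es2" using e(1) by (meson split_list)
      ultimately have "poly_cong (bad_vars b) (\<Prod>e\<leftarrow>es. generic_comp W f g e :: _ \<Rightarrow>\<^sub>0 'k)
        ((\<Prod>e\<leftarrow>es1. generic_comp W f g e) * (0 * (\<Prod>e\<leftarrow>es2. generic_comp W f g e)))"
        by (simp only: map_append prod_list.append list.map prod_list.Cons) (intro poly_cong_mult poly_cong_refl)
      then show ?thesis using good by (simp add: poly_cong_def)
    qed
    then show ?thesis using False es by (simp add: monom_eval_msum)
  qed
qed


section \<open>Strict polynomial functoriality on monomials\<close>

definition basis_mor :: "(nat \<Rightarrow> nat \<Rightarrow> nat \<Rightarrow> nat) \<Rightarrow> coord \<Rightarrow> 'r::comm_ring_1" where
  "basis_mor b = (\<lambda>(j, y, w). if y = b j w then 1 else 0)"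

lemma monom_eval_basis_mor:
  "monom_eval (basis_mor b) (msum ds) = (if \<forall>(j, y, w)\<in>set ds. y = b j w then 1 else 0)"
  unfolding monom_eval_msum by (induction ds) (auto simp: basis_mor_def)

lemma length_id_word [simp]: "length (id_word V) = length V"
  by (simp add: id_word_def)

lemma nth_id_word [simp]: "j < length V \<Longrightarrow> id_word V ! j = j"
  by (simp add: id_word_def)

lemma fibre_id_word [simp]: "j < length V \<Longrightarrow> fibre (id_word V) j = {j}"
  by (auto simp: fibre_def)

lemma surj_word_id [simp]: "length W = length V \<Longrightarrow> surj_word V W (id_word V)"
  by (auto simp: surj_word_def id_word_def)

lemma comp_word_id_left [simp]:
  assumes "surj_word V W f"
  shows "comp_word (id_word V) f = f"
  by (rule nth_equalityI) (use assms nth_mem[of _ f] in \<open>auto simp: surj_word_def\<close>)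

lemma comp_word_id_right [simp]: "length W = length f \<Longrightarrow> comp_word f (id_word W) = f"
  by (rule nth_equalityI) auto

lemma surj_word_comp:
  assumes "surj_word V W f" "surj_word W X g"
  shows "surj_word V X (comp_word f g)"
  using assms by (auto simp: surj_word_def comp_word_def image_iff in_set_conv_nth set_eq_iff) (metis in_set_conv_nth lessThan_iff)+

text \<open>For the identity word, these maps induce the standard inclusions.\<close>

definition dup :: "nat list \<Rightarrow> nat \<Rightarrow> nat \<Rightarrow> nat \<Rightarrow> nat" where
  "dup g j w = (\<lambda>l\<in>fibre g j. w)"

text \<open>The index \<open>w\<close> is legal in every factor at least as large, and surjectivity
  of \<open>g\<close> makes the fibres nonempty, whence injectivity.\<close>

lemma basis_injection_dup:
  assumes "surj_word W X g" "\<And>l. l < length X \<Longrightarrow> W ! (g ! l) \<le> X ! l"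
  shows "basis_injection W X g (dup g)"
  unfolding basis_injection_def
proof (intro allI impI conjI)
  fix j w assume "j < length W" "w < W ! j"
  then show "dup g j w \<in> tbasis X (fibre g j)"
    using assms by (fastforce simp: dup_def tbasis_def fibre_def surj_word_def)
next
  fix j assume "j < length W"
  then have "j \<in> set g" using assms(1) by (simp add: surj_word_def)
  then obtain l where l: "l \<in> fibre g j" by (auto simp: fibre_def in_set_conv_nth)
  show "inj_on (dup g j) {..<W ! j}"
    by (rule inj_onI) (use l in \<open>auto simp: dup_def dest: fun_cong[of _ _ l]\<close>)
qed

lemma push_dup:
  "push (dup g) f g (i, w, v) = (i, (\<lambda>l\<in>fibre (comp_word f g) i. w (g ! l)), v)"
  by (auto simp: push_def dup_def fibre_comp_word fibre_def restrict_def fun_eq_iff)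

lemma push_dup_id:
  assumes c: "c \<in> coords V W f" and l: "length f = length W"
  shows "push (dup (id_word W)) f (id_word W) c = c"
proof -
  obtain i w v where iwv: "c = (i, w, v)" "w \<in> tbasis W (fibre f i)" using c by (auto simp: coords_def)
  have "(\<lambda>l\<in>fibre f i. w (id_word W ! l)) = w"
    using iwv(2) l by (auto simp: tbasis_def restrict_def fun_eq_iff PiE_def extensional_def fibre_def)
  then show ?thesis using iwv l by (simp add: push_dup)
qed

text \<open>The torus weight of the coefficient at the monomial \<open>cs\<close>: each entry
  contributes its index in every tensor factor of its fibre.\<close>

definition diag_weight :: "nat list \<Rightarrow> coord list \<Rightarrow> coord \<Rightarrow>\<^sub>0 nat" where
  "diag_weight f cs = msum (concat (map (\<lambda>(i, w, v). map (\<lambda>j. diag_coord j (w j)) (fibre_list f i)) cs))"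

lemma diag_coord_eq: "j < length W \<Longrightarrow> diag_coord j a = (j, dup (id_word W) j a, a)"
  by (simp add: diag_coord_def dup_def)

lemma diag_coord_inject [simp]: "diag_coord j a = diag_coord j' a' \<longleftrightarrow> j = j' \<and> a = a'"
  by (auto simp: diag_coord_def)

lemma weight_list_dup_id:
  assumes l: "length f = length W"
  shows "msum (concat (map (weight_list (dup (id_word W)) f) cs)) = diag_weight f cs"
proof -
  have "weight_list (dup (id_word W)) f (i, w, v) = map (\<lambda>j. diag_coord j (w j)) (fibre_list f i)" for i w v
    using l by (auto simp: weight_list_def fibre_def diag_coord_eq[of _ W])
  then show ?thesis unfolding diag_weight_def
    by (metis (no_types, lifting) case_prod_beta' prod.collapse)
qed

definition diag_coords :: "nat list \<Rightarrow> coord set" where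
  "diag_coords V = {diag_coord j a | j a. j < length V \<and> a < V ! j}"

section \<open>Calculus with the coefficients of a \<Delta>-module\<close>

locale delta_functor = vector_space "scl F"
  for F :: "('k::field, 'm::ab_group_add) vec_delta_functor" +
  assumes delta_module: "delta_module F"
begin

lemma functorial: "is_functor F" and polynomial: "is_polynomial F"
  using delta_module by (auto simp: delta_module_def)

lemma obj_span: "\<exists>B. finite B \<and> obj F V = span B"
  using functorial by (simp add: is_functor_def)

lemma subspace_obj: "subspace (obj F V)"
  using obj_span subspace_span by metis

lemma mor_linear: "surj_word V W f \<Longrightarrow> mor F V W f \<eta> \<in> linear_maps (scl F) (obj F V) (obj F W)"
  using functorial by (simp add: is_functor_def)

lemma pol_linear: "surj_word V W f \<Longrightarrow> pol F V W f \<alpha> \<in> linear_maps (scl F) (obj F V) (obj F W)"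
  using polynomial by (simp add: is_polynomial_def)

lemma mor_simps:
  assumes "surj_word V W f" "x \<in> obj F V"
  shows "mor F V W f \<eta> x \<in> obj F W"
    and "y \<in> obj F V \<Longrightarrow> mor F V W f \<eta> (x + y) = mor F V W f \<eta> x + mor F V W f \<eta> y"
    and "mor F V W f \<eta> (scl F c x) = scl F c (mor F V W f \<eta> x)"
  using mor_linear[OF assms(1), of \<eta>] assms(2) by (auto simp: linear_maps_def)

lemma pol_simps:
  assumes "surj_word V W f" "x \<in> obj F V"
  shows "pol F V W f \<alpha> x \<in> obj F W"
    and "y \<in> obj F V \<Longrightarrow> pol F V W f \<alpha> (x + y) = pol F V W f \<alpha> x + pol F V W f \<alpha> y"
    and "pol F V W f \<alpha> (scl F c x) = scl F c (pol F V W f \<alpha> x)"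
  using pol_linear[OF assms(1), of \<alpha>] assms(2) by (auto simp: linear_maps_def)

lemma zero_obj: "0 \<in> obj F V"
  using subspace_obj by (rule subspace_0)

lemma mor_0: "surj_word V W f \<Longrightarrow> mor F V W f \<eta> 0 = 0"
  using mor_simps(3)[OF _ zero_obj, of V W f \<eta> 0] by simp

lemma pol_0: "surj_word V W f \<Longrightarrow> pol F V W f \<alpha> 0 = 0"
  using pol_simps(3)[OF _ zero_obj, of V W f \<alpha> 0] by simp

lemma mor_cong:
  assumes "surj_word V W f" "\<And>c. c \<in> coords V W f \<Longrightarrow> \<eta> c = \<eta>' c" "x \<in> obj F V"
  shows "mor F V W f \<eta> x = mor F V W f \<eta>' x"
proof -
  have "\<forall>V W f \<eta> \<eta>'. surj_word V W f \<and> (\<forall>c\<in>coords V W f. \<eta> c = \<eta>' c) \<longrightarrow>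
      (\<forall>x\<in>obj F V. mor F V W f \<eta> x = mor F V W f \<eta>' x)"
    using functorial unfolding is_functor_def by (elim conjE)
  then show ?thesis using assms by simp
qed

lemma mor_id: "x \<in> obj F V \<Longrightarrow> mor F V V (id_word V) std_mor x = x"
  using functorial by (simp add: is_functor_def)

lemma mor_comp:
  "surj_word V W f \<Longrightarrow> surj_word W X g \<Longrightarrow> x \<in> obj F V \<Longrightarrow>
     mor F V X (comp_word f g) (comp_mor W f g \<zeta> \<eta>) x = mor F W X g \<zeta> (mor F V W f \<eta> x)"
  using functorial by (simp add: is_functor_def)

lemma finite_pol_support: "surj_word V W f \<Longrightarrow> finite (pol_support F V W f)"
  using polynomial by (simp add: is_polynomial_def)

lemma pol_support_keys: "surj_word V W f \<Longrightarrow> \<alpha> \<in> pol_support F V W f \<Longrightarrow> keys \<alpha> \<subseteq> coords V W f"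
  using polynomial by (simp add: is_polynomial_def)

lemma pol_support_0: "x \<in> obj F V \<Longrightarrow> \<alpha> \<notin> pol_support F V W f \<Longrightarrow> pol F V W f \<alpha> x = 0"
  by (auto simp: pol_support_def)

lemma mor_pol:
  "surj_word V W f \<Longrightarrow> x \<in> obj F V \<Longrightarrow>
    mor F V W f \<eta> x = (\<Sum>\<alpha>\<in>pol_support F V W f. scl F (monom_eval \<eta> \<alpha>) (pol F V W f \<alpha> x))"
  using polynomial by (simp add: is_polynomial_def)

lemma pol_comp:
  "surj_word V W f \<Longrightarrow> surj_word W X g \<Longrightarrow> x \<in> obj F V \<Longrightarrow>
    (\<Sum>\<gamma>\<in>pol_support F V X (comp_word f g).
       scl F (lookup (monom_eval (generic_comp W f g) \<gamma>) \<delta>) (pol F V X (comp_word f g) \<gamma> x))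
    = pol F W X g (Poly_Mapping.map_key Inr \<delta>) (pol F V W f (Poly_Mapping.map_key Inl \<delta>) x)"
  using polynomial by (simp add: is_polynomial_def)

lemma pol_degree_id:
  "\<exists>D. \<forall>V W \<alpha> x. length V = n \<and> length W = n \<and> x \<in> obj F V \<and> pol F V W (id_word V) \<alpha> x \<noteq> 0 \<longrightarrow> monom_degree \<alpha> \<le> D"
proof -
  have "\<forall>n. \<exists>D. \<forall>V W. length V = n \<and> length W = n \<longrightarrow> (\<forall>\<alpha>\<in>pol_support F V W (id_word V). monom_degree \<alpha> \<le> D)"
    using polynomial unfolding is_polynomial_def by (elim conjE)
  then obtain D where "\<forall>V W. length V = n \<and> length W = n \<longrightarrow> (\<forall>\<alpha>\<in>pol_support F V W (id_word V). monom_degree \<alpha> \<le> D)"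
    by blast
  then show ?thesis by (intro exI[of _ D]) (auto simp: pol_support_def)
qed

text \<open>In the polynomial identity for composites, compare coefficients at a monomial whose
  second part involves only entries of the form \<open>(j, b j w, w)\<close>: at most one term of
  the sum survives.\<close>

theorem pol_pol:
  assumes fgb: "surj_word V W f" "surj_word W X g" "basis_injection W X g b"
    and cs: "set cs \<subseteq> coords V W f" and ds: "\<forall>(j, y, w)\<in>set ds. y = b j w" and x: "x \<in> obj F V"
  shows "pol F W X g (msum ds) (pol F V W f (msum cs) x) =
    (if msum ds = msum (concat (map (weight_list b f) cs))
     then pol F V X (comp_word f g) (msum (map (push b f g) cs)) x else 0)"
proof -
  let ?fg = "comp_word f g" and ?\<gamma> = "msum (map (push b f g) cs)"
  let ?w = "msum ds = msum (concat (map (weight_list b f) cs))"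
  have fg: "surj_word V X ?fg" using fgb surj_word_comp by blast
  have "pol F W X g (msum ds) (pol F V W f (msum cs) x) =
    (\<Sum>\<gamma>\<in>pol_support F V X ?fg. scl F (lookup (monom_eval (generic_comp W f g) \<gamma>)
       (msum (map Inl cs @ map Inr ds))) (pol F V X ?fg \<gamma> x))"
    using pol_comp[OF fgb(1,2) x, of "msum (map Inl cs @ map Inr ds)"] by (simp only: map_key_msum)
  also have "\<dots> = (\<Sum>\<gamma>\<in>pol_support F V X ?fg. scl F (if \<gamma> = ?\<gamma> \<and> ?w then 1 else 0) (pol F V X ?fg \<gamma> x))"
    by (intro sum.cong refl) (simp only: generic_comp_coeff[OF fgb cs ds pol_support_keys[OF fg]])
  also have "\<dots> = (\<Sum>\<gamma>\<in>pol_support F V X ?fg. if \<gamma> = ?\<gamma> then (if ?w then pol F V X ?fg ?\<gamma> x else 0) else 0)"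
    by (intro sum.cong) auto
  also have "\<dots> = (if ?\<gamma> \<in> pol_support F V X ?fg then (if ?w then pol F V X ?fg ?\<gamma> x else 0) else 0)"
    by (simp add: finite_pol_support[OF fg])
  also have "\<dots> = (if ?w then pol F V X ?fg ?\<gamma> x else 0)"
    using pol_support_0[OF x] by auto
  finally show ?thesis .
qed

text \<open>Sum \<open>pol_pol\<close> over the monomials in the entries of the second factor: those
  with a bad entry evaluate to 0 at \<open>basis_mor b\<close>, and among the others only the weight
  list of \<open>cs\<close> contributes.\<close>

lemma mor_basis_pol:
  assumes fgb: "surj_word V W f" "surj_word W X g" "basis_injection W X g b"
    and cs: "set cs \<subseteq> coords V W f" and x: "x \<in> obj F V"
  shows "mor F W X g (basis_mor b) (pol F V W f (msum cs) x) =
    pol F V X (comp_word f g) (msum (map (push b f g) cs)) x"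
proof -
  let ?y = "pol F V W f (msum cs) x" and ?z = "pol F V X (comp_word f g) (msum (map (push b f g) cs)) x"
  define ds0 where "ds0 = concat (map (weight_list b f) cs)"
  have ds0: "\<forall>(j, y, w)\<in>set ds0. y = b j w" by (auto simp: ds0_def weight_list_def)
  have y: "?y \<in> obj F W" using pol_simps(1)[OF fgb(1) x] .
  have "scl F (monom_eval (basis_mor b) \<beta>) (pol F W X g \<beta> ?y) = (if \<beta> = msum ds0 then ?z else 0)" for \<beta>
  proof -
    obtain ds where ds: "\<beta> = msum ds" by (rule msum_exhaust)
    show ?thesis
    proof (cases "\<forall>(j, y, w)\<in>set ds. y = b j w")
      case True
      then show ?thesis using pol_pol[OF fgb cs True x] ds by (simp add: monom_eval_basis_mor ds0_def)
    next
      case False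
      then have "set ds \<noteq> set ds0" using ds0 by auto
      then have "\<beta> \<noteq> msum ds0" using ds by (metis keys_msum)
      then show ?thesis unfolding ds monom_eval_basis_mor if_not_P[OF False] by simp
    qed
  qed
  then have "mor F W X g (basis_mor b) ?y = (\<Sum>\<beta>\<in>pol_support F W X g. if \<beta> = msum ds0 then ?z else 0)"
    using mor_pol[OF fgb(2) y] by simp
  also have "\<dots> = (if msum ds0 \<in> pol_support F W X g then ?z else 0)"
    by (simp add: finite_pol_support[OF fgb(2)])
  also have "\<dots> = ?z"
    using pol_support_0[OF y, of "msum ds0" X g] pol_pol[OF fgb cs ds0 x] by (auto simp: ds0_def)
  finally show ?thesis .
qed

text \<open>The case of \<open>pol_pol\<close> with diagonal second factor: the torus acts on a
  coefficient through a single monomial.\<close>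

lemma pol_diag_pol:
  assumes f: "surj_word V W f" and cs: "set cs \<subseteq> coords V W f" and x: "x \<in> obj F V"
    and \<beta>: "keys \<beta> \<subseteq> diag_coords W"
  shows "pol F W W (id_word W) \<beta> (pol F V W f (msum cs) x) =
    (if \<beta> = diag_weight f cs then pol F V W f (msum cs) x else 0)"
proof -
  have l: "length f = length W" using f by (simp add: surj_word_def)
  obtain ds where ds: "\<beta> = msum ds" by (rule msum_exhaust)
  have *: "\<forall>(j, y, w)\<in>set ds. y = dup (id_word W) j w"
    using \<beta> ds diag_coord_eq[of _ W] by (fastforce simp: diag_coords_def)
  have b: "basis_injection W W (id_word W) (dup (id_word W))"
    by (rule basis_injection_dup) auto
  have "map (push (dup (id_word W)) f (id_word W)) cs = cs"
    using push_dup_id[OF _ l, of _ V] cs by (intro map_idI) auto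
  then show ?thesis
    using pol_pol[OF f surj_word_id[OF refl] b cs * x] ds weight_list_dup_id[OF l] l by simp
qed

text \<open>A bound is given only over identities. A morphism over \<open>f\<close> is one over the
  identity into the tensor products over the fibres, followed by a bijection of bases, and this does
  not change the degree of a monomial.\<close>

lemma pol_degree_bound:
  "\<exists>D. \<forall>V W f \<alpha> x. length V = n \<and> surj_word V W f \<and> x \<in> obj F V \<and> pol F V W f \<alpha> x \<noteq> 0 \<longrightarrow> monom_degree \<alpha> \<le> D"
proof -
  obtain D where D: "\<And>V W \<alpha> x. length V = n \<Longrightarrow> length W = n \<Longrightarrow> x \<in> obj F V \<Longrightarrow>
      pol F V W (id_word V) \<alpha> x \<noteq> 0 \<Longrightarrow> monom_degree \<alpha> \<le> D"
    using pol_degree_id[of n] by blast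
  have "monom_degree \<alpha> \<le> D" if n: "length V = n" and f: "surj_word V W f" and x: "x \<in> obj F V"
    and nz: "pol F V W f \<alpha> x \<noteq> 0" for V W f \<alpha> x
  proof -
    \<comment> \<open>The dimensions of the tensor products over the fibres. Below,
      \<open>b i\<close> numbers their basis vectors and \<open>q\<close> reads an entry over
      \<open>f\<close> as one over the identity.\<close>
    define W' where "W' = map (\<lambda>i. card (tbasis W (fibre f i))) [0..<length V]"
    have lW': "length W' = length V" by (simp add: W'_def)
    have W'n: "W' ! i = card (tbasis W (fibre f i))" if "i < length V" for i
      using that by (simp add: W'_def)
    have "\<exists>h. bij_betw h {..<card (tbasis W (fibre f i))} (tbasis W (fibre f i))" for i
      using ex_bij_betw_nat_finite[of "tbasis W (fibre f i)"] by (simp add: lessThan_atLeast0)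
    then obtain b where b: "\<And>i. bij_betw (b i) {..<card (tbasis W (fibre f i))} (tbasis W (fibre f i))"
      by metis
    have f': "surj_word W' W f" using f lW' by (simp add: surj_word_def)
    have binj: "basis_injection W' W f b"
      unfolding basis_injection_def
      using b W'n lW' by (auto simp: bij_betw_def)
    obtain cs where cs: "\<alpha> = msum cs" by (rule msum_exhaust)
    have "\<alpha> \<in> pol_support F V W f" using nz x by (auto simp: pol_support_def)
    then have csc: "set cs \<subseteq> coords V W f" using pol_support_keys[OF f, of \<alpha>] cs by simp
    define q where "q = (\<lambda>(i, w, v). (i, (\<lambda>l\<in>{i}. inv_into {..<card (tbasis W (fibre f i))} (b i) w), v) :: coord)"
    have q: "q c \<in> coords V W' (id_word V) \<and> push b (id_word V) f (q c) = c" if "c \<in> set cs" for c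
    proof -
      have "c \<in> coords V W f" using that csc by blast
      then obtain i w v where c: "c = (i, w, v)" "i < length V" "w \<in> tbasis W (fibre f i)" "v < V ! i"
        by (auto simp: coords_def)
      let ?u = "inv_into {..<card (tbasis W (fibre f i))} (b i) w"
      have u: "?u < card (tbasis W (fibre f i))" "b i ?u = w"
        using b[of i] c(3) by (metis bij_betw_inv_into_right bij_betw_imp_surj_on inv_into_into lessThan_iff)+
      have "(\<lambda>l\<in>fibre f i. b (f ! l) ((\<lambda>l\<in>{i}. ?u) (f ! l)) l) = w"
        using u(2) c(3) by (auto simp: fun_eq_iff restrict_def fibre_def tbasis_def PiE_def extensional_def)
      then have "push b (id_word V) f (q c) = c" using c f by (simp add: push_def q_def)
      moreover have "q c \<in> coords V W' (id_word V)"
        using c u W'n lW' by (simp add: q_def coords_def tbasis_def)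
      ultimately show ?thesis by blast
    qed
    then have "map (push b (id_word V) f) (map q cs) = cs" by (simp add: map_idI)
    moreover have "set (map q cs) \<subseteq> coords V W' (id_word V)" using q by auto
    ultimately have "mor F W' W f (basis_mor b) (pol F V W' (id_word V) (msum (map q cs)) x) = pol F V W f \<alpha> x"
      using mor_basis_pol[OF surj_word_id[OF lW'] f' binj _ x, of "map q cs"] cs f by simp
    then have "pol F V W' (id_word V) (msum (map q cs)) x \<noteq> 0"
      using nz mor_0[OF f'] by auto
    then have "monom_degree (msum (map q cs)) \<le> D" using D n lW' x by blast
    then show ?thesis using cs by (simp add: monom_degree_msum)
  qed
  then show ?thesis by blast
qed

end


section \<open>Weights and reduction to cubes\<close>

definition rel_mor :: "(nat \<Rightarrow> nat \<Rightarrow> nat \<Rightarrow> bool) \<Rightarrow> coord \<Rightarrow> 'r::comm_ring_1" where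
  "rel_mor R = (\<lambda>(j, y, v). if R j (y j) v then 1 else 0)"

lemma std_mor_eq: "std_mor = rel_mor (\<lambda>j b v. b = v)"
  by (simp add: std_mor_def rel_mor_def)

lemma tbasis_singleton: "tbasis W {j} = (\<lambda>a. \<lambda>l\<in>{j}. a) ` {..<W ! j}"
proof (intro equalityI subsetI)
  fix w assume w: "w \<in> tbasis W {j}"
  then have "w = (\<lambda>l\<in>{j}. w j)" by (auto simp: tbasis_def PiE_def extensional_def fun_eq_iff)
  then show "w \<in> (\<lambda>a. \<lambda>l\<in>{j}. a) ` {..<W ! j}" using w by (auto simp: tbasis_def)
qed (auto simp: tbasis_def split: if_splits)

text \<open>A product of 0/1 matrices counts intermediate indices; by \<open>uniq\<close> there is
  at most one, so the product is again a 0/1 matrix, that of the composed relation.\<close>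

lemma comp_rel_mor:
  assumes j: "j < length V" "length W = length V" "length X = length V"
    and uniq: "\<And>a a'. a < W ! j \<Longrightarrow> a' < W ! j \<Longrightarrow> R' j (x j) a \<Longrightarrow> R j a v \<Longrightarrow> R' j (x j) a' \<Longrightarrow> R j a' v \<Longrightarrow> a = a'"
  shows "comp_mor W (id_word V) (id_word W) (rel_mor R') (rel_mor R) (j, x, v) =
    (rel_mor (\<lambda>j b v. \<exists>a<W ! j. R' j b a \<and> R j a v) (j, x, v) :: 'r::comm_ring_1)"
proof -
  have inj: "inj_on (\<lambda>a. \<lambda>l\<in>{j}. a) {..<W ! j}"
    by (rule inj_onI) (auto dest: fun_cong[of _ _ j])
  have "comp_mor W (id_word V) (id_word W) (rel_mor R') (rel_mor R) (j, x, v) =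
    (\<Sum>a<W ! j. if R' j (x j) a \<and> R j a v then 1 else (0 :: 'r))"
    using j unfolding comp_mor_def prod.case fibre_id_word[OF j(1)] tbasis_singleton sum.reindex[OF inj]
    by (intro sum.cong refl) (simp add: rel_mor_def)
  also have "\<dots> = (if \<exists>a<W ! j. R' j (x j) a \<and> R j a v then 1 else 0)"
  proof (cases "\<exists>a<W ! j. R' j (x j) a \<and> R j a v")
    case True
    then obtain a where a: "a < W ! j" "R' j (x j) a" "R j a v" by blast
    have "(\<Sum>a<W ! j. if R' j (x j) a \<and> R j a v then 1 else (0 :: 'r)) = (\<Sum>a'<W ! j. if a' = a then 1 else 0)"
    proof (intro sum.cong refl if_cong)
      fix a' assume "a' \<in> {..<W ! j}"
      then show "R' j (x j) a' \<and> R j a' v \<longleftrightarrow> a' = a"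
        using uniq[of a' a] a by auto
    qed
    also have "\<dots> = 1" using a(1) by simp
    finally show ?thesis unfolding if_P[OF True] .
  qed (auto intro!: sum.neutral)
  finally show ?thesis by (simp add: rel_mor_def)
qed

abbreviation diag_mor :: "(nat \<Rightarrow> nat set) \<Rightarrow> coord \<Rightarrow> 'r::comm_ring_1" where
  "diag_mor T \<equiv> rel_mor (\<lambda>j b v. b = v \<and> v \<in> T j)"

abbreviation diag_coords_on :: "nat list \<Rightarrow> (nat \<Rightarrow> nat set) \<Rightarrow> coord set" where
  "diag_coords_on W T \<equiv> {diag_coord j a | j a. j < length W \<and> a < W ! j \<and> a \<in> T j}"

lemma monom_eval_diag:
  assumes "keys \<alpha> \<subseteq> coords W W (id_word W)"
  shows "(monom_eval (diag_mor T) \<alpha> :: 'r::comm_ring_1) =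
    (if keys \<alpha> \<subseteq> diag_coords_on W T then 1 else 0)"
proof -
  obtain cs where cs: "\<alpha> = msum cs" by (rule msum_exhaust)
  have "(diag_mor T c :: 'r) = (if c \<in> diag_coords_on W T then 1 else 0)"
    if c: "c \<in> coords W W (id_word W)" for c
  proof -
    obtain j y v where jyv: "c = (j, y, v)" "j < length W" "y \<in> tbasis W {j}" "v < W ! j"
      using c by (auto simp: coords_def)
    then obtain b where b: "y = (\<lambda>l\<in>{j}. b)" by (auto simp: tbasis_singleton)
    have "c \<in> diag_coords_on W T \<longleftrightarrow> b = v \<and> v \<in> T j"
    proof
      assume "c \<in> diag_coords_on W T"
      then show "b = v \<and> v \<in> T j" using jyv(1) b by (auto simp: diag_coord_def dest: fun_cong[of _ _ j])
    next
      assume "b = v \<and> v \<in> T j"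
      then show "c \<in> diag_coords_on W T"
        using jyv b by (auto simp: diag_coord_def)
    qed
    then show ?thesis using jyv(1) b by (simp add: rel_mor_def)
  qed
  moreover have "set cs \<subseteq> coords W W (id_word W)" using assms cs by simp
  ultimately have "(\<Prod>c\<leftarrow>cs. diag_mor T c :: 'r) =
    (if set cs \<subseteq> diag_coords_on W T then 1 else 0)"
  proof (induction cs)
    case (Cons c cs)
    have "(diag_mor T c :: 'r) = (if c \<in> diag_coords_on W T then 1 else 0)"
      by (rule Cons.prems(1)) (use Cons.prems(2) in auto)
    moreover have "(\<Prod>c\<leftarrow>cs. diag_mor T c :: 'r) =
    (if set cs \<subseteq> diag_coords_on W T then 1 else 0)"
      by (rule Cons.IH[OF Cons.prems(1)]) (use Cons.prems(2) in auto)
    ultimately show ?case by (simp only: list.map prod_list.Cons list.set insert_subset split: if_split) simp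
  qed simp
  then show ?thesis by (simp only: cs monom_eval_msum keys_msum)
qed

context delta_functor
begin

lemma pol_sum_closed:
  assumes "subspace S" "\<And>\<alpha>. pol F V W f \<alpha> x \<in> S" "surj_word V W f" "x \<in> obj F V"
  shows "mor F V W f \<eta> x \<in> S"
  unfolding mor_pol[OF assms(3,4)] using assms(1,2) by (intro subspace_sum subspace_scale)

lemma mor_rel_comp:
  assumes l: "length W = length V" "length X = length V" and x: "x \<in> obj F V"
    and uniq: "\<And>j b v a a'. j < length V \<Longrightarrow> a < W ! j \<Longrightarrow> a' < W ! j \<Longrightarrow> R' j b a \<Longrightarrow> R j a v \<Longrightarrow> R' j b a' \<Longrightarrow> R j a' v \<Longrightarrow> a = a'"
    and R'': "\<And>j b v. j < length V \<Longrightarrow> b < X ! j \<Longrightarrow> v < V ! j \<Longrightarrow> R'' j b v \<longleftrightarrow> (\<exists>a<W ! j. R' j b a \<and> R j a v)"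
  shows "mor F W X (id_word W) (rel_mor R') (mor F V W (id_word V) (rel_mor R) x) =
    mor F V X (id_word V) (rel_mor R'') x"
proof -
  have "mor F W X (id_word W) (rel_mor R') (mor F V W (id_word V) (rel_mor R) x) =
    mor F V X (comp_word (id_word V) (id_word W)) (comp_mor W (id_word V) (id_word W) (rel_mor R') (rel_mor R)) x"
    using l x by (intro mor_comp[symmetric]) auto
  also have "comp_word (id_word V) (id_word W) = id_word V"
    using l by simp
  also have "mor F V X (id_word V) (comp_mor W (id_word V) (id_word W) (rel_mor R') (rel_mor R)) x =
    mor F V X (id_word V) (rel_mor R'') x"
  proof (rule mor_cong)
    show "surj_word V X (id_word V)" using l by simp
    show "x \<in> obj F V" by (rule x)
    fix c assume "c \<in> coords V X (id_word V)"
    then obtain j y v where c: "c = (j, y, v)" "j < length V" "y \<in> tbasis X {j}" "v < V ! j"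
      by (auto simp: coords_def)
    have "y j < X ! j" using c(3) by (auto simp: tbasis_def)
    then show "comp_mor W (id_word V) (id_word W) (rel_mor R') (rel_mor R) c = rel_mor R'' c"
      using comp_rel_mor[OF c(2) l, of R' y R v] uniq[OF c(2)] R''[OF c(2) _ c(4)] c(1)
      by (simp add: rel_mor_def)
  qed
  finally show ?thesis .
qed

end

section \<open>Spanning terms obtained from generators, and weight decomposition\<close>

locale generated_delta_functor = delta_functor F
  for F :: "('k::field, 'm::ab_group_add) vec_delta_functor" +
  fixes gens :: "(nat list \<times> 'm) list" and D :: nat
  assumes gens_obj: "(V, x) \<in> set gens \<Longrightarrow> x \<in> obj F V"
    and gens_generate: "delta_submodule F U \<Longrightarrow> (\<And>V x. (V, x) \<in> set gens \<Longrightarrow> x \<in> U V) \<Longrightarrow> U V = obj F V"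
    and gens_degree: "(V, x) \<in> set gens \<Longrightarrow> surj_word V W f \<Longrightarrow> pol F V W f \<alpha> x \<noteq> 0 \<Longrightarrow> monom_degree \<alpha> \<le> D"
begin

definition weight_terms :: "nat list \<Rightarrow> (coord \<Rightarrow>\<^sub>0 nat) \<Rightarrow> 'm set" where
  "weight_terms W \<beta> = {pol F V W f (msum cs) x | V x f cs. (V, x) \<in> set gens \<and> surj_word V W f \<and>
     set cs \<subseteq> coords V W f \<and> length cs \<le> D \<and> diag_weight f cs = \<beta>}"

definition terms :: "nat list \<Rightarrow> 'm set" where
  "terms W = (\<Union>\<beta>. weight_terms W \<beta>)"

lemma weight_terms_obj: "weight_terms W \<beta> \<subseteq> obj F W"
  unfolding weight_terms_def using gens_obj pol_simps(1) by blast

lemma terms_obj: "terms W \<subseteq> obj F W"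
  unfolding terms_def using weight_terms_obj by blast

lemma pol_gens: "(V, x) \<in> set gens \<Longrightarrow> surj_word V W f \<Longrightarrow> pol F V W f \<alpha> x \<in> span (terms W)"
proof -
  assume g: "(V, x) \<in> set gens" and f: "surj_word V W f"
  show ?thesis
  proof (cases "pol F V W f \<alpha> x = 0")
    case False
    obtain cs where cs: "\<alpha> = msum cs" by (rule msum_exhaust)
    have "\<alpha> \<in> pol_support F V W f" using False gens_obj[OF g] by (auto simp: pol_support_def)
    then have "set cs \<subseteq> coords V W f" using pol_support_keys[OF f, of \<alpha>] cs by simp
    moreover have "length cs \<le> D" using gens_degree[OF g f False] cs by (simp add: monom_degree_msum)
    ultimately have "pol F V W f \<alpha> x \<in> terms W"
      using g f cs unfolding terms_def weight_terms_def by blast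
    then show ?thesis by (rule span_base)
  qed (simp add: span_zero)
qed

lemma linear_maps_span:
  assumes \<phi>: "\<phi> \<in> linear_maps (scl F) (obj F W) (obj F X)" and T: "T \<subseteq> obj F W" and S: "subspace S"
    and base: "\<And>t. t \<in> T \<Longrightarrow> \<phi> t \<in> S" and y: "y \<in> span T"
  shows "\<phi> y \<in> S"
proof -
  have add: "\<phi> (x + y) = \<phi> x + \<phi> y" and scale: "\<phi> (scl F c x) = scl F c (\<phi> x)"
    if "x \<in> obj F W" "y \<in> obj F W" for c x y
    using \<phi> that by (simp_all add: linear_maps_def)
  have "y \<in> obj F W \<and> \<phi> y \<in> S"
    using y
  proof (induction rule: span_induct_alt)
    case base
    show ?case using zero_obj scale[OF zero_obj zero_obj, of 0] subspace_0[OF S] by simp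
  next
    case (step c t y)
    have t: "t \<in> obj F W" using T step by blast
    then have ct: "scl F c t \<in> obj F W" using subspace_obj subspace_scale by blast
    have "\<phi> (scl F c t + y) = scl F c (\<phi> t) + \<phi> y"
      using add[OF ct] scale[OF t t] step by simp
    then show ?case
      using base[OF step(1)] step ct S subspace_obj by (simp add: subspace_add subspace_scale)
  qed
  then show ?thesis by blast
qed

text \<open>The terms span a submodule containing the generators: by the composition identity, a
  coefficient of a coefficient is a combination of coefficients at the same generator, and a
  generator is recovered from its coefficients over the identity.\<close>

lemma obj_eq_span_terms: "obj F W = span (terms W)"
proof -
  let ?G = "\<lambda>W. span (terms W)"
  have GO: "?G W \<subseteq> obj F W" for W using terms_obj subspace_obj by (rule span_minimal)
  have pol: "pol F W X g \<beta> y \<in> ?G X" if g: "surj_word W X g" and y: "y \<in> ?G W" for W X g \<beta> y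
  proof (rule linear_maps_span[OF pol_linear[OF g] terms_obj subspace_span _ y])
    fix t assume "t \<in> terms W"
    then obtain V x f cs where t: "t = pol F V W f (msum cs) x" "(V, x) \<in> set gens" "surj_word V W f"
      unfolding terms_def weight_terms_def by blast
    obtain ds where ds: "\<beta> = msum ds" by (rule msum_exhaust)
    let ?\<delta> = "msum (map Inl cs @ map Inr ds)"
    have fg: "surj_word V X (comp_word f g)" using surj_word_comp t(3) g by blast
    have "pol F W X g \<beta> t = (\<Sum>\<gamma>\<in>pol_support F V X (comp_word f g).
       scl F (lookup (monom_eval (generic_comp W f g) \<gamma>) ?\<delta>) (pol F V X (comp_word f g) \<gamma> x))"
      using pol_comp[OF t(3) g gens_obj[OF t(2)], of ?\<delta>] ds t(1) by (simp only: map_key_msum)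
    also have "\<dots> \<in> ?G X"
      using pol_gens[OF t(2) fg] by (intro span_sum span_scale)
    finally show "pol F W X g \<beta> t \<in> ?G X" .
  qed
  have mor: "mor F W X g \<eta> y \<in> ?G X" if g: "surj_word W X g" and y: "y \<in> ?G W" for W X g \<eta> y
    by (rule pol_sum_closed[OF subspace_span pol[OF g y] g]) (use y GO in blast)
  have "delta_submodule F ?G"
    unfolding delta_submodule_def using GO pol mor subspace_span by blast
  then show ?thesis
  proof (rule gens_generate[symmetric])
    fix V x assume g: "(V, x) \<in> set gens"
    have "mor F V V (id_word V) std_mor x \<in> ?G V"
      by (rule pol_sum_closed[OF subspace_span pol_gens[OF g]]) (use gens_obj[OF g] in auto)
    then show "x \<in> ?G V" using mor_id gens_obj[OF g] by simp
  qed
qed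

lemma pol_weight_term:
  assumes t: "t \<in> weight_terms W \<beta>" and \<beta>': "keys \<beta>' \<subseteq> diag_coords W"
  shows "pol F W W (id_word W) \<beta>' t = (if \<beta>' = \<beta> then t else 0)"
proof -
  obtain V x f cs where "t = pol F V W f (msum cs) x" "(V, x) \<in> set gens" "surj_word V W f"
    "set cs \<subseteq> coords V W f" "diag_weight f cs = \<beta>"
    using t unfolding weight_terms_def by blast
  then show ?thesis using pol_diag_pol[OF _ _ gens_obj \<beta>'] by metis
qed

lemma pol_weight_span:
  assumes x: "x \<in> span (weight_terms W \<beta>)" and \<beta>': "keys \<beta>' \<subseteq> diag_coords W"
  shows "pol F W W (id_word W) \<beta>' x = (if \<beta>' = \<beta> then x else 0)"
proof -
  have id: "surj_word W W (id_word W)" by simp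
  have "x \<in> obj F W \<and> pol F W W (id_word W) \<beta>' x = (if \<beta>' = \<beta> then x else 0)"
    using x
  proof (induction rule: span_induct_alt)
    case base
    show ?case using zero_obj pol_0[OF id] by simp
  next
    case (step c t y)
    have t: "t \<in> obj F W" using step weight_terms_obj by blast
    then have ct: "scl F c t \<in> obj F W" using subspace_obj subspace_scale by blast
    have "pol F W W (id_word W) \<beta>' (scl F c t + y) = scl F c (pol F W W (id_word W) \<beta>' t) + pol F W W (id_word W) \<beta>' y"
      using pol_simps(2)[OF id ct, of y] pol_simps(3)[OF id t] step by simp
    then show ?case
      using pol_weight_term[OF step(1) \<beta>'] step ct subspace_obj by (auto simp: subspace_add)
  qed
  then show ?thesis by blast
qed

text \<open>The coefficient at a diagonal monomial acts as the projection to the corresponding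
  weight space.\<close>

lemma pol_diag_in_weight_span:
  assumes x: "x \<in> span (terms W)" and \<beta>: "keys \<beta> \<subseteq> diag_coords W"
  shows "pol F W W (id_word W) \<beta> x \<in> span (weight_terms W \<beta>)"
proof (rule linear_maps_span[OF pol_linear[OF surj_word_id[OF refl]] terms_obj subspace_span _ x])
  fix t assume "t \<in> terms W"
  then obtain \<beta>' where "t \<in> weight_terms W \<beta>'" by (auto simp: terms_def)
  then show "pol F W W (id_word W) \<beta> t \<in> span (weight_terms W \<beta>)"
    using pol_weight_term[OF _ \<beta>] by (auto simp: span_zero intro: span_base)
qed

lemma diag_subset_coords: "diag_coords_on W T \<subseteq> diag_coords W"
  by (auto simp: diag_coords_def)

text \<open>Projecting to the basis vectors in \<open>T j\<close> acts on a weight vector by 1 or 0,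
  according to whether its weight involves only these indices.\<close>

lemma mor_diag_weight_span:
  assumes x: "x \<in> span (weight_terms W \<beta>)" and \<beta>: "keys \<beta> \<subseteq> diag_coords W"
  shows "mor F W W (id_word W) (diag_mor T) x =
    (if \<forall>j a. diag_coord j a \<in> keys \<beta> \<longrightarrow> a \<in> T j then x else 0)"
proof -
  have id: "surj_word W W (id_word W)" by simp
  have xo: "x \<in> obj F W" using x span_minimal[OF weight_terms_obj subspace_obj] by blast
  let ?T = "diag_coords_on W T"
  let ?\<eta> = "diag_mor T :: coord \<Rightarrow> 'k"
  let ?s = "pol_support F W W (id_word W)"
  let ?r = "if keys \<beta> \<subseteq> ?T then x else 0"
  have "scl F (monom_eval ?\<eta> \<alpha>) (pol F W W (id_word W) \<alpha> x) = (if \<alpha> = \<beta> then ?r else 0)" if "\<alpha> \<in> ?s" for \<alpha>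
  proof -
    have m: "monom_eval ?\<eta> \<alpha> = (if keys \<alpha> \<subseteq> ?T then 1 else 0)"
      by (rule monom_eval_diag[OF pol_support_keys[OF id that]])
    show ?thesis
    proof (cases "keys \<alpha> \<subseteq> ?T")
      case True
      then have k: "keys \<alpha> \<subseteq> diag_coords W" using diag_subset_coords by blast
      show ?thesis unfolding m pol_weight_span[OF x k] using True by (cases "\<alpha> = \<beta>") simp_all
    next
      case False
      then show ?thesis unfolding m by auto
    qed
  qed
  then have "mor F W W (id_word W) ?\<eta> x = (\<Sum>\<alpha>\<in>?s. if \<alpha> = \<beta> then ?r else 0)"
    unfolding mor_pol[OF id xo] by (intro sum.cong refl)
  also have "\<dots> = (if \<beta> \<in> ?s then ?r else 0)" using finite_pol_support[OF id] by simp
  also have "\<dots> = ?r" using pol_support_0[OF xo, of \<beta> W "id_word W"] pol_weight_span[OF x \<beta>] by auto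
  also have "keys \<beta> \<subseteq> ?T \<longleftrightarrow> (\<forall>j a. diag_coord j a \<in> keys \<beta> \<longrightarrow> a \<in> T j)"
  proof
    assume "keys \<beta> \<subseteq> ?T"
    then show "\<forall>j a. diag_coord j a \<in> keys \<beta> \<longrightarrow> a \<in> T j" by auto
  next
    assume *: "\<forall>j a. diag_coord j a \<in> keys \<beta> \<longrightarrow> a \<in> T j"
    show "keys \<beta> \<subseteq> ?T"
    proof
      fix c assume "c \<in> keys \<beta>"
      moreover from this obtain j a where "c = diag_coord j a" "j < length W" "a < W ! j"
        using \<beta> by (auto simp: diag_coords_def)
      ultimately show "c \<in> ?T" using * by blast
    qed
  qed
  finally show ?thesis .
qed

text \<open>Expand the action of the identity on \<open>x\<close> into coefficients: monomials with
  an off-diagonal entry vanish at the identity matrices, and the weight components remain.\<close>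

lemma weight_decomposition:
  assumes x: "x \<in> obj F W" and S: "subspace S"
    and in_S: "\<And>\<beta>. keys \<beta> \<subseteq> diag_coords W \<Longrightarrow> pol F W W (id_word W) \<beta> x \<in> S"
  shows "x \<in> S"
proof -
  have id: "surj_word W W (id_word W)" by simp
  have "scl F (monom_eval std_mor \<alpha>) (pol F W W (id_word W) \<alpha> x) \<in> S" if "\<alpha> \<in> pol_support F W W (id_word W)" for \<alpha>
  proof (cases "keys \<alpha> \<subseteq> diag_coords W")
    case True
    then show ?thesis using in_S S by (simp add: subspace_scale)
  next
    case False
    then have "monom_eval std_mor \<alpha> = (0 :: 'k)"
      using monom_eval_diag[OF pol_support_keys[OF id that], of "\<lambda>_. UNIV"]
      unfolding std_mor_eq by (simp add: diag_coords_def)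
    then show ?thesis using S by (simp add: subspace_0)
  qed
  then have "mor F W W (id_word W) std_mor x \<in> S"
    unfolding mor_pol[OF id x] using S by (intro subspace_sum)
  then show ?thesis using mor_id[OF x] by simp
qed

lemma diag_weight_keys:
  assumes f: "surj_word V W f" and cs: "set cs \<subseteq> coords V W f"
  shows "keys (diag_weight f cs) \<subseteq> diag_coords W"
proof
  fix c assume "c \<in> keys (diag_weight f cs)"
  then obtain i w v j where *: "(i, w, v) \<in> set cs" "j \<in> fibre f i" "c = diag_coord j (w j)"
    by (auto simp: diag_weight_def)
  then have "w \<in> tbasis W (fibre f i)" using cs by (auto simp: coords_def)
  then show "c \<in> diag_coords W" using * f by (auto simp: diag_coords_def tbasis_def fibre_def surj_word_def)
qed

text \<open>Each of the at most \<open>D\<close> entries contributes at most one index to a given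
  tensor factor.\<close>

lemma diag_weight_card:
  assumes "length cs \<le> D"
  shows "finite {a. diag_coord j a \<in> keys (diag_weight f cs)}"
    and "card {a. diag_coord j a \<in> keys (diag_weight f cs)} \<le> D"
proof -
  have sub: "{a. diag_coord j a \<in> keys (diag_weight f cs)} \<subseteq> (\<lambda>(i, w, v). w j) ` set cs"
    by (auto simp: diag_weight_def image_iff) (metis prod.case)
  then show "finite {a. diag_coord j a \<in> keys (diag_weight f cs)}"
    using finite_subset by blast
  have "card {a. diag_coord j a \<in> keys (diag_weight f cs)} \<le> card ((\<lambda>(i, w, v). w j) ` set cs)"
    using sub by (intro card_mono) auto
  also have "\<dots> \<le> length cs" by (meson card_image_le card_length finite_set le_trans)
  finally show "card {a. diag_coord j a \<in> keys (diag_weight f cs)} \<le> D" using assms by simp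
qed

text \<open>A weight vector uses at most \<open>D\<close> basis vectors in each factor. Renaming
  them into \<open>{..<N}\<close> carries it to a cube and back unchanged, so membership can be
  tested on the cube.\<close>

lemma submodule_le_if_replicate:
  assumes U: "\<And>V. U V \<subseteq> obj F V"
      "\<And>V W f \<eta>. surj_word V W f \<Longrightarrow> mor F V W f \<eta> ` U V \<subseteq> U W"
      "\<And>V W f \<alpha>. surj_word V W f \<Longrightarrow> pol F V W f \<alpha> ` U V \<subseteq> U W"
    and U': "\<And>V. subspace (U' V)" "\<And>V W f \<eta>. surj_word V W f \<Longrightarrow> mor F V W f \<eta> ` U' V \<subseteq> U' W"
    and N: "D \<le> N" and le: "\<And>n. U (replicate n N) \<subseteq> U' (replicate n N)"
  shows "U V \<subseteq> U' V"
proof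
  fix x assume x: "x \<in> U V"
  show "x \<in> U' V"
  proof (rule weight_decomposition[OF subsetD[OF U(1) x] U'(1)])
    fix \<beta> :: "coord \<Rightarrow>\<^sub>0 nat"
    assume \<beta>: "keys \<beta> \<subseteq> diag_coords V"
    let ?y = "pol F V V (id_word V) \<beta> x"
    have y: "?y \<in> U V" using U(3)[of V V "id_word V"] x by auto
    have "x \<in> span (terms V)" using x U(1) obj_eq_span_terms by blast
    then have yw: "?y \<in> span (weight_terms V \<beta>)" by (rule pol_diag_in_weight_span[OF _ \<beta>])
    show "?y \<in> U' V"
    proof (cases "weight_terms V \<beta> = {}")
      case True
      then have "?y = 0" using yw by simp
      then show ?thesis using subspace_0[OF U'(1)] by simp
    next
      case False
      then obtain f cs where fcs: "length cs \<le> D" "\<beta> = diag_weight f cs"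
        unfolding weight_terms_def by blast
      define T where "T j = {a. diag_coord j a \<in> keys \<beta>}" for j
      have T: "finite (T j)" "card (T j) \<le> N" for j
        using diag_weight_card[OF fcs(1), of j f] N unfolding T_def fcs(2) by auto
      have "\<exists>r. inj_on r (T j) \<and> r ` T j \<subseteq> {..<N}" for j
        using T[of j] by (metis card_le_inj card_lessThan finite_lessThan)
      then obtain r where r: "\<And>j. inj_on (r j) (T j)" "\<And>j. r j ` T j \<subseteq> {..<N}" by metis
      let ?W = "replicate (length V) N"
      \<comment> \<open>\<open>?p\<close> renames the indices in use and kills the others,
        \<open>?i\<close> goes back; their composite is \<open>diag_mor T\<close>, which fixes
        \<open>?y\<close>.\<close>
      let ?p = "rel_mor (\<lambda>j b v. v \<in> T j \<and> b = r j v) :: coord \<Rightarrow> 'k"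
      let ?i = "rel_mor (\<lambda>j b v. b \<in> T j \<and> v = r j b) :: coord \<Rightarrow> 'k"
      let ?z = "mor F V ?W (id_word V) ?p ?y"
      have "?z \<in> U ?W" using U(2)[of V ?W "id_word V" ?p] y by auto
      then have "?z \<in> U' ?W" using le by blast
      then have "mor F ?W V (id_word ?W) ?i ?z \<in> U' V"
        using U'(2)[of ?W V "id_word ?W" ?i] by auto
      moreover have "mor F ?W V (id_word ?W) ?i ?z = mor F V V (id_word V) (diag_mor T) ?y"
      proof (rule mor_rel_comp)
        show "?y \<in> obj F V" using y U(1) by blast
        fix j b v
        assume "j < length V"
        then show "(b = v \<and> v \<in> T j) \<longleftrightarrow> (\<exists>a<?W ! j. (b \<in> T j \<and> a = r j b) \<and> v \<in> T j \<and> a = r j v)"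
          using r(1)[of j] r(2)[of j] by (auto simp: inj_on_def)
      qed auto
      moreover have "mor F V V (id_word V) (diag_mor T) ?y = ?y"
        using mor_diag_weight_span[OF yw \<beta>, of T] by (simp add: T_def)
      ultimately show ?thesis by simp
    qed
  qed
qed

end


section \<open>Encoding monomials by words\<close>

text \<open>
  A monomial in the entries of a morphism from \<open>V\<close> to \<open>(k\<^sup>N, \<dots>, k\<^sup>N)\<close> over \<open>f\<close> is a list of entries
  \<open>(i\<^sub>t, w\<^sub>t, v\<^sub>t)\<close>. For fixed \<open>\<tau> = [(i\<^sub>0, v\<^sub>0), \<dots>]\<close>, the pair of \<open>f\<close> and the monomial is encoded by a
  word whose \<open>j\<close>-th letter consists of \<open>f j\<close> and the values \<open>w\<^sub>t j\<close> for those \<open>t\<close> with \<open>f j = i\<^sub>t\<close>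
  (the other entries of the letter are irrelevant).
\<close>

definition word_coords :: "(nat \<times> nat) list \<Rightarrow> (nat \<times> nat list) list \<Rightarrow> coord list" where
  "word_coords \<tau> c = map (\<lambda>t. (fst (\<tau> ! t), (\<lambda>j\<in>fibre (map fst c) (fst (\<tau> ! t)). snd (c ! j) ! t), snd (\<tau> ! t)))
     [0..<length \<tau>]"

definition letter_weight :: "nat \<times> (nat \<times> nat) list \<Rightarrow> nat \<times> nat list \<Rightarrow> nat \<Rightarrow> nat" where
  "letter_weight \<sigma> l a = card {t. t < length (snd \<sigma>) \<and> fst (snd \<sigma> ! t) = fst l \<and> snd l ! t = a}"

lemma lookup_msum_diag:
  "lookup (msum (map (\<lambda>j. diag_coord j (w j)) (fibre_list f i))) (diag_coord j a) =
     (if j \<in> fibre f i \<and> w j = a then 1 else 0)"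
proof -
  have "lookup (msum (map (\<lambda>j. diag_coord j (w j)) js)) (diag_coord j a) =
     (if j \<in> set js \<and> w j = a then 1 else 0)" if "distinct js" for js
    using that by (induction js) (auto simp: lookup_add lookup_single when_def)
  from this[OF distinct_fibre_list] show ?thesis by simp
qed

lemma lookup_diag_weight:
  assumes j: "j < length c"
  shows "lookup (diag_weight (map fst c) (word_coords \<tau> c)) (diag_coord j a) = letter_weight (k, \<tau>) (c ! j) a"
proof -
  let ?f = "map fst c"
  have "lookup (diag_weight ?f cs) (diag_coord j a) =
     (\<Sum>(i, w, v)\<leftarrow>cs. if j \<in> fibre ?f i \<and> w j = a then 1 else 0)" for cs
    unfolding diag_weight_def by (induction cs) (auto simp: lookup_add lookup_msum_diag)
  also have "(\<Sum>(i, w, v)\<leftarrow>word_coords \<tau> c. if j \<in> fibre ?f i \<and> w j = a then 1 else 0) =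
    (\<Sum>t\<leftarrow>[0..<length \<tau>]. if fst (\<tau> ! t) = fst (c ! j) \<and> snd (c ! j) ! t = a then 1 else (0::nat))"
    unfolding word_coords_def map_map comp_def prod.case
    by (intro arg_cong[of _ _ sum_list] map_cong refl if_cong) (use j in \<open>auto simp: fibre_def\<close>)
  also have "\<dots> = (\<Sum>t<length \<tau>. if fst (\<tau> ! t) = fst (c ! j) \<and> snd (c ! j) ! t = a then 1 else 0)"
    by (simp add: interv_sum_list_conv_sum_set_nat atLeast0LessThan)
  also have "\<dots> = letter_weight (k, \<tau>) (c ! j) a"
    by (simp add: letter_weight_def sum.If_cases Int_def)
  finally show ?thesis .
qed

section \<open>The word module of a finitely generated \<Delta>-module\<close>

context generated_delta_functor
begin

definition max_arity :: nat where
  "max_arity = (\<Sum>(V, x)\<leftarrow>gens. length V)"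

definition letters :: "nat \<Rightarrow> (nat \<times> nat list) set" where
  "letters N = {..<max_arity} \<times> {u. set u \<subseteq> {..<N} \<and> length u = D}"

definition shapes :: "(nat \<times> (nat \<times> nat) list) set" where
  "shapes = (SIGMA k:{..<length gens}. {\<tau>. set \<tau> \<subseteq> (SIGMA i:{..<length (fst (gens ! k))}. {..<fst (gens ! k) ! i}) \<and> length \<tau> \<le> D})"

text \<open>A word whose first components miss an index of the source encodes no surjection; sending
  it to 0 admits every word over the alphabet.\<close>

fun word_elt :: "nat \<Rightarrow> (nat \<times> (nat \<times> nat) list) \<times> (nat \<times> nat list) list \<Rightarrow> 'm" where
  "word_elt N ((k, \<tau>), c) = (if fst ` set c = {..<length (fst (gens ! k))}
     then pol F (fst (gens ! k)) (replicate (length c) N) (map fst c) (msum (word_coords \<tau> c)) (snd (gens ! k)) else 0)"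

lemma finite_letters: "finite (letters N)"
  unfolding letters_def using finite_lists_length_eq[of "{..<N}" D] by simp

lemma finite_shapes: "finite shapes"
  unfolding shapes_def by (intro finite_SigmaI finite_lists_length_le) auto

lemma length_le_max_arity: "(V, x) \<in> set gens \<Longrightarrow> length V \<le> max_arity"
  unfolding max_arity_def by (rule member_le_sum_list) (force, simp)

lemma surj_word_replicate_iff: "surj_word V (replicate n N) f \<longleftrightarrow> length f = n \<and> set f = {..<length V}"
  by (auto simp: surj_word_def)

lemma word_coords_subset:
  assumes \<sigma>: "(k, \<tau>) \<in> shapes" and c: "c \<in> lists (letters N)"
  shows "set (word_coords \<tau> c) \<subseteq> coords (fst (gens ! k)) (replicate (length c) N) (map fst c)"
proof
  fix e assume "e \<in> set (word_coords \<tau> c)"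
  then obtain t where t: "t < length \<tau>"
    and e: "e = (fst (\<tau> ! t), (\<lambda>j\<in>fibre (map fst c) (fst (\<tau> ! t)). snd (c ! j) ! t), snd (\<tau> ! t))"
    by (auto simp: word_coords_def)
  have "\<tau> ! t \<in> set \<tau>" using t by simp
  then have 1: "fst (\<tau> ! t) < length (fst (gens ! k))" "snd (\<tau> ! t) < fst (gens ! k) ! fst (\<tau> ! t)"
    using \<sigma> by (auto simp: shapes_def)
  have tD: "t < D" using t \<sigma> by (auto simp: shapes_def)
  have "snd (c ! j) ! t < N" if "j < length c" for j
  proof -
    have "c ! j \<in> letters N" using c that by auto
    then have "set (snd (c ! j)) \<subseteq> {..<N}" "length (snd (c ! j)) = D" by (auto simp: letters_def)
    then show ?thesis using tD nth_mem by blast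
  qed
  then show "e \<in> coords (fst (gens ! k)) (replicate (length c) N) (map fst c)"
    using 1 e by (auto simp: coords_def tbasis_def fibre_def)
qed

lemma gens_nth: "k < length gens \<Longrightarrow> (fst (gens ! k), snd (gens ! k)) \<in> set gens"
  by simp

lemma word_elt_in_weight_terms:
  assumes \<sigma>: "(k, \<tau>) \<in> shapes" and c: "c \<in> lists (letters N)" and s: "fst ` set c = {..<length (fst (gens ! k))}"
  shows "word_elt N ((k, \<tau>), c) \<in> weight_terms (replicate (length c) N) (diag_weight (map fst c) (word_coords \<tau> c))"
proof -
  have k: "(fst (gens ! k), snd (gens ! k)) \<in> set gens" using \<sigma> by (auto simp: shapes_def)
  have f: "surj_word (fst (gens ! k)) (replicate (length c) N) (map fst c)" using s by (simp add: surj_word_replicate_iff)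
  have "length (word_coords \<tau> c) \<le> D" using \<sigma> by (simp add: word_coords_def shapes_def)
  moreover have "word_elt N ((k, \<tau>), c) = pol F (fst (gens ! k)) (replicate (length c) N) (map fst c) (msum (word_coords \<tau> c)) (snd (gens ! k))"
    using s by simp
  ultimately show ?thesis
    using k f word_coords_subset[OF \<sigma> c] unfolding weight_terms_def by blast
qed

lemma word_elt_obj:
  assumes "\<sigma> \<in> shapes" "c \<in> lists (letters N)"
  shows "word_elt N (\<sigma>, c) \<in> obj F (replicate (length c) N)"
  using word_elt_in_weight_terms[of "fst \<sigma>" "snd \<sigma>" c N] assms weight_terms_obj zero_obj
  by (cases \<sigma>) (auto simp del: in_lists_conv_set)

text \<open>\<open>push (dup g)\<close> copies the indices at position \<open>g ! l\<close> to
  position \<open>l\<close>. As \<open>g\<close> is surjective, the set of letters does not change,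
  so words sent to 0 correspond to words sent to 0.\<close>

lemma mor_dup_word_elt:
  assumes \<sigma>: "\<sigma> \<in> shapes" and c: "c \<in> lists (letters N)" and g: "set g = {..<length c}" and N: "N \<le> N'"
  shows "mor F (replicate (length c) N) (replicate (length g) N') g (basis_mor (dup g)) (word_elt N (\<sigma>, c)) =
    word_elt N' (\<sigma>, map ((!) c) g)"
proof -
  obtain k \<tau> where k: "\<sigma> = (k, \<tau>)" by fastforce
  let ?d = "map ((!) c) g"
  let ?V = "fst (gens ! k)" and ?x = "snd (gens ! k)"
  have gs: "surj_word (replicate (length c) N) (replicate (length g) N') g"
    using g by (simp add: surj_word_def)
  have gl: "g ! l < length c" if "l < length g" for l using g that nth_mem by blast
  have cw: "comp_word (map fst c) g = map fst ?d"
    by (rule nth_equalityI) (use gl in auto)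
  have set_d: "set ?d = set c" unfolding set_map g by (auto simp: set_conv_nth)
  show ?thesis
  proof (cases "fst ` set c = {..<length ?V}")
    case False
    then show ?thesis using mor_0[OF gs] set_d by (simp add: k)
  next
    case True
    have f: "surj_word ?V (replicate (length c) N) (map fst c)" using True by (simp add: surj_word_replicate_iff)
    have b: "basis_injection (replicate (length c) N) (replicate (length g) N') g (dup g)"
      by (rule basis_injection_dup[OF gs]) (use gl N in auto)
    have "?x \<in> obj F ?V" using \<sigma> gens_obj gens_nth by (auto simp: k shapes_def)
    note m = mor_basis_pol[OF f gs b word_coords_subset[OF \<sigma>[unfolded k] c] this]
    have "map (push (dup g) (map fst c) g) (word_coords \<tau> c) = word_coords \<tau> ?d"
    proof -
      have "(\<lambda>l\<in>fibre (comp_word (map fst c) g) i. (\<lambda>j\<in>fibre (map fst c) i. snd (c ! j) ! t) (g ! l)) =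
        (\<lambda>l\<in>fibre (map fst ?d) i. snd (?d ! l) ! t)" for i t
        unfolding cw[symmetric] using gl by (intro restrict_ext) (auto simp: fibre_def)
      then show ?thesis
        unfolding word_coords_def map_map by (intro map_cong refl) (simp only: comp_def push_dup)
    qed
    then show ?thesis using m True set_d unfolding cw by (simp add: k)
  qed
qed

lemma weight_term_is_word_elt:
  assumes t: "t \<in> weight_terms (replicate n (Suc M)) \<beta>"
  obtains k \<tau> c where "(k, \<tau>) \<in> shapes" "c \<in> lists (letters (Suc M))" "length c = n"
    "t = word_elt (Suc M) ((k, \<tau>), c)" "\<beta> = diag_weight (map fst c) (word_coords \<tau> c)"
    "fst ` set c = {..<length (fst (gens ! k))}"
proof -
  obtain V x f cs where V: "(V, x) \<in> set gens" and f: "surj_word V (replicate n (Suc M)) f"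
    and cs: "set cs \<subseteq> coords V (replicate n (Suc M)) f" "length cs \<le> D" "diag_weight f cs = \<beta>"
    and t: "t = pol F V (replicate n (Suc M)) f (msum cs) x"
    using t unfolding weight_terms_def by blast
  obtain k where k: "k < length gens" "gens ! k = (V, x)" using V by (metis in_set_conv_nth)
  define \<tau> where "\<tau> = map (\<lambda>(i, w, v). (i, v)) cs"
  \<comment> \<open>Irrelevant entries are filled with 0, a legal value because the side of the cube
    is a successor.\<close>
  define u where "u j = map (\<lambda>t. if t < length cs \<and> f ! j = fst (cs ! t) then fst (snd (cs ! t)) j else 0) [0..<D]" for j
  define c where "c = map (\<lambda>j. (f ! j, u j)) [0..<n]"
  have lf: "length f = n" "set f = {..<length V}" using f by (auto simp: surj_word_def)
  have mf: "map fst c = f" by (rule nth_equalityI) (auto simp: c_def lf)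
  have nth: "fst (cs ! t) < length V" "fst (snd (cs ! t)) \<in> tbasis (replicate n (Suc M)) (fibre f (fst (cs ! t)))"
      "snd (snd (cs ! t)) < V ! fst (cs ! t)" if "t < length cs" for t
  proof -
    have "cs ! t \<in> coords V (replicate n (Suc M)) f" using cs(1) that nth_mem by blast
    then show "fst (cs ! t) < length V" "fst (snd (cs ! t)) \<in> tbasis (replicate n (Suc M)) (fibre f (fst (cs ! t)))"
      "snd (snd (cs ! t)) < V ! fst (cs ! t)" by (auto simp: coords_def)
  qed
  have \<tau>_nth: "\<tau> ! t = (fst (cs ! t), snd (snd (cs ! t)))" if "t < length cs" for t
    using that by (simp add: \<tau>_def case_prod_beta)
  have l\<tau>: "length \<tau> = length cs" by (simp add: \<tau>_def)
  have "set \<tau> \<subseteq> (SIGMA i:{..<length V}. {..<V ! i})"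
  proof
    fix p assume "p \<in> set \<tau>"
    then obtain t where "t < length cs" "p = \<tau> ! t" using l\<tau> by (metis in_set_conv_nth)
    then show "p \<in> (SIGMA i:{..<length V}. {..<V ! i})" using nth[of t] \<tau>_nth[of t] by simp
  qed
  then have 1: "(k, \<tau>) \<in> shapes" using k cs(2) l\<tau> by (simp add: shapes_def)
  have lu: "length (u j) = D" for j by (simp add: u_def)
  have u_less: "u j ! t < Suc M" if "t < D" "j < n" for j t
  proof (cases "t < length cs \<and> f ! j = fst (cs ! t)")
    case True
    then have "j \<in> fibre f (fst (cs ! t))" using that lf by (simp add: fibre_def)
    then have "fst (snd (cs ! t)) j < Suc M" using nth(2)[of t] True that unfolding tbasis_def by (force simp: PiE_def Pi_def)
    then show ?thesis using True that by (simp add: u_def)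
  qed (use that in \<open>auto simp: u_def\<close>)
  have "set (u j) \<subseteq> {..<Suc M} \<and> length (u j) = D" if "j < n" for j
  proof -
    have "y < Suc M" if y: "y \<in> set (u j)" for y
    proof -
      obtain t where "t < D" "y = u j ! t" using y lu[of j] by (metis in_set_conv_nth)
      then show ?thesis using u_less \<open>j < n\<close> by blast
    qed
    then show ?thesis using lu by auto
  qed
  moreover have "f ! j < max_arity" if "j < n" for j
    using length_le_max_arity[OF V] lf that nth_mem[of j f] by auto
  ultimately have "(f ! j, u j) \<in> letters (Suc M)" if "j < n" for j
    using that unfolding letters_def by blast
  then have 2: "c \<in> lists (letters (Suc M))" by (auto simp: c_def)
  have wc: "word_coords \<tau> c = cs"
  proof (rule nth_equalityI)
    show "length (word_coords \<tau> c) = length cs" by (simp add: word_coords_def l\<tau>)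
    fix t assume "t < length (word_coords \<tau> c)"
    then have t: "t < length cs" by (simp add: word_coords_def l\<tau>)
    have "(\<lambda>j\<in>fibre f (fst (cs ! t)). snd (c ! j) ! t) = fst (snd (cs ! t))"
    proof
      fix j
      show "(\<lambda>j\<in>fibre f (fst (cs ! t)). snd (c ! j) ! t) j = fst (snd (cs ! t)) j"
      proof (cases "j \<in> fibre f (fst (cs ! t))")
        case True
        then have "j < n" "f ! j = fst (cs ! t)" using lf by (auto simp: fibre_def)
        then show ?thesis using True t cs(2) by (simp add: c_def u_def)
      next
        case False
        then show ?thesis using nth(2)[OF t] by (auto simp: tbasis_def PiE_def extensional_def)
      qed
    qed
    then show "word_coords \<tau> c ! t = cs ! t"
      using t \<tau>_nth[OF t] by (simp add: word_coords_def l\<tau> mf prod_eq_iff)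
  qed
  have sc: "fst ` set c = {..<length (fst (gens ! k))}" using mf lf k by (metis fst_conv set_map)
  moreover have "t = word_elt (Suc M) ((k, \<tau>), c)" using sc t wc mf k by (simp add: c_def)
  moreover have "length c = n" by (simp add: c_def)
  ultimately show ?thesis using that[OF 1 2] cs(3) wc mf by blast
qed

text \<open>The side \<open>Suc D\<close> is at least \<open>D\<close>, as the reduction to cubes
  requires, and positive, as the encoding by words requires.\<close>

abbreviation dup_mor :: "nat \<Rightarrow> nat list \<Rightarrow> 'm \<Rightarrow> 'm" where
  "dup_mor n g \<equiv> mor F (replicate n (Suc D)) (replicate (length g) (Suc D)) g (basis_mor (dup g))"

sublocale wm: word_module "scl F" shapes "letters (Suc D)" "word_elt (Suc D)" dup_mor
proof unfold_locales
  have sub: "span (word_elt (Suc D) ` (shapes \<times> {c \<in> lists (letters (Suc D)). length c = n})) \<subseteq> obj F (replicate n (Suc D))" for n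
    by (rule span_minimal[OF _ subspace_obj]) (auto simp del: word_elt.simps in_lists_conv_set intro: word_elt_obj)
  have surj: "surj_word (replicate n (Suc D)) (replicate (length g) (Suc D)) g" if "set g = {..<n}" for n g
    using that by (simp add: surj_word_def)
  fix g n x y r
  assume g: "set g = {..<n}"
    and x: "x \<in> span (word_elt (Suc D) ` (shapes \<times> {c \<in> lists (letters (Suc D)). length c = n}))"
  show "dup_mor n g (scl F r x) = scl F r (dup_mor n g x)"
    using mor_simps(3)[OF surj[OF g]] x sub by blast
  assume y: "y \<in> span (word_elt (Suc D) ` (shapes \<times> {c \<in> lists (letters (Suc D)). length c = n}))"
  show "dup_mor n g (x + y) = dup_mor n g x + dup_mor n g y"
    using mor_simps(2)[OF surj[OF g]] x y sub by blast
qed (use finite_letters finite_shapes mor_dup_word_elt in auto)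

lemma words_span: "wm.E n = obj F (replicate n (Suc D))"
proof
  show "wm.E n \<subseteq> obj F (replicate n (Suc D))"
    by (rule span_minimal[OF _ subspace_obj])
      (auto simp: wm.words_def simp del: word_elt.simps in_lists_conv_set intro: word_elt_obj)
  have "terms (replicate n (Suc D)) \<subseteq> word_elt (Suc D) ` wm.words n"
  proof
    fix t assume "t \<in> terms (replicate n (Suc D))"
    then obtain \<beta> where "t \<in> weight_terms (replicate n (Suc D)) \<beta>" by (auto simp: terms_def)
    then show "t \<in> word_elt (Suc D) ` wm.words n"
      by (rule weight_term_is_word_elt) (auto simp: wm.words_def simp del: word_elt.simps)
  qed
  then show "obj F (replicate n (Suc D)) \<subseteq> wm.E n" unfolding obj_eq_span_terms by (rule span_mono)
qed

text \<open>On the cubes of side \<open>Suc D\<close>, finitely many elements generate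
  \<open>U\<close> under duplications alone. A submodule of \<open>U\<close> containing them agrees
  with \<open>U\<close> on these cubes, hence everywhere.\<close>

theorem noetherian: "noetherian F"
  unfolding noetherian_def
proof (intro allI impI)
  fix U assume sub: "delta_submodule F U"
  then have U: "subspace (U V)" "U V \<subseteq> obj F V"
    "surj_word V W f \<Longrightarrow> mor F V W f \<eta> ` U V \<subseteq> U W" "surj_word V W f \<Longrightarrow> pol F V W f \<alpha> ` U V \<subseteq> U W" for V W f \<eta> \<alpha>
    unfolding delta_submodule_def by blast+
  let ?N = "Suc D"
  have surj: "surj_word (replicate n ?N) (replicate (length g) ?N) g" if "set g = {..<n}" for n g
    using that by (simp add: surj_word_def)
  have UD: "dup_mor n g ` U (replicate n ?N) \<subseteq> U (replicate (length g) ?N)" if "set g = {..<n}" for n g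
    by (rule U(3)[OF surj[OF that]])
  have UE: "U (replicate n ?N) \<subseteq> wm.E n" for n unfolding words_span by (rule U(2))
  obtain T where T: "finite T" "\<forall>(n, u)\<in>T. u \<in> U (replicate n ?N)"
    and gen: "\<And>U'. (\<forall>n. subspace (U' n)) \<and> (\<forall>n g. set g = {..<n} \<longrightarrow> dup_mor n g ` U' n \<subseteq> U' (length g)) \<and>
       (\<forall>(n, u)\<in>T. u \<in> U' n) \<Longrightarrow> \<forall>n. U (replicate n ?N) \<subseteq> U' n"
    using wm.finite_generation[where U = "\<lambda>n. U (replicate n ?N)", OF U(1) UE UD] by metis
  let ?S = "(\<lambda>(n, u). (replicate n ?N, u)) ` T"
  have eq: "U' V = U V" if s': "delta_submodule (F\<lparr>obj := U\<rparr>) U'" and S: "\<forall>(V, x)\<in>?S. x \<in> U' V" for U' V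
  proof
    have U': "subspace (U' V)" "U' V \<subseteq> U V" "surj_word V W f \<Longrightarrow> mor F V W f \<eta> ` U' V \<subseteq> U' W" for V W f \<eta>
      using s' unfolding delta_submodule_def by simp_all
    show "U' V \<subseteq> U V" by (rule U')
    have le: "\<forall>n. U (replicate n ?N) \<subseteq> U' (replicate n ?N)"
    proof (rule gen, intro conjI allI impI)
      show "subspace (U' (replicate n ?N))" for n by (rule U')
      show "dup_mor n g ` U' (replicate n ?N) \<subseteq> U' (replicate (length g) ?N)" if "set g = {..<n}" for n g
        by (rule U'(3)[OF surj[OF that]])
      show "\<forall>(n, u)\<in>T. u \<in> U' (replicate n ?N)" using S by auto
    qed
    show "U V \<subseteq> U' V"
      by (rule submodule_le_if_replicate[of U U' ?N, OF U(2,3,4) U'(1,3)]) (use le in auto)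
  qed
  show "finitely_generated (F\<lparr>obj := U\<rparr>)"
    unfolding finitely_generated_def
  proof (intro exI[of _ ?S] conjI allI impI)
    show "finite ?S" using T(1) by simp
    show "\<forall>(V, x)\<in>?S. x \<in> obj (F\<lparr>obj := U\<rparr>) V" using T(2) by auto
    show "U' V = obj (F\<lparr>obj := U\<rparr>) V"
      if "delta_submodule (F\<lparr>obj := U\<rparr>) U' \<and> (\<forall>(V, x)\<in>?S. x \<in> U' V)" for U' V
      using eq[OF conjunct1[OF that] conjunct2[OF that]] by simp
  qed
qed

end

text \<open>The degree bound depends only on the arity of the source, so it is uniform in the
  target; summing over the generators gives one \<open>D\<close>.\<close>

lemma (in delta_functor) ex_generated:
  assumes "finitely_generated F"
  shows "\<exists>gens D. generated_delta_functor F gens D"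
proof -
  obtain S where S: "finite S" "\<forall>(V, x)\<in>S. x \<in> obj F V"
    "\<forall>U. delta_submodule F U \<and> (\<forall>(V, x)\<in>S. x \<in> U V) \<longrightarrow> (\<forall>V. U V = obj F V)"
    using assms unfolding finitely_generated_def by blast
  obtain gens where gens: "set gens = S" using finite_list[OF S(1)] by blast
  have "\<forall>n. \<exists>D. \<forall>V W f \<alpha> x. length V = n \<and> surj_word V W f \<and> x \<in> obj F V \<and> pol F V W f \<alpha> x \<noteq> 0 \<longrightarrow> monom_degree \<alpha> \<le> D"
    using pol_degree_bound by blast
  then obtain Df where Df: "\<And>V W f \<alpha> x. surj_word V W f \<Longrightarrow> x \<in> obj F V \<Longrightarrow> pol F V W f \<alpha> x \<noteq> 0 \<Longrightarrow> monom_degree \<alpha> \<le> Df (length V)"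
    by metis
  define D where "D = (\<Sum>(V, x)\<leftarrow>gens. Df (length V))"
  have D: "Df (length V) \<le> D" if "(V, x) \<in> set gens" for V x
    unfolding D_def using that by (intro member_le_sum_list) (force, simp)
  have "generated_delta_functor F gens D"
  proof
    show "x \<in> obj F V" if "(V, x) \<in> set gens" for V x using that S(2) gens by blast
    show "U V = obj F V" if "delta_submodule F U" "\<And>V x. (V, x) \<in> set gens \<Longrightarrow> x \<in> U V" for U V
      using that S(3) gens by blast
    show "monom_degree \<alpha> \<le> D" if "(V, x) \<in> set gens" "surj_word V W f" "pol F V W f \<alpha> x \<noteq> 0" for V x W f \<alpha>
    proof -
      have "x \<in> obj F V" using that(1) S(2) gens by blast
      then show ?thesis using Df[OF that(2) _ that(3)] D[OF that(1)] by simp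
    qed
  qed
  then show ?thesis by blast
qed


section \<open>Weight spaces of the direct limit\<close>

definition partition_weight :: "partition list \<Rightarrow> coord \<Rightarrow>\<^sub>0 nat" where
  "partition_weight ps = msum (concat (map (\<lambda>j. concat (map (\<lambda>a. replicate (Defs.part (ps ! j) a) (diag_coord j a))
     [0..<length (parts (ps ! j))])) [0..<length ps]))"

lemma part_eq_0_iff: "Defs.part p a = 0 \<longleftrightarrow> length (parts p) \<le> a"
proof -
  have "0 \<notin> set (parts p)" using parts[of p] by simp
  then have "parts p ! a \<noteq> 0" if "a < length (parts p)" using nth_mem[OF that] by metis
  then show ?thesis by (auto simp: Defs.part_def)
qed

lemma lookup_partition_weight:
  assumes j: "j < length ps"
  shows "lookup (partition_weight ps) (diag_coord j a) = Defs.part (ps ! j) a"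
proof -
  have 1: "lookup (msum (replicate k (diag_coord i b))) (diag_coord j a) = (if i = j \<and> b = a then k else 0)" for k i b
    by (induction k) (auto simp: lookup_add lookup_single when_def)
  have 2: "lookup (msum (concat (map (\<lambda>b. replicate (h b) (diag_coord i b)) as))) (diag_coord j a) =
      (if i = j \<and> a \<in> set as then h a else 0)" if "distinct as" for h as i
    using that by (induction as) (auto simp: lookup_add 1)
  have 3: "lookup (msum (concat (map (\<lambda>i. concat (map (\<lambda>b. replicate (Defs.part (ps ! i) b) (diag_coord i b))
     [0..<length (parts (ps ! i))])) js))) (diag_coord j a) = (if j \<in> set js then Defs.part (ps ! j) a else 0)"
    if "distinct js" for js
    using that part_eq_0_iff[of "ps ! j" a] by (induction js) (auto simp: lookup_add 2)
  show ?thesis unfolding partition_weight_def using 3[of "[0..<length ps]"] j by simp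
qed

lemma keys_partition_weight:
  "keys (partition_weight ps) = {diag_coord j a | j a. j < length ps \<and> a < length (parts (ps ! j))}"
  by (auto simp: partition_weight_def set_replicate_conv_if part_eq_0_iff)

lemma eq_partition_weight_iff:
  assumes \<alpha>: "keys \<alpha> \<subseteq> diag_coords (replicate (length ps) N)"
    and len: "\<forall>p\<in>set ps. length (parts p) \<le> N"
  shows "\<alpha> = partition_weight ps \<longleftrightarrow>
    (\<forall>j<length ps. \<forall>a<N. lookup \<alpha> (diag_coord j a) = Defs.part (ps ! j) a)"
proof
  assume "\<alpha> = partition_weight ps"
  then show "\<forall>j<length ps. \<forall>a<N. lookup \<alpha> (diag_coord j a) = Defs.part (ps ! j) a"
    using lookup_partition_weight by simp
next
  assume *: "\<forall>j<length ps. \<forall>a<N. lookup \<alpha> (diag_coord j a) = Defs.part (ps ! j) a"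
  have len': "length (parts (ps ! j)) \<le> N" if "j < length ps" for j using len that by simp
  have k: "keys (partition_weight ps) \<subseteq> diag_coords (replicate (length ps) N)"
    unfolding keys_partition_weight diag_coords_def using len' by fastforce
  show "\<alpha> = partition_weight ps"
  proof (rule poly_mapping_eqI)
    fix c
    show "lookup \<alpha> c = lookup (partition_weight ps) c"
    proof (cases "c \<in> diag_coords (replicate (length ps) N)")
      case True
      then obtain j a where "c = diag_coord j a" "j < length ps" "a < N" by (auto simp: diag_coords_def)
      then show ?thesis using * lookup_partition_weight by simp
    next
      case False
      then have "c \<notin> keys \<alpha>" "c \<notin> keys (partition_weight ps)" using \<alpha> k by blast+
      then show ?thesis by (simp add: in_keys_iff)
    qed
  qed
qed

lemma keys_partition_weight_subset:
  assumes "\<forall>p\<in>set ps. length (parts p) \<le> N"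
  shows "keys (partition_weight ps) \<subseteq> diag_coords (replicate (length ps) N)"
proof -
  have "length (parts (ps ! j)) \<le> N" if "j < length ps" for j using assms that by simp
  then show ?thesis unfolding keys_partition_weight diag_coords_def by fastforce
qed

section \<open>Standard maps between cubes and their effect on weights\<close>

context generated_delta_functor
begin

abbreviation cube :: "nat \<Rightarrow> nat \<Rightarrow> nat list" where
  "cube n N \<equiv> replicate n N"

abbreviation std :: "nat \<Rightarrow> nat \<Rightarrow> nat \<Rightarrow> 'm \<Rightarrow> 'm" where
  "std n M N \<equiv> mor F (cube n M) (cube n N) [0..<n] std_mor"

lemma id_word_cube: "[0..<n] = id_word (cube n N)"
  by (simp add: id_word_def)

lemma surj_cube: "surj_word (cube n M) (cube n N) [0..<n]"
  by (simp add: id_word_cube[of n M])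

text \<open>Passing through level \<open>K\<close> loses nothing unless \<open>K\<close> is smaller
  than both ends.\<close>

lemma std_comp:
  assumes "x \<in> obj F (cube n M)" "M \<le> K \<or> N \<le> K"
  shows "std n K N (std n M K x) = std n M N x"
proof -
  have "mor F (cube n K) (cube n N) (id_word (cube n K)) (rel_mor (\<lambda>j b v. b = v)) (mor F (cube n M) (cube n K) (id_word (cube n M)) (rel_mor (\<lambda>j b v. b = v)) x)
    = mor F (cube n M) (cube n N) (id_word (cube n M)) (rel_mor (\<lambda>j b v. b = v)) x"
    by (rule mor_rel_comp) (use assms in auto)
  then show ?thesis by (simp add: std_mor_eq id_word_def)
qed

lemma std_idem:
  assumes x: "x \<in> obj F (cube n M)" and KM: "K \<le> M"
  shows "std n K M (std n M K x) = mor F (cube n M) (cube n M) (id_word (cube n M)) (diag_mor (\<lambda>_. {..<K})) x"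
proof -
  have "mor F (cube n K) (cube n M) (id_word (cube n K)) (rel_mor (\<lambda>j b v. b = v)) (mor F (cube n M) (cube n K) (id_word (cube n M)) (rel_mor (\<lambda>j b v. b = v)) x)
    = mor F (cube n M) (cube n M) (id_word (cube n M)) (diag_mor (\<lambda>_. {..<K})) x"
    by (rule mor_rel_comp) (use assms in auto)
  then show ?thesis by (simp add: std_mor_eq id_word_def)
qed

lemma std_basis_mor:
  assumes x: "x \<in> obj F (cube n M)"
  shows "std n M N x = mor F (cube n M) (cube n N) [0..<n] (basis_mor (dup [0..<n])) x"
proof (rule mor_cong[OF surj_cube _ x])
  fix c assume "c \<in> coords (cube n M) (cube n N) [0..<n]"
  then obtain j y v where c: "c = (j, y, v)" "j < n" "y \<in> tbasis (cube n N) (fibre [0..<n] j)"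
    by (auto simp: coords_def)
  have f: "fibre [0..<n] j = {j}" using c(2) by (auto simp: fibre_def)
  then obtain a where a: "y = (\<lambda>l\<in>{j}. a)" using c(3) by (auto simp: tbasis_singleton)
  have "y = (\<lambda>l\<in>{j}. v) \<longleftrightarrow> a = v" unfolding a by (auto dest: fun_cong[of _ _ j])
  then show "std_mor c = basis_mor (dup [0..<n]) c"
    using c(1) a f by (simp add: std_mor_def basis_mor_def dup_def)
qed

lemma std_weight_terms:
  assumes t: "t \<in> weight_terms (cube n M) \<beta>" and MN: "M \<le> N"
  shows "std n M N t \<in> weight_terms (cube n N) \<beta>"
proof -
  obtain V x f cs where V: "(V, x) \<in> set gens" and f: "surj_word V (cube n M) f"
    and cs: "set cs \<subseteq> coords V (cube n M) f" "length cs \<le> D" "diag_weight f cs = \<beta>"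
    and teq: "t = pol F V (cube n M) f (msum cs) x"
    using t unfolding weight_terms_def by blast
  let ?g = "[0..<n]"
  have b: "basis_injection (cube n M) (cube n N) ?g (dup ?g)"
    by (rule basis_injection_dup[OF surj_cube]) (use MN in auto)
  have lf: "length f = n" using f by (simp add: surj_word_def)
  have fg: "comp_word f ?g = f" unfolding id_word_cube[of n M] by (rule comp_word_id_right) (simp add: lf)
  have push: "push (dup ?g) f ?g c = c" if c: "c \<in> coords V (cube n M) f" for c
    unfolding id_word_cube[of n M] by (rule push_dup_id[OF c]) (simp add: lf)
  have mp: "map (push (dup ?g) f ?g) cs = cs"
    using push cs(1) by (intro map_idI) blast
  have "std n M N t = mor F (cube n M) (cube n N) ?g (basis_mor (dup ?g)) t"
    by (rule std_basis_mor[OF subsetD[OF weight_terms_obj t]])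
  also have "\<dots> = pol F V (cube n N) (comp_word f ?g) (msum (map (push (dup ?g) f ?g) cs)) x"
    unfolding teq by (rule mor_basis_pol[OF f surj_cube b cs(1) gens_obj[OF V]])
  finally have t2: "std n M N t = pol F V (cube n N) f (msum cs) x"
    unfolding fg mp .
  have "set cs \<subseteq> coords V (cube n N) f"
    using push_coords[OF f surj_cube b] push cs(1) fg by fastforce
  moreover have "surj_word V (cube n N) f" using f by (simp add: surj_word_def)
  ultimately show ?thesis unfolding t2 weight_terms_def using V cs by blast
qed

lemma std_weight_span:
  assumes "x \<in> span (weight_terms (cube n M) \<beta>)" and MN: "M \<le> N"
  shows "std n M N x \<in> span (weight_terms (cube n N) \<beta>)"
  by (rule linear_maps_span[OF mor_linear[OF surj_cube] weight_terms_obj subspace_span _ assms(1)])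
    (use std_weight_terms[OF _ MN] in \<open>auto intro: span_base\<close>)

lemma diag_coords_cube_mono: "M \<le> N \<Longrightarrow> diag_coords (cube n M) \<subseteq> diag_coords (cube n N)"
  by (auto simp: diag_coords_def)

text \<open>Standard inclusions send weight terms to weight terms of the same weight, so they
  commute with taking weight components.\<close>

lemma pol_diag_std:
  assumes x: "x \<in> obj F (cube n M)" and MN: "M \<le> N" and \<beta>: "keys \<beta> \<subseteq> diag_coords (cube n M)"
  shows "pol F (cube n N) (cube n N) [0..<n] \<beta> (std n M N x) = std n M N (pol F (cube n M) (cube n M) [0..<n] \<beta> x)"
proof -
  let ?p = "pol F (cube n N) (cube n N) [0..<n] \<beta>" and ?q = "pol F (cube n M) (cube n M) [0..<n] \<beta>"
  have \<beta>N: "keys \<beta> \<subseteq> diag_coords (cube n N)" using \<beta> diag_coords_cube_mono[OF MN] by blast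
  have "x \<in> obj F (cube n M) \<and> ?p (std n M N x) = std n M N (?q x)"
    using x unfolding obj_eq_span_terms[of "cube n M"]
  proof (induction rule: span_induct_alt)
    case base
    show ?case using pol_0[OF surj_cube] mor_0[OF surj_cube] by (simp add: span_zero)
  next
    case (step c t y)
    obtain \<gamma> where \<gamma>: "t \<in> weight_terms (cube n M) \<gamma>" using step(1) by (auto simp: terms_def)
    have t: "?p (std n M N t) = std n M N (?q t)"
      using pol_weight_term[OF std_weight_terms[OF \<gamma> MN] \<beta>N] pol_weight_term[OF \<gamma> \<beta>] mor_0[OF surj_cube]
      by (simp add: id_word_def)
    have to: "t \<in> obj F (cube n M)" and yo: "y \<in> obj F (cube n M)"
      using step terms_obj obj_eq_span_terms by blast+
    have cto: "scl F c t \<in> obj F (cube n M)" using to subspace_obj subspace_scale by blast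
    have "?p (std n M N (scl F c t + y)) = scl F c (?p (std n M N t)) + ?p (std n M N y)"
      using to yo cto by (simp add: mor_simps[OF surj_cube] pol_simps[OF surj_cube] subspace_scale[OF subspace_obj])
    moreover have "std n M N (?q (scl F c t + y)) = scl F c (std n M N (?q t)) + std n M N (?q y)"
      using to yo cto by (simp add: mor_simps[OF surj_cube] pol_simps[OF surj_cube] subspace_scale[OF subspace_obj])
    ultimately show ?case
      using t step cto yo subspace_add[OF subspace_obj cto yo] obj_eq_span_terms by simp
  qed
  then show ?thesis by blast
qed

lemma weight_space_eq:
  assumes len: "\<forall>p\<in>set ps. length (parts p) \<le> N"
  shows "weight_space F (cube (length ps) N) ps = span (weight_terms (cube (length ps) N) (partition_weight ps))"
proof -
  let ?V = "cube (length ps) N" and ?\<beta> = "partition_weight ps"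
  have \<beta>: "keys ?\<beta> \<subseteq> diag_coords ?V" by (rule keys_partition_weight_subset[OF len])
  have ws: "x \<in> weight_space F ?V ps \<longleftrightarrow> x \<in> obj F ?V \<and>
      (\<forall>\<alpha>. keys \<alpha> \<subseteq> diag_coords ?V \<longrightarrow> pol F ?V ?V (id_word ?V) \<alpha> x = (if \<alpha> = ?\<beta> then x else 0))" for x
    unfolding weight_space_def diag_coords_def[symmetric] using eq_partition_weight_iff[OF _ len] by auto
  show ?thesis
  proof (intro equalityI subsetI)
    fix x assume "x \<in> weight_space F ?V ps"
    then have x: "x \<in> span (terms ?V)" "pol F ?V ?V (id_word ?V) ?\<beta> x = x"
      using ws \<beta> obj_eq_span_terms by auto
    show "x \<in> span (weight_terms ?V ?\<beta>)" using pol_diag_in_weight_span[OF x(1) \<beta>] x(2) by simp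
  next
    fix x assume x: "x \<in> span (weight_terms ?V ?\<beta>)"
    then have "x \<in> obj F ?V" using span_minimal[OF weight_terms_obj subspace_obj] by blast
    then show "x \<in> weight_space F ?V ps" using ws pol_weight_span[OF x] by blast
  qed
qed

lemma zero_weight_space: "0 \<in> weight_space F V ps"
  unfolding weight_space_def using zero_obj pol_0[of V V "id_word V"] by simp

lemma std_idem_weight_space:
  assumes len: "\<forall>p\<in>set ps. length (parts p) \<le> N" and KN: "K \<le> N"
    and y: "y \<in> weight_space F (cube (length ps) N) ps"
  shows "std (length ps) K N (std (length ps) N K y) = (if \<forall>p\<in>set ps. length (parts p) \<le> K then y else 0)"
proof -
  let ?n = "length ps"
  have y': "y \<in> span (weight_terms (cube ?n N) (partition_weight ps))" "y \<in> obj F (cube ?n N)"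
    using y weight_space_eq[OF len] by (auto simp: weight_space_def)
  have "(\<forall>j a. diag_coord j a \<in> keys (partition_weight ps) \<longrightarrow> a \<in> {..<K}) \<longleftrightarrow>
     (\<forall>p\<in>set ps. length (parts p) \<le> K)"
    unfolding keys_partition_weight
    by (auto simp: all_set_conv_all_nth) (metis less_le_not_le linorder_not_less nat_le_linear)
  then show ?thesis
    using std_idem[OF y'(2) KN] mor_diag_weight_span[OF y'(1) keys_partition_weight_subset[OF len], of "\<lambda>_. {..<K}"] by simp
qed

text \<open>The delicate case is going down. If the partitions do not fit into \<open>K\<close>,
  truncation kills \<open>y\<close>. If they do, including back recovers \<open>y\<close>, and as
  the inclusion is split injective, the truncated vector equals its own weight component.\<close>

lemma std_weight_space:
  assumes len: "\<forall>p\<in>set ps. length (parts p) \<le> N" and y: "y \<in> weight_space F (cube (length ps) N) ps"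
  shows "std (length ps) N K y \<in> weight_space F (cube (length ps) K) ps"
proof -
  let ?n = "length ps" and ?\<beta> = "partition_weight ps"
  have yo: "y \<in> obj F (cube ?n N)" using y by (simp add: weight_space_def)
  have yw: "y \<in> span (weight_terms (cube ?n N) ?\<beta>)" using y weight_space_eq[OF len] by simp
  show ?thesis
  proof (cases "N \<le> K")
    case True
    then have "\<forall>p\<in>set ps. length (parts p) \<le> K" using len by auto
    then show ?thesis using std_weight_span[OF yw True] weight_space_eq by simp
  next
    case False
    then have KN: "K \<le> N" by simp
    let ?z = "std ?n N K y"
    have zo: "?z \<in> obj F (cube ?n K)" by (rule mor_simps(1)[OF surj_cube yo])
    have retract: "std ?n N K (std ?n K N w) = w" if "w \<in> obj F (cube ?n K)" for w
    proof -
      have "std ?n N K (std ?n K N w) = std ?n K K w" by (rule std_comp[OF that]) (use KN in simp)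
      also have "\<dots> = w" using mor_id[OF that] by (simp add: id_word_def)
      finally show ?thesis .
    qed
    note idem = std_idem_weight_space[OF len KN y]
    show ?thesis
    proof (cases "\<forall>p\<in>set ps. length (parts p) \<le> K")
      case False
      then have "std ?n K N ?z = 0" using idem unfolding if_not_P[OF False] by simp
      then have "?z = 0" using retract[OF zo] mor_0[OF surj_cube] by simp
      then show ?thesis using zero_weight_space by simp
    next
      case True
      then have \<beta>K: "keys ?\<beta> \<subseteq> diag_coords (cube ?n K)" by (rule keys_partition_weight_subset)
      let ?w = "pol F (cube ?n K) (cube ?n K) [0..<?n] ?\<beta> ?z"
      have iz: "std ?n K N ?z = y" using idem unfolding if_P[OF True] .
      have "std ?n K N ?w = pol F (cube ?n N) (cube ?n N) [0..<?n] ?\<beta> y"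
        using pol_diag_std[OF zo KN \<beta>K] iz by simp
      also have "\<dots> = y"
        using pol_weight_span[OF yw keys_partition_weight_subset[OF len]] by (simp add: id_word_def)
      finally have iw: "std ?n K N ?w = y" .
      have wo: "?w \<in> obj F (cube ?n K)" by (rule pol_simps(1)[OF surj_cube zo])
      have "?w = ?z" using retract[OF wo] unfolding iw by simp
      moreover have "?w \<in> span (weight_terms (cube ?n K) ?\<beta>)"
        using pol_diag_in_weight_span[OF _ \<beta>K, of ?z] zo obj_eq_span_terms by (simp add: id_word_def)
      ultimately show ?thesis using weight_space_eq[OF True] by simp
    qed
  qed
qed

text \<open>The limit can be read off at any level \<open>N\<close> where the partitions fit: at a
  common larger level \<open>L\<close>, a vector of this weight survives truncation to
  \<open>N\<close>.\<close>

lemma limit_weight_space_eq: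
  assumes len: "\<forall>p\<in>set ps. length (parts p) \<le> N"
  shows "limit_weight_space F ps = (\<lambda>y K. std (length ps) N K y) ` weight_space F (cube (length ps) N) ps"
proof (intro equalityI subsetI)
  let ?n = "length ps"
  fix s assume s: "s \<in> limit_weight_space F ps"
  then obtain M x where x: "x \<in> obj F (cube ?n M)" and s_eq: "s = (\<lambda>K. std ?n M K x)"
    by (auto simp: limit_weight_space_def limit_space_def)
  have ws: "s K \<in> weight_space F (cube ?n K) ps" for K using s by (simp add: limit_weight_space_def)
  have "s K = std ?n N K (s N)" for K
  proof -
    define L where "L = max N (max M K)"
    have L: "N \<le> L" "M \<le> L" "K \<le> L" by (auto simp: L_def)
    have lenL: "\<forall>p\<in>set ps. length (parts p) \<le> L" using len L by auto
    have sL: "s L \<in> obj F (cube ?n L)" using ws[of L] by (simp add: weight_space_def)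
    have sN: "s N \<in> obj F (cube ?n N)" using ws[of N] by (simp add: weight_space_def)
    have 1: "s K' = std ?n L K' (s L)" for K'
      unfolding s_eq using std_comp[OF x, of L K'] L by simp
    have "s K = std ?n L K (s L)" by (rule 1)
    also have "s L = std ?n N L (std ?n L N (s L))"
      using std_idem_weight_space[OF lenL L(1) ws[of L]] unfolding if_P[OF len] by simp
    also have "std ?n L N (s L) = s N" by (rule 1[symmetric])
    also have "std ?n L K (std ?n N L (s N)) = std ?n N K (s N)"
      using std_comp[OF sN, of L K] L by simp
    finally show ?thesis .
  qed
  then have "s = (\<lambda>K. std ?n N K (s N))" by blast
  then show "s \<in> (\<lambda>y K. std ?n N K y) ` weight_space F (cube ?n N) ps" using ws[of N] by blast
next
  let ?n = "length ps"
  fix s assume "s \<in> (\<lambda>y K. std ?n N K y) ` weight_space F (cube ?n N) ps"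
  then obtain y where y: "y \<in> weight_space F (cube ?n N) ps" "s = (\<lambda>K. std ?n N K y)" by blast
  have "y \<in> obj F (cube ?n N)" using y(1) by (simp add: weight_space_def)
  then have "s \<in> limit_space F ?n" unfolding limit_space_def using y(2) by blast
  then show "s \<in> limit_weight_space F ps"
    unfolding limit_weight_space_def using std_weight_space[OF len y(1)] y(2) by simp
qed

text \<open>Evaluation at level \<open>N\<close> is linear, is injective on the limit weight space,
  and has the weight space of that level as its image.\<close>

lemma weight_dim_eq:
  assumes len: "\<forall>p\<in>set ps. length (parts p) \<le> N"
  shows "weight_dim F ps = dim (weight_space F (cube (length ps) N) ps)"
proof -
  let ?n = "length ps" and ?L = "limit_weight_space F ps" and ?W = "weight_space F (cube (length ps) N) ps"
  let ?sc = "\<lambda>c (s :: nat \<Rightarrow> 'm) N. scl F c (s N)"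
  have fs: "vector_space ?sc"
    by unfold_locales (simp_all add: fun_eq_iff scale_right_distrib scale_left_distrib)
  interpret fs: vector_space ?sc by (rule fs)
  interpret pr: vector_space_pair ?sc "scl F" ..
  have lin: "Vector_Spaces.linear ?sc (scl F) (\<lambda>s. s N)"
    by unfold_locales simp_all
  note L = limit_weight_space_eq[OF len]
  have Wo: "?W \<subseteq> obj F (cube ?n N)" by (auto simp: weight_space_def)
  have Wsub: "subspace ?W" unfolding weight_space_eq[OF len] by (rule subspace_span)
  have ev: "std ?n N N y = y" if "y \<in> ?W" for y
    using mor_id[of y "cube ?n N"] Wo that by (auto simp: id_word_def)
  have "fs.subspace ?L"
  proof (rule fs.subspaceI)
    have "0 = (\<lambda>K. std ?n N K 0)" using mor_0[OF surj_cube] by (simp add: fun_eq_iff)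
    then show "0 \<in> ?L" unfolding L using subspace_0[OF Wsub] by (rule image_eqI)
  next
    fix s s' assume "s \<in> ?L" "s' \<in> ?L"
    then obtain y y' where y: "y \<in> ?W" "y' \<in> ?W" "s = (\<lambda>K. std ?n N K y)" "s' = (\<lambda>K. std ?n N K y')"
      unfolding L by blast
    have yo: "y \<in> obj F (cube ?n N)" "y' \<in> obj F (cube ?n N)" using y Wo by blast+
    have "s + s' = (\<lambda>K. std ?n N K (y + y'))"
      by (rule ext) (simp add: y(3,4) mor_simps(2)[OF surj_cube yo])
    then show "s + s' \<in> ?L" unfolding L using subspace_add[OF Wsub y(1,2)] by (rule image_eqI)
  next
    fix c s assume "s \<in> ?L"
    then obtain y where y: "y \<in> ?W" "s = (\<lambda>K. std ?n N K y)"
      unfolding L by blast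
    have yo: "y \<in> obj F (cube ?n N)" using y Wo by blast
    have "?sc c s = (\<lambda>K. std ?n N K (scl F c y))"
      by (rule ext) (simp add: y(2) mor_simps(3)[OF surj_cube yo])
    then show "?sc c s \<in> ?L" unfolding L using subspace_scale[OF Wsub y(1)] by (rule image_eqI)
  qed
  then have span_L: "fs.span ?L = ?L" by (simp add: fs.span_eq_iff)
  have inj: "inj_on (\<lambda>s. s N) ?L"
    unfolding L using ev by (auto simp: inj_on_def)
  obtain B where B: "B \<subseteq> ?L" "fs.independent B" "?L \<subseteq> fs.span B" "card B = fs.dim ?L"
    by (rule fs.basis_exists)
  have span_B: "fs.span B = ?L" using B fs.span_mono[OF B(1)] span_L by blast
  have "independent ((\<lambda>s. s N) ` B)"
    using pr.linear_independent_injective_image[OF lin B(2)] inj span_B by simp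
  moreover have "span ((\<lambda>s. s N) ` B) = (\<lambda>s. s N) ` ?L"
    using pr.linear_span_image[OF lin, of B] span_B by simp
  moreover have "card ((\<lambda>s. s N) ` B) = card B"
    using inj_on_subset[OF inj B(1)] by (rule card_image)
  ultimately have "dim ((\<lambda>s. s N) ` ?L) = fs.dim ?L"
    using B(4) by (metis dim_span_eq_card_independent)
  moreover have "(\<lambda>s. s N) ` ?L = ?W" unfolding L image_image using ev by simp
  ultimately show ?thesis by (simp add: weight_dim_def)
qed

end


section \<open>The Hilbert series\<close>

lemma length_parts_le: "length (parts p) \<le> sum_list (parts p)"
proof -
  have "length xs \<le> sum_list xs" if "0 \<notin> set xs" for xs :: "nat list"
    using that by (induction xs) auto
  then show ?thesis using parts[of p] by simp
qed

lemma finite_partitions_le: "finite {p. sum_list (parts p) \<le> d}"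
proof (rule finite_imageD)
  show "inj_on parts {p. sum_list (parts p) \<le> d}" by (simp add: inj_on_def parts_inject)
  have "parts ` {p. sum_list (parts p) \<le> d} \<subseteq> {xs. set xs \<subseteq> {..d} \<and> length xs \<le> d}"
    using length_parts_le member_le_sum_list by (fastforce intro: order_trans)
  then show "finite (parts ` {p. sum_list (parts p) \<le> d})"
    using finite_lists_length_le[of "{..d}" d] finite_subset by blast
qed

lemma sum_part: "(\<Sum>a<length (parts p). Defs.part p a) = sum_list (parts p)"
  by (simp add: Defs.part_def sum_list_sum_nth atLeast0LessThan)

text \<open>Each entry of the monomial adds at most 1 to the weight of a letter. Hence only
  partitions of size at most \<open>D\<close> occur, leaving finitely many variables in the Hilbert
  series.\<close>

lemma sum_letter_weight_le: "(\<Sum>a<m. letter_weight \<sigma> l a) \<le> length (snd \<sigma>)"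
proof -
  let ?T = "\<lambda>a. {t. t < length (snd \<sigma>) \<and> fst (snd \<sigma> ! t) = fst l \<and> snd l ! t = a}"
  have "(\<Sum>a<m. letter_weight \<sigma> l a) = card (\<Union>a<m. ?T a)"
    unfolding letter_weight_def by (rule card_UN_disjoint[symmetric]) auto
  also have "\<dots> \<le> card {..<length (snd \<sigma>)}" by (rule card_mono) auto
  finally show ?thesis by simp
qed

context generated_delta_functor
begin

section \<open>Weight spaces spanned by words, and their symmetry\<close>

definition partition_words :: "nat \<Rightarrow> partition list \<Rightarrow> ((nat \<times> (nat \<times> nat) list) \<times> (nat \<times> nat list) list) set" where
  "partition_words N ps = {(\<sigma>, c). \<sigma> \<in> shapes \<and> c \<in> lists (letters N) \<and> map (letter_weight \<sigma>) c = map Defs.part ps}"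

lemma weight_space_words:
  assumes len: "\<forall>p\<in>set ps. length (parts p) \<le> Suc M"
  shows "weight_space F (cube (length ps) (Suc M)) ps = span (word_elt (Suc M) ` partition_words (Suc M) ps)"
proof -
  let ?V = "cube (length ps) (Suc M)" and ?\<beta> = "partition_weight ps"
  have 1: "weight_terms ?V ?\<beta> \<subseteq> word_elt (Suc M) ` partition_words (Suc M) ps"
  proof
    fix t assume t: "t \<in> weight_terms ?V ?\<beta>"
    obtain k \<tau> c where kc: "(k, \<tau>) \<in> shapes" "c \<in> lists (letters (Suc M))" "length c = length ps"
      "t = word_elt (Suc M) ((k, \<tau>), c)" "?\<beta> = diag_weight (map fst c) (word_coords \<tau> c)"
      by (rule weight_term_is_word_elt[OF t])
    have "letter_weight (k, \<tau>) (c ! j) = Defs.part (ps ! j)" if j: "j < length ps" for j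
    proof
      fix a
      show "letter_weight (k, \<tau>) (c ! j) a = Defs.part (ps ! j) a"
        using lookup_diag_weight[of j c \<tau> a k] lookup_partition_weight[OF j, of a] j kc(3,5) by simp
    qed
    then have "map (letter_weight (k, \<tau>)) c = map Defs.part ps"
      using kc(3) by (intro nth_equalityI) auto
    then show "t \<in> word_elt (Suc M) ` partition_words (Suc M) ps"
      using kc(1,2,4) unfolding partition_words_def by blast
  qed
  have 2: "word_elt (Suc M) ` partition_words (Suc M) ps \<subseteq> span (weight_terms ?V ?\<beta>)"
  proof
    fix t assume "t \<in> word_elt (Suc M) ` partition_words (Suc M) ps"
    then obtain p where p: "t = word_elt (Suc M) p" "p \<in> partition_words (Suc M) ps" by (rule imageE)
    obtain k \<tau> c where "p = ((k, \<tau>), c)" by (metis prod.exhaust)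
    with p have kc: "(k, \<tau>) \<in> shapes" "c \<in> lists (letters (Suc M))"
      "map (letter_weight (k, \<tau>)) c = map Defs.part ps" "t = word_elt (Suc M) ((k, \<tau>), c)"
      unfolding partition_words_def by simp_all
    have lc: "length c = length ps" using arg_cong[OF kc(3), of length] by simp
    show "t \<in> span (weight_terms ?V ?\<beta>)"
    proof (cases "fst ` set c = {..<length (fst (gens ! k))}")
      case True
      have f: "surj_word (fst (gens ! k)) ?V (map fst c)" using True lc by (simp add: surj_word_replicate_iff)
      have "keys (diag_weight (map fst c) (word_coords \<tau> c)) \<subseteq> diag_coords ?V"
        by (rule diag_weight_keys[OF f]) (use word_coords_subset[OF kc(1,2)] lc in simp)
      moreover have "letter_weight (k, \<tau>) (c ! j) = Defs.part (ps ! j)" if "j < length ps" for j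
        using arg_cong[OF kc(3), of "\<lambda>xs. xs ! j"] lc that by simp
      ultimately have "diag_weight (map fst c) (word_coords \<tau> c) = ?\<beta>"
        using eq_partition_weight_iff[OF _ len] lookup_diag_weight[of _ c \<tau> _ k] lc by simp
      then have "t \<in> weight_terms ?V ?\<beta>"
        using word_elt_in_weight_terms[OF kc(1,2) True] lc kc(4) by simp
      then show ?thesis by (rule span_base)
    next
      case False
      then show ?thesis using kc(4) by (simp add: span_zero)
    qed
  qed
  have "span (weight_terms ?V ?\<beta>) = span (word_elt (Suc M) ` partition_words (Suc M) ps)"
    by (rule equalityI[OF span_mono[OF 1] span_minimal[OF 2 subspace_span]])
  then show ?thesis using weight_space_eq[OF len] by simp
qed

lemma partition_words_bound:
  assumes "(\<sigma>, c) \<in> partition_words N ps" "p \<in> set ps"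
  shows "sum_list (parts p) \<le> D"
proof -
  have \<sigma>: "\<sigma> \<in> shapes" and m: "map (letter_weight \<sigma>) c = map Defs.part ps"
    using assms(1) by (auto simp: partition_words_def)
  have "Defs.part p \<in> set (map (letter_weight \<sigma>) c)" unfolding m using assms(2) by simp
  then obtain l where "Defs.part p = letter_weight \<sigma> l" by auto
  then have "sum_list (parts p) = (\<Sum>a<length (parts p). letter_weight \<sigma> l a)"
    by (simp flip: sum_part)
  also have "\<dots> \<le> length (snd \<sigma>)" by (rule sum_letter_weight_le)
  also have "\<dots> \<le> D" using \<sigma> by (auto simp: shapes_def)
  finally show ?thesis .
qed

lemma weight_dim_zero:
  assumes "p \<in> set ps" "D < sum_list (parts p)"
  shows "weight_dim F ps = 0"
proof -
  define M where "M = (\<Sum>p\<leftarrow>ps. length (parts p))"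
  have len: "\<forall>p\<in>set ps. length (parts p) \<le> Suc M"
  proof
    fix q assume "q \<in> set ps"
    then have "length (parts q) \<le> M" unfolding M_def by (intro member_le_sum_list) auto
    then show "length (parts q) \<le> Suc M" by simp
  qed
  have "partition_words (Suc M) ps = {}"
    using partition_words_bound[of _ _ "Suc M" ps p] assms by fastforce
  then have "weight_space F (cube (length ps) (Suc M)) ps = span {}"
    unfolding weight_space_words[OF len] by (simp only: image_empty)
  moreover have "dim (span {}) = 0"
    using dim_span_eq_card_independent[OF independent_empty] by simp
  ultimately show ?thesis using weight_dim_eq[OF len] by (simp only:)
qed

lemma length_le_if_small:
  assumes "\<forall>p\<in>set ps. sum_list (parts p) \<le> D"
  shows "\<forall>p\<in>set ps. length (parts p) \<le> Suc D"
  using assms length_parts_le by (meson le_SucI order_trans)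

text \<open>Duplication along a permutation only permutes the letters, so it carries the words of
  weight \<open>ps\<close> onto those of weight \<open>qs\<close>, and a basis to a spanning
  set.\<close>

lemma weight_dim_permute_le:
  assumes small: "\<forall>p\<in>set ps. sum_list (parts p) \<le> D" and ms: "mset qs = mset ps"
  shows "weight_dim F qs \<le> weight_dim F ps"
proof -
  let ?N = "Suc D"
  let ?n = "length ps"
  have sq: "set qs = set ps" "length qs = ?n" using ms by (metis set_mset_mset, metis size_mset)
  obtain f where f: "f permutes {..<?n}" "permute_list f ps = qs"
    using mset_eq_permutation[OF ms] by blast
  define g where "g = map f [0..<?n]"
  have g: "set g = {..<?n}" using permutes_image[OF f(1)] by (simp add: g_def atLeast0LessThan)
  have lg: "length g = ?n" by (simp add: g_def)
  let ?D = "mor F (cube ?n ?N) (cube (length g) ?N) g (basis_mor (dup g))"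
  let ?W = "\<lambda>ps. word_elt ?N ` partition_words ?N ps"
  have dim: "weight_dim F rs = dim (?W rs)" if "set rs = set ps" for rs
    using weight_dim_eq[OF length_le_if_small] weight_space_words[OF length_le_if_small] small that by simp
  obtain B where B: "B \<subseteq> ?W ps" "independent B" "?W ps \<subseteq> span B" "card B = dim (?W ps)"
    by (rule basis_exists)
  have "finite (partition_words ?N ps)"
  proof (rule finite_subset)
    show "partition_words ?N ps \<subseteq> wm.words ?n"
      unfolding partition_words_def wm.words_def by (auto dest: map_eq_imp_length_eq)
  qed (rule wm.finite_words)
  then have fB: "finite B" using B(1) finite_subset by blast
  have WE: "?W ps \<subseteq> wm.E ?n"
    unfolding partition_words_def wm.words_def by (auto dest: map_eq_imp_length_eq intro!: span_base simp del: word_elt.simps)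
  have "?W qs \<subseteq> span (?D ` B)"
  proof
    fix t assume "t \<in> ?W qs"
    then obtain p where p: "t = word_elt ?N p" "p \<in> partition_words ?N qs" by (rule imageE)
    obtain \<sigma> c' where "p = (\<sigma>, c')" by (metis prod.exhaust)
    with p have t: "t = word_elt ?N (\<sigma>, c')" and c': "\<sigma> \<in> shapes" "c' \<in> lists (letters ?N)"
      "map (letter_weight \<sigma>) c' = map Defs.part qs" unfolding partition_words_def by simp_all
    have lc': "length c' = ?n" using arg_cong[OF c'(3), of length] sq by simp
    \<comment> \<open>The letters of \<open>c'\<close> moved back, so that composition with
      \<open>g\<close> returns \<open>c'\<close>.\<close>
    define c where "c = map (\<lambda>i. c' ! (inv f i)) [0..<?n]"
    have fi: "inv f i < ?n" "f i < ?n" if "i < ?n" for i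
      using permutes_in_image[OF f(1)] permutes_in_image[OF permutes_inv[OF f(1)]] that by auto
    have c'c: "map ((!) c) g = c'"
      by (rule nth_equalityI) (use lc' fi permutes_inverses[OF f(1)] in \<open>auto simp: g_def c_def\<close>)
    have "letter_weight \<sigma> (c ! i) = Defs.part (ps ! i)" if "i < ?n" for i
    proof -
      have "letter_weight \<sigma> (c ! i) = map (letter_weight \<sigma>) c' ! inv f i" using that fi lc' by (simp add: c_def)
      also have "\<dots> = Defs.part (qs ! inv f i)" unfolding c'(3) using that fi sq by simp
      also have "qs ! inv f i = ps ! i"
        unfolding f(2)[symmetric] using that fi permutes_inverses[OF f(1)] by (simp add: permute_list_def)
      finally show ?thesis .
    qed
    then have "map (letter_weight \<sigma>) c = map Defs.part ps" by (intro nth_equalityI) (auto simp: c_def)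
    moreover have cl: "c \<in> lists (letters ?N)" using c'(2) lc' fi nth_mem by (force simp: c_def)
    ultimately have "word_elt ?N (\<sigma>, c) \<in> span B" using B(3) c'(1) unfolding partition_words_def by blast
    then have "?D (word_elt ?N (\<sigma>, c)) \<in> span (?D ` B)"
      using wm.D_span[OF g, of B "?D ` B"] B(1) WE by (blast intro: span_base)
    moreover have "?D (word_elt ?N (\<sigma>, c)) = t"
      using mor_dup_word_elt[OF c'(1) cl, of g ?N] g c'c t by (simp add: c_def)
    ultimately show "t \<in> span (?D ` B)" by simp
  qed
  then have "dim (?W qs) \<le> card (?D ` B)" using fB by (intro dim_le_card) auto
  also have "\<dots> \<le> card B" using fB by (rule card_image_le)
  finally show ?thesis using dim sq B(4) by simp
qed

lemma weight_dim_permute: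
  assumes "\<forall>p\<in>set ps. sum_list (parts p) \<le> D" "mset qs = mset ps"
  shows "weight_dim F qs = weight_dim F ps"
proof (rule antisym)
  show "weight_dim F qs \<le> weight_dim F ps" by (rule weight_dim_permute_le[OF assms])
  have "set qs = set ps" using assms(2) by (metis set_mset_mset)
  then show "weight_dim F ps \<le> weight_dim F qs" using assms by (intro weight_dim_permute_le) auto
qed

section \<open>From weight multiplicities to the Hilbert series\<close>

lemma ch_eq:
  assumes small: "\<forall>p\<in>set ps. sum_list (parts p) \<le> D"
  shows "ch F n (msum ps) = (if n = length ps then of_nat (card (permutations_of_multiset (mset ps)) * weight_dim F ps) else 0)"
proof -
  have eq: "{qs. length qs = n \<and> (\<Sum>p\<leftarrow>qs. single p 1) = msum ps} =
     (if n = length ps then permutations_of_multiset (mset ps) else {})"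
    unfolding msum_def[symmetric] msum_eq_iff permutations_of_multiset_def
    by (auto dest: mset_eq_length)
  show ?thesis
  proof (cases "n = length ps")
    case True
    have "ch F n (msum ps) = (\<Sum>qs\<in>permutations_of_multiset (mset ps). of_nat (weight_dim F qs))"
      unfolding ch_def eq if_P[OF True] ..
    also have "\<dots> = (\<Sum>qs\<in>permutations_of_multiset (mset ps). of_nat (weight_dim F ps))"
    proof (rule sum.cong[OF refl])
      fix qs assume "qs \<in> permutations_of_multiset (mset ps)"
      then have "mset qs = mset ps" by (simp add: permutations_of_multiset_def)
      from weight_dim_permute[OF small this]
      show "(of_nat (weight_dim F qs) :: rat) = of_nat (weight_dim F ps)" by (simp only:)
    qed
    finally show ?thesis using True by simp
  next
    case False
    then show ?thesis unfolding ch_def eq by simp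
  qed
qed

lemma ch_zero:
  assumes "p \<in> keys \<mu>" "D < sum_list (parts p)"
  shows "ch F n \<mu> = 0"
  unfolding ch_def
proof (rule sum.neutral, rule ballI)
  fix qs assume "qs \<in> {qs. length qs = n \<and> (\<Sum>p\<leftarrow>qs. single p 1) = \<mu>}"
  then have "\<mu> = msum qs" by (simp add: msum_def)
  then have "p \<in> set qs" using assms(1) by simp
  then show "of_nat (weight_dim F qs) = (0 :: rat)" using weight_dim_zero assms(2) by simp
qed

text \<open>The number of orderings of \<open>ps\<close> is \<open>n!\<close> divided by the
  factorials of the multiplicities, and the factor \<open>1/n!\<close> of the Hilbert series cancels
  the numerator.\<close>

lemma hilbert_series_eq:
  assumes small: "\<forall>p\<in>set ps. sum_list (parts p) \<le> D"
  shows "hilbert_series F (msum ps) = of_nat (weight_dim F ps) / (\<Prod>p\<in>set ps. fact (count (mset ps) p))"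
proof -
  let ?n = "length ps" and ?P = "\<Prod>p\<in>set ps. fact (count (mset ps) p) :: nat"
  let ?c = "card (permutations_of_multiset (mset ps))"
  have eq: "?c * ?P = fact ?n"
    using card_permutations_of_multiset_aux[of "mset ps"] by simp
  have "hilbert_series F (msum ps) = ch F ?n (msum ps) / fact ?n"
  proof -
    have "{n. ch F n (msum ps) \<noteq> 0} = (if ch F ?n (msum ps) \<noteq> 0 then {?n} else {})"
      using ch_eq[OF small] by auto
    then show ?thesis by (simp add: hilbert_series_def)
  qed
  also have "\<dots> = of_nat (?c * weight_dim F ps) / of_nat (?c * ?P)"
    unfolding eq using ch_eq[OF small] by simp
  also have "\<dots> = of_nat (weight_dim F ps) / of_nat ?P"
  proof -
    have "?c \<noteq> 0" using eq by (metis fact_nonzero mult_zero_left)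
    then show ?thesis by simp
  qed
  finally show ?thesis by simp
qed

text \<open>The multiplicity of the sorted representative \<open>block_word vs \<mu>\<close> is,
  summed over shapes, the number of words with the prescribed letter weights that avoid
  \<open>R \<sigma>\<close>; this is the numerator of \<open>block_series\<close>.\<close>

theorem hilbert_series_exp_polynomial: "hilbert_series F \<in> exp_polynomials"
proof -
  let ?S = "{p. sum_list (parts p) \<le> D}" and ?N = "Suc D"
  obtain vs where vs: "set vs = ?S" "distinct vs"
    using finite_distinct_list[OF finite_partitions_le] by blast
  obtain R where R: "\<And>ws. dim (span (word_elt ?N ` wm.weight_words letter_weight ws)) =
     (\<Sum>\<sigma>\<in>shapes. card {c \<in> lists (letters ?N). map (letter_weight \<sigma>) c = ws \<and> avoids ({}, R \<sigma>) c})"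
    using wm.dim_weight_words[of letter_weight] by blast
  define B where "B \<sigma> p = {l \<in> letters ?N. letter_weight \<sigma> l = Defs.part p}" for \<sigma> p
  have "hilbert_series F = (\<lambda>\<mu>. \<Sum>\<sigma>\<in>shapes. block_series (B \<sigma>) vs ({}, R \<sigma>) \<mu>)"
  proof
    fix \<mu>
    show "hilbert_series F \<mu> = (\<Sum>\<sigma>\<in>shapes. block_series (B \<sigma>) vs ({}, R \<sigma>) \<mu>)"
    proof (cases "keys \<mu> \<subseteq> ?S")
      case False
      then obtain p where "p \<in> keys \<mu>" "D < sum_list (parts p)" by force
      then have "ch F n \<mu> = 0" for n by (rule ch_zero)
      then have "hilbert_series F \<mu> = 0" by (simp add: hilbert_series_def)
      moreover have "block_series (B \<sigma>) vs ({}, R \<sigma>) \<mu> = 0" for \<sigma>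
        using False vs by (simp add: block_series_def)
      ultimately show ?thesis by simp
    next
      case True
      let ?ps = "block_word vs \<mu>"
      have small: "\<forall>p\<in>set ?ps. sum_list (parts p) \<le> D"
        using vs(1) by (auto simp: block_word_def)
      have count: "count (mset (block_word us \<mu>)) p = (if p \<in> set us then lookup \<mu> p else 0)"
        if "distinct us" for us p
        using that by (induction us) (auto simp: block_word_def count_replicate_mset)
      have lookup: "count (mset ?ps) p = lookup \<mu> p" for p
        using count[OF vs(2), of p] True vs(1) by (auto simp: in_keys_iff)
      have \<mu>: "\<mu> = msum ?ps"
        by (rule poly_mapping_eqI) (simp add: lookup_msum lookup)
      have "weight_dim F ?ps = dim (span (word_elt ?N ` wm.weight_words letter_weight (map Defs.part ?ps)))"
        using weight_dim_eq[OF length_le_if_small[OF small]] weight_space_words[OF length_le_if_small[OF small]]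
        by (simp add: partition_words_def wm.weight_words_def)
      also have "\<dots> = (\<Sum>\<sigma>\<in>shapes. card {c \<in> lifts (B \<sigma>) ?ps. avoids ({}, R \<sigma>) c})"
      proof -
        have "c \<in> lifts (B \<sigma>) ps \<longleftrightarrow> c \<in> lists (letters ?N) \<and> map (letter_weight \<sigma>) c = map Defs.part ps" for c \<sigma> ps
        proof (induction c arbitrary: ps)
          case (Cons l c)
          then show ?case by (cases ps) (auto simp: lifts_def B_def)
        qed (auto simp: lifts_def)
        then show ?thesis unfolding R by (intro sum.cong refl arg_cong[of _ _ card]) auto
      qed
      finally have wd: "weight_dim F ?ps = (\<Sum>\<sigma>\<in>shapes. card {c \<in> lifts (B \<sigma>) ?ps. avoids ({}, R \<sigma>) c})" .
      \<comment> \<open>Partitions absent from \<open>\<mu>\<close> contribute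
        \<open>fact 0 = 1\<close>, so the denominator may run over all of \<open>vs\<close>.\<close>
      have "(\<Prod>p\<in>set ?ps. fact (count (mset ?ps) p)) = (\<Prod>p\<in>set vs. fact (lookup \<mu> p) :: rat)"
        unfolding lookup
      proof (rule prod.mono_neutral_left)
        show "set ?ps \<subseteq> set vs" by (auto simp: block_word_def)
        show "\<forall>p\<in>set vs - set ?ps. fact (lookup \<mu> p) = (1 :: rat)"
        proof
          fix p assume "p \<in> set vs - set ?ps"
          then have "count (mset ?ps) p = 0" by (simp add: count_eq_zero_iff)
          then show "fact (lookup \<mu> p) = (1 :: rat)" using lookup[of p] by simp
        qed
      qed simp
      then have "hilbert_series F \<mu> = of_nat (weight_dim F ?ps) / (\<Prod>p\<in>set vs. fact (lookup \<mu> p))"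
        using hilbert_series_eq[OF small] \<mu> by simp
      then show ?thesis using True vs(1)
        unfolding wd block_series_def by (simp add: sum_divide_distrib)
    qed
  qed
  moreover have "(\<lambda>\<mu>. \<Sum>\<sigma>\<in>shapes. block_series (B \<sigma>) vs ({}, R \<sigma>) \<mu>) \<in> exp_polynomials"
    by (intro exp_polynomials_sum finite_shapes block_series_exp_polynomials[OF finite_letters[of ?N]])
      (auto simp: B_def vs)
  ultimately show ?thesis by simp
qed

end

theorem theorem9p2p3:
  fixes F :: "('k::field, 'm::ab_group_add) vec_delta_functor"
  assumes "delta_module F"
    and "finitely_generated F"
  shows "noetherian F \<and> hilbert_series F \<in> exp_polynomials"
proof -
  interpret vector_space "scl F"
    using assms(1) by (simp add: delta_module_def is_functor_def)
  interpret delta_functor F by unfold_locales (rule assms(1))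
  obtain gens D where "generated_delta_functor F gens D" using ex_generated[OF assms(2)] by blast
  then interpret generated_delta_functor F gens D .
  show ?thesis using noetherian hilbert_series_exp_polynomial by blast
qed

end
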